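(* Assume that $g\in C^1(\mathbb R)$, $g(0)=0$; that there exists $\lambda\ge 0$ such that $g'(r)\ge-\lambda$ for all $r\in\mathbb R$; and that $\liminf_{|r|\to\infty}\big(g(r)r+(\lambda_1-\kappa)r^2\big)>0$ for some $\kappa>0$. Set $\beta(r):=g(r)+\lambda r$ and let $\widehat\beta$ be a primitive of $\beta$. Let $u_0\in\mathcal X_{\sigma0}$ with $\widehat\beta(u_0)\in L^1(\Omega)$. Let $0\le S<T\le\infty$ and let $(u,w)$ be a weak solution of the fractional Cahn-Hilliard system over $(S,T)$ (with $u(0)=u_0$ if $S=0$) additionally satisfying either $$u\in L^2_{\rm loc}(S,T;\mathcal X_{s0})\qquad\text{or}\qquad u_t\in L^2_{\rm loc}(S,T;L^2(\Omega)).$$ Then $$\|w(t)\|_{\mathcal X_{s0}}^2+\frac{d}{dt}\mathbb E_\sigma(u(t))=0\quad\text{for a.a. }t\in(S,T),$$ $$\langle u_t(t),\mathfrak A_\sigma u(t)+g(u(t))\rangle_{\mathcal X_{s0}}=\frac{d}{dt}\mathbb E_\sigma(u(t))\quad\text{for a.a. }t\in(S,T),$$ $$\int_\tau^t\|w(r)\|_{\mathcal X_{s0}}^2\,dr+\mathbb E_\sigma(u(t))=\mathbb E_\sigma(u(\tau))\quad\text{for all }S\le\tau\le t<T.$$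
   Context: $\Omega\subset\mathbb R^N$ is a bounded domain with smooth boundary and $s,\sigma\in(0,1)$. Functions in $L^p(\Omega)$ are identified with their extensions by zero to $\mathbb R^N$. For $a\in(0,1)$, $C_a>0$ denotes the normalization constant (depending only on $N$ and $a$) in the singular-integral definition $(-\Delta)^a u(x)=C_a\,\mathrm{p.v.}\int_{\mathbb R^N}\frac{u(x)-u(y)}{|x-y|^{N+2a}}dy$, and $$\mathcal X_{a0}:=\{v\in H^a(\mathbb R^N): v=0\text{ a.e. in }\mathbb R^N\setminus\Omega\},\qquad \|v\|_{\mathcal X_{a0}}^2:=\frac{C_a}{2}\iint_{\mathbb R^{2N}}\frac{|v(x)-v(y)|^2}{|x-y|^{N+2a}}\,dx\,dy,$$ a Hilbert space with dual $\mathcal X_{a0}'$; $\mathcal X_{a0}\hookrightarrow L^2(\Omega)\simeq L^2(\Omega)'\hookrightarrow\mathcal X_{a0}'$. The operator $\mathfrak A_a:\mathcal X_{a0}\to\mathcal X_{a0}'$ is defined by $$\langle\mathfrak A_a u,v\rangle_{\mathcal X_{a0}}=\frac{C_a}{2}\iint_{\mathbb R^{2N}}\frac{(u(x)-u(y))(v(x)-v(y))}{|x-y|^{N+2a}}\,dx\,dy .$$ $\lambda_1=\inf_{v\in\mathcal X_{\sigma0}\setminus\{0\}}\|v\|_{\mathcal X_{\sigma0}}^2/\|v\|_{L^2(\Omega)}^2>0$ is the first eigenvalue of the fractional Dirichlet Laplacian of order $\sigma$. Energy: with $\widehat g$ a fixed primitive of $g$, $\mathbb E_\sigma(v):=\frac12\|v\|_{\mathcal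 X_{\sigma0}}^2+\int_\Omega\widehat g(v(x))\,dx$ for $v\in\mathcal X_{\sigma0}$ with $\widehat g(v)^-\in L^1(\Omega)$ ($(\cdot)^-$ is the negative part). The fractional Cahn-Hilliard system is $u_t+(-\Delta)^s w=0$, $w=(-\Delta)^\sigma u+g(u)$ in $\Omega\times(0,\infty)$, $u|_{t=0}=u_0$ in $\Omega$, $u=w=0$ in $\mathbb R^N\setminus\Omega$. Weak solution: for $0\le S<T\le\infty$, $(u,w)$ is a weak solution on $(S,T)$ if $u\in C_w([S,T);\mathcal X_{\sigma0})$ (weakly continuous), $u_t\in L^2(S,T;\mathcal X_{s0}')$, $w\in L^2(S,T;\mathcal X_{s0})$, $g(u)\in L^2_{\rm loc}(S,T;L^2(\Omega))$, and for a.e. $t\in(S,T)$: $u_t(t)+\mathfrak A_s w(t)=0$ in $\mathcal X_{s0}'$ and $w(t)=\mathfrak A_\sigma u(t)+g(u(t))$ in $\mathcal X_{\sigma0}'$. Here $L^p_{\rm loc}(S,T;X)$ means $L^p(S,T;X)$ if $T<\infty$ and $L^p_{\rm loc}([S,\infty);X)$ if $T=\infty$. In the second energy identity, $\mathfrak A_\sigma u(t)+g(u(t))$ is identified with $w(t)\in\mathcal X_{s0}$. *)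

theory Defs
  imports "HOL-Analysis.Analysis"
begin

text \<open>
  Functions on the Euclidean space are total functions that are Borel measurable; equality in a
  function space is equality almost everywhere (every Lebesgue class has a Borel representative).
  All norms below are therefore seminorms on representatives.
\<close>

primrec C_k :: "nat \<Rightarrow> ('a::euclidean_space \<Rightarrow> real) \<Rightarrow> bool" where
  "C_k 0 f \<longleftrightarrow> continuous_on UNIV f"
| "C_k (Suc k) f \<longleftrightarrow>
     (\<forall>x. f differentiable (at x)) \<and> (\<forall>v. C_k k (\<lambda>x. frechet_derivative f (at x) v))"

definition C_infinity :: "('a::euclidean_space \<Rightarrow> real) \<Rightarrow> bool" where
  "C_infinity f \<longleftrightarrow> (\<forall>k. C_k k f)"

text \<open>
  Near each boundary point the domain is the strict epigraph, in some direction \<open>e\<close>, of a smooth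
  function of the coordinates orthogonal to \<open>e\<close> (a function on the whole space which is constant
  along \<open>e\<close>).
\<close>

definition smooth_boundary :: "'a::euclidean_space set \<Rightarrow> bool" where
  "smooth_boundary \<Omega> \<longleftrightarrow>
     (\<forall>p \<in> frontier \<Omega>. \<exists>r > 0. \<exists>e \<gamma>.
        norm e = 1 \<and> C_infinity \<gamma> \<and> (\<forall>x c. \<gamma> (x + c *\<^sub>R e) = \<gamma> x) \<and>
        \<Omega> \<inter> ball p r = {x \<in> ball p r. \<gamma> x < x \<bullet> e})"

definition smooth_bounded_domain :: "'a::euclidean_space set \<Rightarrow> bool" where
  "smooth_bounded_domain \<Omega> \<longleftrightarrow>
     open \<Omega> \<and> connected \<Omega> \<and> \<Omega> \<noteq> {} \<and> bounded \<Omega> \<and> smooth_boundary \<Omega>"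

definition L2_space :: "'a::euclidean_space set \<Rightarrow> ('a \<Rightarrow> real) set" where
  "L2_space \<Omega> = {v \<in> borel_measurable borel.
     integrable lborel (\<lambda>x. (v x)\<^sup>2) \<and> (AE x in lborel. x \<notin> \<Omega> \<longrightarrow> v x = 0)}"

definition L2_inner :: "'a::euclidean_space set \<Rightarrow> ('a \<Rightarrow> real) \<Rightarrow> ('a \<Rightarrow> real) \<Rightarrow> real" where
  "L2_inner \<Omega> u v = (LINT x:\<Omega>|lborel. u x * v x)"

definition L2_norm :: "'a::euclidean_space set \<Rightarrow> ('a \<Rightarrow> real) \<Rightarrow> real" where
  "L2_norm \<Omega> v = sqrt (L2_inner \<Omega> v v)"

text \<open>
  The constant for which the singular integral has Fourier symbol \<open>|\<xi>|\<^sup>2\<^sup>a\<close>: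
  \<open>4\<^sup>a \<Gamma>(N/2 + a) / (\<pi>\<^sup>N\<^sup>/\<^sup>2 |\<Gamma>(-a)|)\<close>, where \<open>|\<Gamma>(-a)| = \<Gamma>(1 - a) / a\<close> for \<open>0 < a < 1\<close>.
\<close>

definition frac_const :: "nat \<Rightarrow> real \<Rightarrow> real" where
  "frac_const N a =
     4 powr a * a * Gamma (real N / 2 + a) / (pi powr (real N / 2) * Gamma (1 - a))"

definition frac_kernel :: "real \<Rightarrow> ('a::euclidean_space) \<Rightarrow> 'a \<Rightarrow> real" where
  "frac_kernel a x y = 1 / norm (x - y) powr (real DIM('a) + 2 * a)"

definition H_frac :: "real \<Rightarrow> ('a::euclidean_space \<Rightarrow> real) set" where
  "H_frac a = {v \<in> borel_measurable borel.
     integrable lborel (\<lambda>x. (v x)\<^sup>2) \<and>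
     integrable (lborel \<Otimes>\<^sub>M lborel) (\<lambda>(x, y). (v x - v y)\<^sup>2 * frac_kernel a x y)}"

definition X0 :: "'a::euclidean_space set \<Rightarrow> real \<Rightarrow> ('a \<Rightarrow> real) set" where
  "X0 \<Omega> a = {v \<in> H_frac a. AE x in lborel. x \<notin> \<Omega> \<longrightarrow> v x = 0}"

text \<open>\<open>frac_lap a u\<close> is the operator \<open>\<AA>\<^sub>a\<close>, with values in the functionals on \<open>X0 \<Omega> a\<close>.\<close>

definition frac_lap :: "real \<Rightarrow> ('a::euclidean_space \<Rightarrow> real) \<Rightarrow> ('a \<Rightarrow> real) \<Rightarrow> real" where
  "frac_lap a u v = frac_const DIM('a) a / 2 *
     (\<integral>(x, y). (u x - u y) * (v x - v y) * frac_kernel a x y \<partial>(lborel \<Otimes>\<^sub>M lborel))"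

definition X0_norm :: "real \<Rightarrow> ('a::euclidean_space \<Rightarrow> real) \<Rightarrow> real" where
  "X0_norm a v = sqrt (frac_const DIM('a) a / 2 *
     (\<integral>(x, y). (v x - v y)\<^sup>2 * frac_kernel a x y \<partial>(lborel \<Otimes>\<^sub>M lborel)))"

text \<open>
  Elements of the dual are functionals on all functions, of which only the values on \<open>X0 \<Omega> a\<close>
  matter. The embedding of \<open>L\<^sup>2(\<Omega>)\<close> into the dual is \<open>L2_inner \<Omega>\<close>.
\<close>

definition X0_dual :: "'a::euclidean_space set \<Rightarrow> real \<Rightarrow> (('a \<Rightarrow> real) \<Rightarrow> real) set" where
  "X0_dual \<Omega> a = {l.
     (\<forall>u \<in> X0 \<Omega> a. \<forall>v \<in> X0 \<Omega> a. l (\<lambda>x. u x + v x) = l u + l v) \<and>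
     (\<forall>c. \<forall>v \<in> X0 \<Omega> a. l (\<lambda>x. c * v x) = c * l v) \<and>
     (\<exists>K. \<forall>v \<in> X0 \<Omega> a. \<bar>l v\<bar> \<le> K * X0_norm a v)}"

definition X0_dual_norm :: "'a::euclidean_space set \<Rightarrow> real \<Rightarrow> (('a \<Rightarrow> real) \<Rightarrow> real) \<Rightarrow> real" where
  "X0_dual_norm \<Omega> a l = Sup {\<bar>l v\<bar> | v. v \<in> X0 \<Omega> a \<and> X0_norm a v \<le> 1}"

definition lambda_1 :: "'a::euclidean_space set \<Rightarrow> real \<Rightarrow> real" where
  "lambda_1 \<Omega> \<sigma> = Inf {(X0_norm \<sigma> v)\<^sup>2 / (L2_norm \<Omega> v)\<^sup>2 | v.
     v \<in> X0 \<Omega> \<sigma> \<and> \<not> (AE x in lborel. v x = 0)}"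

definition time_interval :: "real \<Rightarrow> ereal \<Rightarrow> real set" where
  "time_interval S T = {t. S < t \<and> ereal t < T}"

definition time_interval0 :: "real \<Rightarrow> ereal \<Rightarrow> real set" where
  "time_interval0 S T = {t. S \<le> t \<and> ereal t < T}"

text \<open>
  The Bochner space \<open>L\<^sup>2(I; V)\<close> for a space \<open>V\<close> of real functions with norm \<open>nrm\<close>; strong
  measurability means being an almost everywhere limit of simple functions. It is used with \<open>V\<close>
  consisting of functions on the Euclidean space and with \<open>V\<close> consisting of functionals.
\<close>

definition strongly_measurable ::
  "real set \<Rightarrow> ('b \<Rightarrow> real) set \<Rightarrow> (('b \<Rightarrow> real) \<Rightarrow> real) \<Rightarrow> (real \<Rightarrow> 'b \<Rightarrow> real) \<Rightarrow> bool" where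
  "strongly_measurable I V nrm f \<longleftrightarrow>
     (AE t in lebesgue_on I. f t \<in> V) \<and>
     (\<exists>h :: nat \<Rightarrow> real \<Rightarrow> 'b \<Rightarrow> real.
        (\<forall>n. simple_function (lebesgue_on I) (h n) \<and> h n ` I \<subseteq> V) \<and>
        (AE t in lebesgue_on I. (\<lambda>n. nrm (\<lambda>x. h n t x - f t x)) \<longlonglongrightarrow> 0))"

definition bochner_L2 ::
  "real set \<Rightarrow> ('b \<Rightarrow> real) set \<Rightarrow> (('b \<Rightarrow> real) \<Rightarrow> real) \<Rightarrow> (real \<Rightarrow> 'b \<Rightarrow> real) \<Rightarrow> bool" where
  "bochner_L2 I V nrm f \<longleftrightarrow>
     strongly_measurable I V nrm f \<and> integrable (lebesgue_on I) (\<lambda>t. (nrm (f t))\<^sup>2)"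

definition bochner_L2_loc ::
  "real \<Rightarrow> ereal \<Rightarrow> ('b \<Rightarrow> real) set \<Rightarrow> (('b \<Rightarrow> real) \<Rightarrow> real) \<Rightarrow> (real \<Rightarrow> 'b \<Rightarrow> real) \<Rightarrow> bool" where
  "bochner_L2_loc S T V nrm f \<longleftrightarrow>
     (if T = \<infinity> then \<forall>R > S. bochner_L2 {S<..<R} V nrm f
      else bochner_L2 (time_interval S T) V nrm f)"

definition test_function :: "real set \<Rightarrow> (real \<Rightarrow> real) \<Rightarrow> bool" where
  "test_function I \<phi> \<longleftrightarrow>
     C_infinity \<phi> \<and> compact (closure {t. \<phi> t \<noteq> 0}) \<and> closure {t. \<phi> t \<noteq> 0} \<subseteq> I"

text \<open>
  \<open>u'\<close> is the derivative of \<open>u\<close> in the sense of distributions on \<open>I\<close> with values in the dual of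
  \<open>X0 \<Omega> a\<close>, where \<open>u(t) \<in> L\<^sup>2(\<Omega>)\<close> is embedded into this dual: the identity between the dual-valued
  integrals of \<open>\<phi>' u\<close> and \<open>- \<phi> u'\<close> is evaluated at each \<open>z \<in> X0 \<Omega> a\<close>.
\<close>

definition has_time_derivative ::
  "'a::euclidean_space set \<Rightarrow> real \<Rightarrow> real set \<Rightarrow> (real \<Rightarrow> 'a \<Rightarrow> real)
    \<Rightarrow> (real \<Rightarrow> ('a \<Rightarrow> real) \<Rightarrow> real) \<Rightarrow> bool" where
  "has_time_derivative \<Omega> a I u u' \<longleftrightarrow>
     (\<forall>\<phi>. test_function I \<phi> \<longrightarrow> (\<forall>z \<in> X0 \<Omega> a.
        (LINT t|lebesgue_on I. deriv \<phi> t * L2_inner \<Omega> (u t) z)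
          = - (LINT t|lebesgue_on I. \<phi> t * u' t z)))"

definition weakly_continuous ::
  "'a::euclidean_space set \<Rightarrow> real \<Rightarrow> real set \<Rightarrow> (real \<Rightarrow> 'a \<Rightarrow> real) \<Rightarrow> bool" where
  "weakly_continuous \<Omega> a I u \<longleftrightarrow>
     (\<forall>t \<in> I. u t \<in> X0 \<Omega> a) \<and> (\<forall>l \<in> X0_dual \<Omega> a. continuous_on I (\<lambda>t. l (u t)))"

text \<open>
  The energy takes values in \<open>(-\<infinity>, \<infinity>]\<close> as long as the negative part is integrable; for
  \<open>v \<in> X0 \<Omega> \<sigma>\<close> it is finite exactly if \<open>gh \<circ> v\<close> is integrable on \<open>\<Omega>\<close>
  (note that \<open>\<infinity> - \<infinity> = \<infinity>\<close> in type \<open>ereal\<close>).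
\<close>

definition energy ::
  "'a::euclidean_space set \<Rightarrow> real \<Rightarrow> (real \<Rightarrow> real) \<Rightarrow> ('a \<Rightarrow> real) \<Rightarrow> ereal" where
  "energy \<Omega> \<sigma> gh v = ereal ((X0_norm \<sigma> v)\<^sup>2 / 2) +
     (enn2ereal (\<integral>\<^sup>+x\<in>\<Omega>. ennreal (gh (v x)) \<partial>lborel)
       - enn2ereal (\<integral>\<^sup>+x\<in>\<Omega>. ennreal (- gh (v x)) \<partial>lborel))"

text \<open>\<open>u'\<close> is the time derivative of \<open>u\<close>, which is determined by \<open>u\<close> up to a null set of times.\<close>

definition weak_solution ::
  "'a::euclidean_space set \<Rightarrow> real \<Rightarrow> real \<Rightarrow> (real \<Rightarrow> real) \<Rightarrow> real \<Rightarrow> ereal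
    \<Rightarrow> (real \<Rightarrow> 'a \<Rightarrow> real) \<Rightarrow> (real \<Rightarrow> ('a \<Rightarrow> real) \<Rightarrow> real) \<Rightarrow> (real \<Rightarrow> 'a \<Rightarrow> real) \<Rightarrow> bool" where
  "weak_solution \<Omega> s \<sigma> g S T u u' w \<longleftrightarrow>
     weakly_continuous \<Omega> \<sigma> (time_interval0 S T) u \<and>
     has_time_derivative \<Omega> s (time_interval S T) u u' \<and>
     bochner_L2 (time_interval S T) (X0_dual \<Omega> s) (X0_dual_norm \<Omega> s) u' \<and>
     bochner_L2 (time_interval S T) (X0 \<Omega> s) (X0_norm s) w \<and>
     bochner_L2_loc S T (L2_space \<Omega>) (L2_norm \<Omega>) (\<lambda>t x. g (u t x)) \<and>
     (AE t in lebesgue_on (time_interval S T).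
        (\<forall>z \<in> X0 \<Omega> s. u' t z + frac_lap s (w t) z = 0) \<and>
        (\<forall>z \<in> X0 \<Omega> \<sigma>. L2_inner \<Omega> (w t) z
           = frac_lap \<sigma> (u t) z + L2_inner \<Omega> (\<lambda>x. g (u t x)) z))"

end

theory Submission
  imports Defs
begin

text \<open>
  By the two equations, the function \<open>w(t)\<close> is, for almost every \<open>t\<close>, a subgradient of the semiconvex
  energy at \<open>u(t)\<close>, while \<open>u\<close> has the weak derivative \<open>- \<AA>\<^sub>s w\<close>. Testing \<open>u(\<tau>) - u(t)\<close> with \<open>w(t)\<close>
  gives, for almost every \<open>t\<close> and all \<open>\<tau>\<close>,
  \<open>E(u(\<tau>)) \<ge> E(u(t)) - \<integral>\<^sub>t\<^sup>\<tau> (w(r), w(t)) dr - (\<lambda>/2) |u(\<tau>) - u(t)|\<^sup>2\<close>. Either regularity hypothesis controls the last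
  term and makes \<open>u\<close> strongly continuous in \<open>L\<^sup>2\<close>; then the energy is lower semicontinuous in time by
  Fatou's lemma. Summing the inequality in both directions over partitions whose points have small
  slope bounds the increments of the energy by integrals of an integrable function, and at Lebesgue
  points the inequality identifies the derivative as \<open>- |w(t)|\<^sup>2\<close>.
\<close>

section \<open>Lebesgue differentiation on the line\<close>

text \<open>The chain rule cannot be applied term by term: \<open>u_t\<close> lives in the dual of
  \<open>X0 \<Omega> s\<close>, and of the expression A u + g(u) only the whole, \<open>w\<close>,
  is known to lie in \<open>X0 \<Omega> s\<close>. The L2 pairing of \<open>w(t)\<close> with
  \<open>u(\<tau>) - u(t)\<close> is the place where the two equations meet: the difference tests
  the second one, \<open>w(t)\<close> tests the first. The resulting inequality has a slope factor
  that is only square integrable in time, so no single base time gives a uniform modulus of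
  continuity. The cure is to choose in every cell of a partition a time whose squared slope is at
  most the cell average plus one. Moreover the energy is known to be finite only at almost every
  time, while the identity is claimed at every time, \<open>S\<close> included. Finiteness is
  therefore propagated together with the increment bound, by lower semicontinuity at the end points.
  Equality arises although only a lower bound is available, because \<tau> may lie on either side of
  t.\<close>

lemma integrable_on_Icc_subset:
  fixes f :: "real \<Rightarrow> real"
  shows "f integrable_on {a..b} \<Longrightarrow> a \<le> x \<Longrightarrow> y \<le> b \<Longrightarrow> f integrable_on {x..y}"
  by (rule integrable_on_subinterval) auto

lemma integral_Icc_add:
  fixes f :: "real \<Rightarrow> real"
  assumes "f integrable_on {a..b}" "a \<le> x" "x \<le> y" "y \<le> b"
  shows "integral {a..x} f + integral {x..y} f = integral {a..y} f"
  by (rule Henstock_Kurzweil_Integration.integral_combine)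
    (use assms integrable_on_Icc_subset[OF assms(1)] in auto)

text \<open>The two times come in either order, since the subgradient inequality is tested on both
  sides of the base time; hence the min/max end points.\<close>

lemma integral_min_max_eq_abs:
  fixes f :: "real \<Rightarrow> real"
  assumes f: "f integrable_on {a..b}" "\<And>r. 0 \<le> f r" and t: "t \<in> {a..b}" "\<tau> \<in> {a..b}"
  shows "integral {min t \<tau>..max t \<tau>} f = \<bar>integral {a..\<tau>} f - integral {a..t} f\<bar>"
proof -
  have "integral {x..y} f = \<bar>integral {a..y} f - integral {a..x} f\<bar>" if "a \<le> x" "x \<le> y" "y \<le> b" for x y
  proof -
    have "0 \<le> integral {x..y} f"
      by (rule Henstock_Kurzweil_Integration.integral_nonneg[OF integrable_on_Icc_subset[OF f(1)]]) (use that f(2) in auto)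
    then show ?thesis using integral_Icc_add[OF f(1) that] by linarith
  qed
  note * = this
  show ?thesis
  proof (cases "t \<le> \<tau>")
    case False
    then show ?thesis using *[of \<tau> t] t by (subst abs_minus_commute) auto
  qed (use *[of t \<tau>] t in auto)
qed

lemma abs_integral_diff_le:
  fixes f q :: "real \<Rightarrow> real"
  assumes f: "f integrable_on {a..b}" and q: "q integrable_on {a..b}" and le: "\<And>r. \<bar>f r\<bar> \<le> q r"
    and t: "t \<in> {a..b}" "\<tau> \<in> {a..b}"
  shows "\<bar>integral {a..\<tau>} f - integral {a..t} f\<bar> \<le> integral {min t \<tau>..max t \<tau>} q"
proof -
  have *: "\<bar>integral {a..y} f - integral {a..x} f\<bar> \<le> integral {x..y} q" if "a \<le> x" "x \<le> y" "y \<le> b" for x y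
  proof -
    have fs: "f integrable_on {a..y}" "f integrable_on {x..y}" and qs: "q integrable_on {x..y}"
      using that by (auto intro: integrable_on_subinterval[OF f] integrable_on_subinterval[OF q])
    have "integral {a..y} f - integral {a..x} f = integral {x..y} f"
      using Henstock_Kurzweil_Integration.integral_combine[OF that(1,2) fs(1)] by simp
    moreover have "norm (integral {x..y} f) \<le> integral {x..y} q"
      using fs qs le by (intro integral_norm_bound_integral) auto
    ultimately show ?thesis by simp
  qed
  show ?thesis
  proof (cases "t \<le> \<tau>")
    case True
    then show ?thesis using *[of t \<tau>] t by auto
  next
    case False
    then show ?thesis using *[of \<tau> t] t by (auto simp: abs_minus_commute)
  qed
qed

text \<open>\<open>integrable_ccontinuous_explicit\<close> averages over cubes with the point as
  lower corner, which in dimension one gives right difference quotients. It asks for integrability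
  on all boxes, hence the extension \<open>f0\<close> by zero.\<close>

lemma lebesgue_right_derivative:
  fixes f :: "real \<Rightarrow> real"
  assumes "f integrable_on {a..b}"
  obtains N where "negligible N"
    "\<And>t e. t \<in> {a<..<b} - N \<Longrightarrow> 0 < e \<Longrightarrow>
      \<exists>d>0. \<forall>h. 0 < h \<and> h < d \<longrightarrow> t + h \<le> b \<and> \<bar>integral {t..t + h} f / h - f t\<bar> < e"
proof -
  define f0 where "f0 = (\<lambda>x. if x \<in> {a..b} then f x else 0)"
  have "f0 integrable_on UNIV"
    unfolding f0_def using assms integrable_restrict_UNIV by blast
  then have "\<And>c d. f0 integrable_on cbox c d"
    using integrable_on_subcbox by blast
  from integrable_ccontinuous_explicit[OF this] obtain N where N: "negligible N"
    and f0: "\<And>x e. \<lbrakk>x \<notin> N; 0 < e\<rbrakk> \<Longrightarrow> \<exists>d>0. \<forall>h. 0 < h \<and> h < d \<longrightarrow>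
      norm (integral (cbox x (x + h *\<^sub>R One)) f0 /\<^sub>R h ^ DIM(real) - f0 x) < e"
    by metis
  show ?thesis
  proof (rule that[OF N])
    fix t e :: real assume t: "t \<in> {a<..<b} - N" and e: "0 < e"
    obtain d where d: "d > 0" "\<And>h. 0 < h \<and> h < d \<Longrightarrow> \<bar>integral {t..t + h} f0 / h - f0 t\<bar> < e"
      using f0[of t e] t e by (auto simp: divide_inverse mult.commute)
    show "\<exists>d>0. \<forall>h. 0 < h \<and> h < d \<longrightarrow> t + h \<le> b \<and> \<bar>integral {t..t + h} f / h - f t\<bar> < e"
    proof (intro exI[of _ "min d (b - t)"] conjI allI impI)
      show "min d (b - t) > 0" using d t by auto
      fix h assume h: "0 < h \<and> h < min d (b - t)"
      show "t + h \<le> b" using h by auto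
      have "integral {t..t + h} f0 = integral {t..t + h} f"
        by (rule integral_cong) (use t h in \<open>auto simp: f0_def\<close>)
      then show "\<bar>integral {t..t + h} f / h - f t\<bar> < e"
        using d(2)[of h] h t by (auto simp: f0_def)
    qed
  qed
qed

text \<open>Left quotients of \<open>f\<close> at t are right quotients of the reflected function at
  -t, and reflection preserves null sets.\<close>

lemma lebesgue_differentiation:
  fixes f :: "real \<Rightarrow> real"
  assumes f: "f integrable_on {a..b}"
  obtains N where "negligible N"
    "\<And>t. t \<in> {a<..<b} - N \<Longrightarrow> ((\<lambda>t. integral {a..t} f) has_real_derivative f t) (at t)"
proof -
  have f': "(\<lambda>x. f (- x)) integrable_on {-b..-a}"
    using f Henstock_Kurzweil_Integration.integrable_reflect_real by blast
  obtain N1 where N1: "negligible N1" "\<And>t e. t \<in> {a<..<b} - N1 \<Longrightarrow> 0 < e \<Longrightarrow>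
      \<exists>d>0. \<forall>h. 0 < h \<and> h < d \<longrightarrow> t + h \<le> b \<and> \<bar>integral {t..t + h} f / h - f t\<bar> < e"
    using lebesgue_right_derivative[OF f] by metis
  obtain N2 where N2: "negligible N2" "\<And>t e. t \<in> {-b<..<-a} - N2 \<Longrightarrow> 0 < e \<Longrightarrow>
      \<exists>d>0. \<forall>h. 0 < h \<and> h < d \<longrightarrow> t + h \<le> -a \<and>
        \<bar>integral {t..t + h} (\<lambda>x. f (- x)) / h - f (- t)\<bar> < e"
    using lebesgue_right_derivative[OF f'] by metis
  show ?thesis
  proof (rule that[of "N1 \<union> uminus ` N2"])
    show "negligible (N1 \<union> uminus ` N2)"
      using N1(1) N2(1)
      by (intro negligible_Un negligible_differentiable_image_negligible)
        (auto intro!: differentiable_on_minus differentiable_on_ident)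
    fix t assume t: "t \<in> {a<..<b} - (N1 \<union> uminus ` N2)"
    then have t1: "t \<in> {a<..<b} - N1" by auto
    have t2: "- t \<in> {-b<..<-a} - N2" using t by (force simp: image_iff)
    have sub: "f integrable_on {c..d}" if "a \<le> c" "d \<le> b" for c d
      using f that by (meson atLeastatMost_subset_iff integrable_on_subinterval)
    show "((\<lambda>t. integral {a..t} f) has_real_derivative f t) (at t)"
      unfolding DERIV_def LIM_eq
    proof (intro allI impI)
      fix e :: real assume e: "0 < e"
      obtain d1 where d1: "d1 > 0" "\<And>h. 0 < h \<and> h < d1 \<Longrightarrow> t + h \<le> b \<and> \<bar>integral {t..t + h} f / h - f t\<bar> < e"
        using N1(2)[OF t1 e] by metis
      obtain d2 where d2: "d2 > 0" "\<And>h. 0 < h \<and> h < d2 \<Longrightarrow> -t + h \<le> -a \<and>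
         \<bar>integral {-t..-t + h} (\<lambda>x. f (- x)) / h - f t\<bar> < e"
        using N2(2)[OF t2 e] by (metis minus_minus)
      show "\<exists>s>0. \<forall>x::real. x \<noteq> 0 \<and> norm (x - 0) < s \<longrightarrow>
          norm ((integral {a..t + x} f - integral {a..t} f) / x - f t) < e"
      proof (intro exI[of _ "min d1 d2"] conjI allI impI)
        show "min d1 d2 > 0" using d1 d2 by auto
        fix x :: real assume x: "x \<noteq> 0 \<and> norm (x - 0) < min d1 d2"
        show "norm ((integral {a..t + x} f - integral {a..t} f) / x - f t) < e"
        proof (cases "x > 0")
          case True
          with d1(2)[of x] x have *: "t + x \<le> b" "\<bar>integral {t..t + x} f / x - f t\<bar> < e" by auto
          have "integral {a..t} f + integral {t..t + x} f = integral {a..t + x} f"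
            by (rule Henstock_Kurzweil_Integration.integral_combine) (use * True t sub in auto)
          then have "integral {a..t + x} f - integral {a..t} f = integral {t..t + x} f" by simp
          then show ?thesis using * by simp
        next
          case False
          define h where "h = - x"
          have h: "0 < h" "h < d2" using False x by (auto simp: h_def)
          with d2(2)[of h] have *: "a \<le> t - h" "\<bar>integral {-t..-t + h} (\<lambda>x. f (- x)) / h - f t\<bar> < e" by auto
          have "integral {-t..-t + h} (\<lambda>x. f (- x)) = integral {t - h..t} f"
            using Henstock_Kurzweil_Integration.integral_reflect_real[of t "t - h" f] by (simp add: algebra_simps)
          moreover have "integral {a..t - h} f + integral {t - h..t} f = integral {a..t} f"
            by (rule Henstock_Kurzweil_Integration.integral_combine) (use * h t sub in auto)
          ultimately have "integral {a..t + x} f - integral {a..t} f = - integral {-t..-t + h} (\<lambda>x. f (- x))"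
            by (simp add: h_def)
          then show ?thesis using * by (simp add: h_def)
        qed
      qed
    qed
  qed
qed

section \<open>Smooth cut-off functions and weak derivatives\<close>

text \<open>The case n = 0 is the classical flat function. The powers in the denominator make the
  family closed under differentiation up to linear combinations.\<close>

definition flat_exp :: "nat \<Rightarrow> real \<Rightarrow> real" where
  "flat_exp n x = (if x \<le> 0 then 0 else exp (- 1 / x) / x ^ n)"

lemma power_div_fact_le_exp:
  fixes y :: real
  assumes "0 \<le> y"
  shows "y ^ m / fact m \<le> exp y"
proof -
  have "(\<Sum>k\<in>{m}. inverse (fact k) * y ^ k) \<le> (\<Sum>k. inverse (fact k) * y ^ k)"
    by (rule sum_le_suminf) (use assms summable_exp in auto)
  also have "\<dots> = exp y"
    using exp_converges[of y] by (simp add: sums_iff)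
  finally show ?thesis by (simp add: divide_inverse mult.commute)
qed

lemma flat_exp_bound: "\<bar>flat_exp n x\<bar> \<le> fact (Suc n) * \<bar>x\<bar>"
proof (cases "x \<le> 0")
  case False
  then have x: "x > 0" by simp
  define y where "y = 1 / x"
  have "y ^ Suc n / fact (Suc n) \<le> exp y"
    using power_div_fact_le_exp[of y "Suc n"] x by (simp add: y_def)
  then have "y ^ Suc n \<le> fact (Suc n) * exp y"
    by (subst (asm) pos_divide_le_eq) (auto simp: mult.commute)
  then have "exp (- y) * y ^ Suc n \<le> exp (- y) * (fact (Suc n) * exp y)"
    by (intro mult_left_mono) auto
  also have "\<dots> = fact (Suc n)" by (simp add: exp_minus)
  finally have "exp (- (1 / x)) * (1 / x) ^ Suc n \<le> fact (Suc n)" by (simp only: y_def)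
  then have "exp (- (1 / x)) / x ^ n \<le> fact (Suc n) * x"
    using x by (simp add: field_simps)
  then show ?thesis using x by (simp add: flat_exp_def abs_mult)
next
  case True
  then have "\<bar>flat_exp n x\<bar> = 0" by (simp add: flat_exp_def)
  also have "0 \<le> fact (Suc n) * \<bar>x\<bar>" by (intro mult_nonneg_nonneg) auto
  finally show ?thesis .
qed

lemma flat_exp_deriv:
  "(flat_exp n has_real_derivative flat_exp (n + 2) x - real n * flat_exp (n + 1) x) (at x)"
proof -
  consider "x < 0" | "x = 0" | "x > 0" by linarith
  then show ?thesis
  proof cases
    case 1
    have "((\<lambda>_. 0) has_real_derivative 0) (at x)" by simp
    then have "(flat_exp n has_real_derivative 0) (at x)"
      by (rule has_field_derivative_transform_within_open[where S="{..<0}"])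
        (use 1 in \<open>auto simp: flat_exp_def\<close>)
    then show ?thesis using 1 by (simp add: flat_exp_def)
  next
    case 2
    have "(\<lambda>h. (flat_exp n (0 + h) - flat_exp n 0) / h) \<midarrow>0\<rightarrow> 0"
    proof (rule Lim_null_comparison)
      show "\<forall>\<^sub>F h in at 0. norm ((flat_exp n (0 + h) - flat_exp n 0) / h) \<le> fact (Suc (n + 1)) * \<bar>h\<bar>"
      proof (rule always_eventually, rule allI)
        fix h :: real
        \<comment> \<open>The quotient at the origin is the next member of the family, which the
          linear bound of \<open>flat_exp_bound\<close> sends to 0.\<close>
        have "(flat_exp n (0 + h) - flat_exp n 0) / h = flat_exp (n + 1) h"
          by (simp add: flat_exp_def)
        then show "norm ((flat_exp n (0 + h) - flat_exp n 0) / h) \<le> fact (Suc (n + 1)) * \<bar>h\<bar>"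
          using flat_exp_bound[of "n + 1" h] by simp
      qed
      show "((\<lambda>h::real. fact (Suc (n + 1)) * \<bar>h\<bar>) \<longlongrightarrow> 0) (at 0)"
        by (auto intro!: tendsto_eq_intros)
    qed
    then show ?thesis unfolding DERIV_def 2 by (simp add: flat_exp_def)
  next
    case 3
    have "((\<lambda>x. exp (- 1 / x) / x ^ n) has_real_derivative
        exp (- 1 / x) / x ^ (n + 2) - real n * (exp (- 1 / x) / x ^ (n + 1))) (at x)"
      using 3
      apply (auto intro!: derivative_eq_intros)
      apply (cases n)
       apply (auto simp: field_simps power2_eq_square)
      done
    then have "(flat_exp n has_real_derivative
        exp (- 1 / x) / x ^ (n + 2) - real n * (exp (- 1 / x) / x ^ (n + 1))) (at x)"
      by (rule has_field_derivative_transform_within_open[where S="{0<..}"])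
        (use 3 in \<open>auto simp: flat_exp_def\<close>)
    then show ?thesis using 3 by (simp add: flat_exp_def)
  qed
qed

text \<open>A class of terms closed under differentiation: \<open>C_k k\<close> then follows for all
  k by one induction, and no higher derivative is ever computed.\<close>

inductive smooth_expr :: "(real \<Rightarrow> real) \<Rightarrow> bool" where
  flat: "smooth_expr (flat_exp n)"
| const: "smooth_expr (\<lambda>_. c)"
| add: "smooth_expr f \<Longrightarrow> smooth_expr h \<Longrightarrow> smooth_expr (\<lambda>x. f x + h x)"
| mult: "smooth_expr f \<Longrightarrow> smooth_expr h \<Longrightarrow> smooth_expr (\<lambda>x. f x * h x)"
| affine: "smooth_expr f \<Longrightarrow> smooth_expr (\<lambda>x. f (a * x + b))"
| inverse: "smooth_expr f \<Longrightarrow> (\<And>x. f x \<noteq> 0) \<Longrightarrow> smooth_expr (\<lambda>x. inverse (f x))"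

lemma smooth_expr_deriv:
  "smooth_expr f \<Longrightarrow> \<exists>f'. smooth_expr f' \<and> (\<forall>x. (f has_real_derivative f' x) (at x))"
proof (induction rule: smooth_expr.induct)
  case (flat n)
  have "smooth_expr (\<lambda>x. flat_exp (n + 2) x + (- real n) * flat_exp (n + 1) x)"
    by (intro smooth_expr.intros)
  then show ?case using flat_exp_deriv[of n]
    by (intro exI[of _ "\<lambda>x. flat_exp (n + 2) x + (- real n) * flat_exp (n + 1) x"]) simp
next
  case (const c)
  show ?case by (intro exI[of _ "\<lambda>_. 0"]) (simp add: smooth_expr.const)
next
  case (add f h)
  then obtain f' h' where "smooth_expr f'" "\<forall>x. (f has_real_derivative f' x) (at x)"
    "smooth_expr h'" "\<forall>x. (h has_real_derivative h' x) (at x)" by blast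
  then show ?case
    by (intro exI[of _ "\<lambda>x. f' x + h' x"]) (auto intro: smooth_expr.add DERIV_add)
next
  case (mult f h)
  then obtain f' h' where "smooth_expr f'" "\<forall>x. (f has_real_derivative f' x) (at x)"
    "smooth_expr h'" "\<forall>x. (h has_real_derivative h' x) (at x)" by blast
  with mult show ?case
    by (intro exI[of _ "\<lambda>x. f' x * h x + h' x * f x"])
      (auto intro!: smooth_expr.add smooth_expr.mult DERIV_mult)
next
  case (affine f a b)
  then obtain f' where f': "smooth_expr f'" "\<forall>x. (f has_real_derivative f' x) (at x)" by blast
  have "((\<lambda>x. f (a * x + b)) has_real_derivative f' (a * x + b) * a) (at x)" for x
    by (rule DERIV_chain2[where f=f, OF f'(2)[rule_format]]) (auto intro!: derivative_eq_intros)
  moreover have "smooth_expr (\<lambda>x. f' (a * x + b) * a)"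
    by (intro smooth_expr.mult smooth_expr.const smooth_expr.affine f')
  ultimately show ?case by blast
next
  case (inverse f)
  then obtain f' where f': "smooth_expr f'" "\<forall>x. (f has_real_derivative f' x) (at x)" by blast
  have "((\<lambda>x. inverse (f x)) has_real_derivative
      (-1) * (inverse (f x) * (f' x * inverse (f x)))) (at x)" for x
    using DERIV_inverse'[OF f'(2)[rule_format, of x] inverse(2)[of x]] by (simp add: mult.assoc)
  moreover have "smooth_expr (\<lambda>x. (-1) * (inverse (f x) * (f' x * inverse (f x))))"
    by (intro smooth_expr.mult smooth_expr.const smooth_expr.inverse f' inverse)
  ultimately show ?case by blast
qed

lemma smooth_expr_C_k: "smooth_expr f \<Longrightarrow> C_k k f"
proof (induction k arbitrary: f)
  case 0
  then show ?case
    using smooth_expr_deriv[of f] DERIV_isCont by (auto simp: continuous_on_eq_continuous_at)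
next
  case (Suc k)
  obtain f' where f': "smooth_expr f'" "\<And>x. (f has_real_derivative f' x) (at x)"
    using smooth_expr_deriv[OF Suc.prems] by blast
  have "frechet_derivative f (at x) = (\<lambda>v. f' x * v)" for x
    using frechet_derivative_at[OF f'(2)[of x, unfolded has_field_derivative_def]] by simp
  moreover have "f differentiable (at x)" for x
    using f'(2) unfolding has_field_derivative_def differentiable_def by blast
  moreover have "C_k k (\<lambda>x. f' x * v)" for v
    by (intro Suc.IH smooth_expr.mult smooth_expr.const f')
  ultimately show ?case by simp
qed

text \<open>The usual transition f(x) / (f(x) + f(1 - x)) from 0 to 1; the argument 1 - x is spelled
  so that it matches the \<open>affine\<close> rule of \<open>smooth_expr\<close>.\<close>

definition smooth_step :: "real \<Rightarrow> real" where
  "smooth_step x = flat_exp 0 x * inverse (flat_exp 0 x + flat_exp 0 ((-1) * x + 1))"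

lemma flat_exp_0_sum_pos: "flat_exp 0 x + flat_exp 0 ((-1) * x + 1) > 0"
  by (auto simp: flat_exp_def add_pos_pos)

lemma smooth_expr_smooth_step: "smooth_expr smooth_step"
  unfolding smooth_step_def[abs_def] using flat_exp_0_sum_pos
  by (intro smooth_expr.intros) (metis less_irrefl)

lemma smooth_step_0: "x \<le> 0 \<Longrightarrow> smooth_step x = 0"
  by (simp add: smooth_step_def flat_exp_def)

lemma smooth_step_1: "x \<ge> 1 \<Longrightarrow> smooth_step x = 1"
  by (simp add: smooth_step_def flat_exp_def)

lemma smooth_step_range: "0 \<le> smooth_step x" "smooth_step x \<le> 1"
proof -
  have "flat_exp 0 y \<ge> 0" for y by (simp add: flat_exp_def)
  then show "0 \<le> smooth_step x" "smooth_step x \<le> 1"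
    using flat_exp_0_sum_pos[of x] by (auto simp: smooth_step_def field_simps)
qed

text \<open>Passes from the Lebesgue integrals over the whole time interval, in which weak
  derivatives are defined, to gauge integrals over a compact interval.\<close>

lemma LINT_lebesgue_on_supported:
  fixes h :: "real \<Rightarrow> real"
  assumes h: "h absolutely_integrable_on {a..b}" and I: "I \<in> sets lebesgue" "{a..b} \<subseteq> I"
    and supp: "\<And>r. r \<in> I - {a..b} \<Longrightarrow> h r = 0"
  shows "(LINT r|lebesgue_on I. h r) = integral {a..b} h"
proof -
  have "(LINT r|lebesgue_on I. h r) = (LINT r|lebesgue. indicator I r *\<^sub>R h r)"
    using I by (simp add: integral_restrict_space)
  also have "\<dots> = (LINT r|lebesgue. indicator {a..b} r *\<^sub>R h r)"
    by (rule Bochner_Integration.integral_cong) (use I supp in \<open>auto simp: indicator_def\<close>)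
  also have "\<dots> = integral {a..b} h"
    using set_lebesgue_integral_eq_integral(2)[OF h] by (simp add: set_lebesgue_integral_def)
  finally show ?thesis .
qed

lemma C_infinity_smooth_expr: "smooth_expr f \<Longrightarrow> C_infinity f"
  by (simp add: C_infinity_def smooth_expr_C_k)

text \<open>A one-sided mollifier: its mass sits to the right of t, so continuity on [t, b] is
  enough to recover the value at the left end point.\<close>

lemma approximate_unit_limit:
  fixes c \<rho> :: "real \<Rightarrow> real"
  assumes c: "continuous_on {t..b} c" and "t < b"
    and \<rho>: "continuous_on UNIV \<rho>" "(\<rho> has_integral 1) {0..1}"
  shows "(\<lambda>n. integral {t..t + 1 / Suc n} (\<lambda>r. Suc n * \<rho> (Suc n * (r - t)) * c r)) \<longlonglongrightarrow> c t"
proof -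
  have "compact (\<rho> ` {0..1})"
    using \<rho>(1) by (intro compact_continuous_image) (auto intro: continuous_on_subset)
  then obtain M where M: "M > 0" "\<And>y. y \<in> {0..1} \<Longrightarrow> \<bar>\<rho> y\<bar> \<le> M"
    using compact_imp_bounded bounded_pos[of "\<rho> ` {0..1}"] by auto
  have unit: "((\<lambda>r. Suc n * \<rho> (Suc n * (r - t))) has_integral 1) {t..t + 1 / Suc n}" for n
  proof -
    have "((\<lambda>r. \<rho> (real (Suc n) *\<^sub>R r + (- real (Suc n) * t))) has_integral
        1 /\<^sub>R real (Suc n) ^ DIM(real))
        (cbox ((0 - (- real (Suc n) * t)) /\<^sub>R real (Suc n)) ((1 - (- real (Suc n) * t)) /\<^sub>R real (Suc n)))"
      by (rule has_integral_affinity') (use \<rho>(2) in auto)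
    moreover have "(0 - (- real (Suc n) * t)) /\<^sub>R real (Suc n) = t"
      "(1 - (- real (Suc n) * t)) /\<^sub>R real (Suc n) = t + 1 / Suc n"
      by (simp_all add: divide_simps, simp_all add: algebra_simps)
    moreover have "real (Suc n) *\<^sub>R r + (- real (Suc n) * t) = Suc n * (r - t)" for r
      by (simp add: algebra_simps)
    ultimately have "((\<lambda>r. \<rho> (real (Suc n) * (r - t))) has_integral 1 / real (Suc n)) {t..t + 1 / Suc n}"
      by (simp add: divide_inverse)
    from has_integral_mult_right[OF this, of "real (Suc n)"] show ?thesis by (simp add: mult.commute)
  qed
  show ?thesis
  proof (rule LIMSEQ_I)
    fix e :: real assume e: "e > 0"
    \<comment> \<open>The rescaled kernel is at most (n + 1) M on an interval of length 1 / (n + 1),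
      so an oscillation of e / (2 M) costs at most e / 2.\<close>
    have "e / (2 * M) > 0" using e M by simp
    then obtain d where d: "d > 0" "\<And>r. r \<in> {t..b} \<Longrightarrow> dist r t < d \<Longrightarrow> dist (c r) (c t) < e / (2 * M)"
      using c \<open>t < b\<close> unfolding continuous_on_iff by (metis atLeastAtMost_iff less_imp_le order_refl)
    obtain n0 :: nat where n0: "1 / real (Suc n0) < min d (b - t)"
      using nat_approx_posE[of "min d (b - t)"] d \<open>t < b\<close> by auto
    show "\<exists>no. \<forall>n\<ge>no. norm (integral {t..t + 1 / Suc n} (\<lambda>r. Suc n * \<rho> (Suc n * (r - t)) * c r) - c t) < e"
    proof (intro exI allI impI)
      fix n assume "n \<ge> n0"
      then have n: "1 / real (Suc n) < min d (b - t)"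
        using n0 by (smt (verit) divide_left_mono of_nat_0_less_iff of_nat_le_iff Suc_le_mono zero_less_Suc mult_pos_pos)
      let ?I = "{t..t + 1 / Suc n}" and ?k = "\<lambda>r. Suc n * \<rho> (Suc n * (r - t))"
      have k: "continuous_on ?I ?k"
        by (intro continuous_intros continuous_on_compose2[OF \<rho>(1)]) auto
      have cI: "continuous_on ?I c" using c n by (auto intro: continuous_on_subset)
      have "((\<lambda>r. ?k r * c t) has_integral 1 * c t) ?I"
        by (rule has_integral_mult_left[OF unit])
      moreover have "(\<lambda>r. ?k r * c r) integrable_on ?I"
        by (intro integrable_continuous_real continuous_intros k cI)
      ultimately have "integral ?I (\<lambda>r. ?k r * c r) - c t = integral ?I (\<lambda>r. ?k r * c r - ?k r * c t)"
        by (subst Henstock_Kurzweil_Integration.integral_diff) (auto simp: has_integral_iff)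
      also have "norm \<dots> \<le> (Suc n * M * (e / (2 * M))) * (t + 1 / Suc n - t)"
      proof (rule integral_bound)
        show "continuous_on ?I (\<lambda>r. ?k r * c r - ?k r * c t)"
          by (intro continuous_intros k cI)
        fix r assume r: "r \<in> ?I"
        have "Suc n * (r - t) \<le> Suc n * (1 / Suc n)" using r by (intro mult_left_mono) auto
        then have "Suc n * (r - t) \<in> {0..1}" using r by auto
        then have "\<bar>?k r\<bar> \<le> Suc n * M" using M(2) by (auto simp: abs_mult)
        moreover have "\<bar>c r - c t\<bar> \<le> e / (2 * M)"
          using d(2)[of r] r n by (auto simp: dist_real_def)
        ultimately have "\<bar>?k r\<bar> * \<bar>c r - c t\<bar> \<le> (Suc n * M) * (e / (2 * M))"
          by (intro mult_mono) auto
        then show "norm (?k r * c r - ?k r * c t) \<le> Suc n * M * (e / (2 * M))"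
          by (simp only: right_diff_distrib[symmetric] real_norm_def abs_mult)
      qed simp
      also have "\<dots> = e / 2" using M(1) by (simp add: divide_simps del: of_nat_Suc)
      also have "\<dots> < e" using e by simp
      finally show "norm (integral ?I (\<lambda>r. ?k r * c r) - c t) < e" .
    qed
  qed
qed

text \<open>The test functions are smoothed indicators of the interval from t to \<tau>. Their
  derivatives are differences of two unit bumps, placed just to the right of t and of \<tau>, so one
  side of the weak identity tends to c(t) - c(\<tau>) and the other to minus the integral of f. The
  gap between \<tau> and b leaves room for the second bump.\<close>

lemma weak_derivative_FTC:
  fixes c f :: "real \<Rightarrow> real"
  assumes c: "continuous_on {t..b} c" and tb: "t < \<tau>" "\<tau> < b"
    and I: "{t..b} \<subseteq> I" "I \<in> sets lebesgue"
    and f: "f absolutely_integrable_on {t..b}"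
    and weak: "\<And>\<phi>. test_function I \<phi> \<Longrightarrow>
      (LINT r|lebesgue_on I. deriv \<phi> r * c r) = - (LINT r|lebesgue_on I. \<phi> r * f r)"
  shows "c \<tau> - c t = integral {t..\<tau>} f"
proof -
  obtain \<rho> where \<rho>: "smooth_expr \<rho>" "\<And>x. (smooth_step has_real_derivative \<rho> x) (at x)"
    using smooth_expr_deriv[OF smooth_expr_smooth_step] by blast
  have \<rho>_cont: "continuous_on UNIV \<rho>"
    using smooth_expr_C_k[OF \<rho>(1), of 0] by simp
  \<comment> \<open>There \<open>smooth_step\<close> attains its minimum 0 or its maximum 1, so its
    derivative vanishes; this includes the points 0 and 1 themselves.\<close>
  have \<rho>_0: "\<rho> x = 0" if "x \<le> 0 \<or> 1 \<le> x" for x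
    using that
  proof
    assume "x \<le> 0"
    then show ?thesis
      using DERIV_local_min[OF \<rho>(2), of 1 x] smooth_step_0[of x] smooth_step_range by auto
  next
    assume "1 \<le> x"
    then show ?thesis
      using DERIV_local_max[OF \<rho>(2), of 1 x] smooth_step_1[of x] smooth_step_range by auto
  qed
  have \<rho>_int: "(\<rho> has_integral 1) {0..1}"
    using fundamental_theorem_of_calculus[of 0 1 smooth_step \<rho>] \<rho>(2) smooth_step_0[of 0] smooth_step_1[of 1]
    by (simp add: has_real_derivative_iff_has_vector_derivative[symmetric] has_field_derivative_at_within)
  define \<phi> where "\<phi> n r = smooth_step (Suc n * (r - t)) - smooth_step (Suc n * (r - \<tau>))" for n :: nat and r :: real
  define k where "k n a r = Suc n * \<rho> (Suc n * (r - a))" for n :: nat and a r :: real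
  have \<phi>_smooth: "smooth_expr (\<phi> n)" for n
  proof -
    have "smooth_expr (\<lambda>r. smooth_step (Suc n * r + - Suc n * t) + (-1) * smooth_step (Suc n * r + - Suc n * \<tau>))"
      by (intro smooth_expr.add smooth_expr.mult smooth_expr.const smooth_expr.affine smooth_expr_smooth_step)
    then show ?thesis by (simp add: \<phi>_def[abs_def] algebra_simps)
  qed
  have \<phi>_deriv: "deriv (\<phi> n) r = k n t r - k n \<tau> r" for n r
    unfolding \<phi>_def[abs_def] k_def
    by (rule DERIV_imp_deriv)
      (auto intro!: derivative_eq_intros DERIV_chain2[OF \<rho>(2)] simp: algebra_simps)
  have \<phi>_supp: "\<phi> n r = 0" if "r \<notin> {t..\<tau> + 1 / Suc n}" for n r
  proof (cases "r < t")
    case True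
    then have "Suc n * (r - t) \<le> 0" "Suc n * (r - \<tau>) \<le> 0"
      using tb by (auto simp: mult_le_0_iff)
    then show ?thesis by (simp add: \<phi>_def smooth_step_0)
  next
    case False
    then have "r > \<tau> + 1 / Suc n" using that by auto
    then have "Suc n * (r - \<tau>) \<ge> 1" by (simp add: field_simps)
    moreover have "Suc n * (r - t) \<ge> Suc n * (r - \<tau>)" using tb by (intro mult_left_mono) auto
    ultimately have "smooth_step (Suc n * (r - t)) = 1" "smooth_step (Suc n * (r - \<tau>)) = 1"
      by (intro smooth_step_1; linarith)+
    then show ?thesis by (simp only: \<phi>_def)
  qed
  have k_cont: "continuous_on A (k n a)" for A n a
    unfolding k_def by (intro continuous_intros continuous_on_compose2[OF \<rho>_cont]) auto
  have k_supp: "k n a r = 0" if "r \<notin> {a..a + 1 / Suc n}" for n a r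
  proof -
    have "Suc n * (r - a) \<le> 0 \<or> 1 \<le> Suc n * (r - a)"
      using that
    proof (cases "r < a")
      case True
      then show ?thesis by (auto simp: mult_le_0_iff)
    next
      case False
      then have "1 / Suc n < r - a" using that by auto
      then show ?thesis by (simp add: pos_divide_less_eq mult.commute del: of_nat_Suc)
    qed
    then show ?thesis using \<rho>_0 by (simp add: k_def)
  qed
  have k_int: "((\<lambda>r. k n a r * c r) has_integral integral {a..a + 1 / Suc n} (\<lambda>r. k n a r * c r)) {t..b}"
    if "t \<le> a" "a + 1 / Suc n \<le> b" for a n
  proof (rule has_integral_on_superset)
    show "((\<lambda>r. k n a r * c r) has_integral integral {a..a + 1 / Suc n} (\<lambda>r. k n a r * c r)) {a..a + 1 / Suc n}"
      using that by (intro integrable_integral integrable_continuous_real continuous_intros k_cont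
          continuous_on_subset[OF c]) auto
  qed (use that k_supp in auto)
  obtain n0 :: nat where n0: "1 / real (Suc n0) < b - \<tau>"
    using nat_approx_posE[of "b - \<tau>"] tb by auto
  have n: "\<tau> + 1 / Suc n < b" if "n \<ge> n0" for n
  proof -
    have "1 / real (Suc n) \<le> 1 / real (Suc n0)" using that by (intro divide_left_mono) auto
    then show ?thesis using n0 by simp
  qed
  have \<phi>f: "(\<lambda>r. \<phi> n r * f r) absolutely_integrable_on {t..b}" for n
  proof (rule absolutely_integrable_bounded_measurable_product_real[OF _ _ _ f])
    have "continuous_on UNIV (\<phi> n)" using smooth_expr_C_k[OF \<phi>_smooth, of 0 n] by simp
    then have cont: "continuous_on {t..b} (\<phi> n)" by (rule continuous_on_subset) simp
    then show "\<phi> n \<in> borel_measurable (lebesgue_on {t..b})"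
      by (rule continuous_imp_measurable_on_sets_lebesgue) simp
    show "bounded (\<phi> n ` {t..b})"
      using cont by (intro compact_imp_bounded compact_continuous_image) auto
  qed simp
  have eq: "integral {t..t + 1 / Suc n} (\<lambda>r. k n t r * c r) - integral {\<tau>..\<tau> + 1 / Suc n} (\<lambda>r. k n \<tau> r * c r)
      = - integral {t..b} (\<lambda>r. \<phi> n r * f r)" if "n \<ge> n0" for n
  proof -
    note nb = n[OF that]
    have test: "test_function I (\<phi> n)"
      unfolding test_function_def
    proof (intro conjI)
      have *: "closure {r. \<phi> n r \<noteq> 0} \<subseteq> {t..\<tau> + 1 / Suc n}"
        using \<phi>_supp[of _ n] by (intro closure_minimal) (blast, simp)
      then show "closure {r. \<phi> n r \<noteq> 0} \<subseteq> I"
        using nb I(1) by (meson atLeastatMost_subset_iff less_imp_le order_refl order_trans)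
      show "compact (closure {r. \<phi> n r \<noteq> 0})"
        using bounded_subset[OF bounded_closed_interval *] by (simp add: compact_eq_bounded_closed)
    qed (rule C_infinity_smooth_expr[OF \<phi>_smooth])
    have "(LINT r|lebesgue_on I. deriv (\<phi> n) r * c r) = integral {t..b} (\<lambda>r. deriv (\<phi> n) r * c r)"
    proof (rule LINT_lebesgue_on_supported[OF _ I(2,1)])
      have "continuous_on {t..b} (\<lambda>r. deriv (\<phi> n) r * c r)"
        unfolding \<phi>_deriv by (intro continuous_intros k_cont c)
      then show "(\<lambda>r. deriv (\<phi> n) r * c r) absolutely_integrable_on {t..b}"
        by (rule absolutely_integrable_continuous_real)
      fix r assume r: "r \<in> I - {t..b}"
      then have "k n t r = 0" "k n \<tau> r = 0" using nb tb by (auto intro!: k_supp)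
      then show "deriv (\<phi> n) r * c r = 0" by (simp add: \<phi>_deriv)
    qed
    also have "\<dots> = integral {t..t + 1 / Suc n} (\<lambda>r. k n t r * c r) - integral {\<tau>..\<tau> + 1 / Suc n} (\<lambda>r. k n \<tau> r * c r)"
    proof (rule integral_unique)
      have "((\<lambda>r. k n t r * c r - k n \<tau> r * c r) has_integral
         integral {t..t + 1 / Suc n} (\<lambda>r. k n t r * c r) - integral {\<tau>..\<tau> + 1 / Suc n} (\<lambda>r. k n \<tau> r * c r)) {t..b}"
        by (intro has_integral_diff k_int) (use nb tb in auto)
      then show "((\<lambda>r. deriv (\<phi> n) r * c r) has_integral
         integral {t..t + 1 / Suc n} (\<lambda>r. k n t r * c r) - integral {\<tau>..\<tau> + 1 / Suc n} (\<lambda>r. k n \<tau> r * c r)) {t..b}"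
        by (simp add: \<phi>_deriv left_diff_distrib)
    qed
    finally have "(LINT r|lebesgue_on I. deriv (\<phi> n) r * c r) = \<dots>" .
    moreover have "(LINT r|lebesgue_on I. \<phi> n r * f r) = integral {t..b} (\<lambda>r. \<phi> n r * f r)"
      using nb by (intro LINT_lebesgue_on_supported[OF \<phi>f I(2,1)]) (auto intro!: \<phi>_supp)
    ultimately show ?thesis using weak[OF test] by simp
  qed
  have lim_c: "(\<lambda>n. integral {a..a + 1 / Suc n} (\<lambda>r. k n a r * c r)) \<longlonglongrightarrow> c a" if "t \<le> a" "a < b" for a
    unfolding k_def
    by (rule approximate_unit_limit[OF continuous_on_subset[OF c] _ \<rho>_cont \<rho>_int]) (use that in auto)
  have lim_f: "(\<lambda>n. integral {t..b} (\<lambda>r. \<phi> n r * f r)) \<longlonglongrightarrow>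
      integral {t..b} (\<lambda>r. if r \<in> {t<..\<tau>} then f r else 0)"
  proof (rule dominated_convergence(2)[where h="\<lambda>r. \<bar>f r\<bar>"])
    show "(\<lambda>r. \<phi> n r * f r) integrable_on {t..b}" for n
      using \<phi>f by (rule set_lebesgue_integral_eq_integral)
    show "(\<lambda>r. \<bar>f r\<bar>) integrable_on {t..b}"
      using f by (simp add: absolutely_integrable_on_def)
    fix r assume r: "r \<in> {t..b}"
    show "norm (\<phi> n r * f r) \<le> \<bar>f r\<bar>" for n
    proof -
      have "\<bar>\<phi> n r\<bar> \<le> 1"
        using smooth_step_range[of "Suc n * (r - t)"] smooth_step_range[of "Suc n * (r - \<tau>)"]
        unfolding \<phi>_def by linarith
      then show ?thesis by (simp add: abs_mult mult_left_le_one_le)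
    qed
    \<comment> \<open>Convergence is by eventual equality: at positive y the scaled argument passes
      1 after finitely many n, at other y the value is 0 throughout.\<close>
    have step: "\<forall>\<^sub>F n in sequentially. smooth_step (Suc n * y) = (if y > 0 then 1 else 0)" for y :: real
    proof (cases "y > 0")
      case True
      obtain m :: nat where m: "1 / real (Suc m) < y" using nat_approx_posE[OF True] by auto
      have "smooth_step (Suc n * y) = 1" if "n \<ge> m" for n
      proof (rule smooth_step_1)
        have "1 < real (Suc m) * y" using m by (simp add: field_simps)
        also have "\<dots> \<le> Suc n * y" using that True by (intro mult_right_mono) auto
        finally show "1 \<le> Suc n * y" by simp
      qed
      then show ?thesis using True by (auto simp: eventually_sequentially)
    next
      case False
      then show ?thesis by (auto intro!: always_eventually smooth_step_0 simp: mult_le_0_iff)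
    qed
    have "\<forall>\<^sub>F n in sequentially. \<phi> n r * f r = (if r \<in> {t<..\<tau>} then f r else 0)"
      using step[of "r - t"] step[of "r - \<tau>"] by eventually_elim (use tb in \<open>auto simp: \<phi>_def\<close>)
    then show "(\<lambda>n. \<phi> n r * f r) \<longlonglongrightarrow> (if r \<in> {t<..\<tau>} then f r else 0)"
      by (rule tendsto_eventually)
  qed
  have "(\<lambda>n. - integral {t..b} (\<lambda>r. \<phi> n r * f r)) \<longlonglongrightarrow> c t - c \<tau>"
  proof (rule Lim_transform_eventually)
    show "(\<lambda>n. integral {t..t + 1 / Suc n} (\<lambda>r. k n t r * c r) -
        integral {\<tau>..\<tau> + 1 / Suc n} (\<lambda>r. k n \<tau> r * c r)) \<longlonglongrightarrow> c t - c \<tau>"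
      using tb by (intro tendsto_diff lim_c) auto
    show "\<forall>\<^sub>F n in sequentially. integral {t..t + 1 / Suc n} (\<lambda>r. k n t r * c r) -
        integral {\<tau>..\<tau> + 1 / Suc n} (\<lambda>r. k n \<tau> r * c r) = - integral {t..b} (\<lambda>r. \<phi> n r * f r)"
      using eq by (auto simp: eventually_sequentially)
  qed
  then have "c t - c \<tau> = - integral {t..b} (\<lambda>r. if r \<in> {t<..\<tau>} then f r else 0)"
    using tendsto_minus[OF lim_f] by (rule LIMSEQ_unique)
  also have "integral {t..b} (\<lambda>r. if r \<in> {t<..\<tau>} then f r else 0) = integral ({t..b} \<inter> {t<..\<tau>}) f"
    by (subst integral_restrict_Int) (simp add: Int_commute)
  also have "{t..b} \<inter> {t<..\<tau>} = {t<..\<tau>}" using tb by auto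
  also have "integral {t<..\<tau>} f = integral {t..\<tau>} f"
    by (rule integral_spike_set) (rule negligible_subset[of "{t}"], auto)+
  finally show ?thesis by simp
qed

section \<open>Functions with integrable lower slopes\<close>

text \<open>The integral of the squared deviation of \<open>v\<close> from its mean \<open>k\<close>
  is nonnegative.\<close>

lemma integral_square_le:
  fixes v :: "real \<Rightarrow> real"
  assumes v: "v integrable_on {c..d}" "(\<lambda>r. (v r)\<^sup>2) integrable_on {c..d}" and "c \<le> d"
  shows "(integral {c..d} v)\<^sup>2 \<le> (d - c) * integral {c..d} (\<lambda>r. (v r)\<^sup>2)"
proof (cases "c = d")
  case False
  then have cd: "c < d" using assms by simp
  define k where "k = integral {c..d} v / (d - c)"
  have "((\<lambda>r. (v r)\<^sup>2 - 2 * k * v r + k\<^sup>2) has_integral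
      (integral {c..d} (\<lambda>r. (v r)\<^sup>2) - 2 * k * integral {c..d} v + (d - c) * k\<^sup>2)) {c..d}"
    by (intro has_integral_add has_integral_diff has_integral_mult_right integrable_integral v)
      (use has_integral_const_real[of "k\<^sup>2" c d] cd in simp)
  then have *: "0 \<le> integral {c..d} (\<lambda>r. (v r)\<^sup>2) - 2 * k * integral {c..d} v + (d - c) * k\<^sup>2"
    by (rule has_integral_nonneg) (metis power2_diff zero_le_power2 add.commute add_diff_eq diff_add_eq mult.commute mult.left_commute)
  have k: "k * (d - c) = integral {c..d} v" using cd by (simp add: k_def)
  then have "(d - c) * k\<^sup>2 = k * integral {c..d} v" by (simp add: power2_eq_square mult.commute mult.left_commute)
  with * have "k * integral {c..d} v \<le> integral {c..d} (\<lambda>r. (v r)\<^sup>2)" by simp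
  then have "(d - c) * (k * integral {c..d} v) \<le> (d - c) * integral {c..d} (\<lambda>r. (v r)\<^sup>2)"
    using cd by (intro mult_left_mono) auto
  moreover have "(d - c) * (k * integral {c..d} v) = (integral {c..d} v)\<^sup>2"
    using k by (metis mult.assoc mult.commute power2_eq_square)
  ultimately show ?thesis by simp
qed simp

text \<open>Otherwise \<open>f\<close> would be at least its mean plus one off a null set, and
  integration gives a contradiction. The added one makes it strict; summed over the cells of a
  partition this slack costs only the total length.\<close>

lemma exists_below_average:
  fixes f :: "real \<Rightarrow> real"
  assumes f: "f integrable_on {c..d}" and "c < d" "negligible N"
  shows "\<exists>t\<in>{c..d} - N. f t * (d - c) \<le> integral {c..d} f + (d - c)"
proof (rule ccontr)
  assume *: "\<not> ?thesis"
  define k where "k = integral {c..d} f / (d - c) + 1"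
  have fk: "k \<le> f t" if "t \<in> {c..d} - N" for t
  proof -
    have "k * (d - c) = integral {c..d} f + (d - c)" using \<open>c < d\<close> by (simp add: k_def distrib_right)
    also have "\<dots> < f t * (d - c)" using * that by force
    finally show ?thesis using \<open>c < d\<close> by simp
  qed
  have "integral {c..d} (\<lambda>_. k) \<le> integral {c..d} (\<lambda>r. if r \<in> N then k else f r)"
  proof (rule integral_le)
    show "(\<lambda>r. if r \<in> N then k else f r) integrable_on {c..d}"
      by (rule integrable_spike[OF f \<open>negligible N\<close>]) simp
  qed (use fk in auto)
  also have "\<dots> = integral {c..d} f"
    by (rule integral_spike[OF \<open>negligible N\<close>]) simp
  finally have "k * (d - c) \<le> integral {c..d} f" using \<open>c < d\<close> by (simp add: mult.commute)
  moreover have "k * (d - c) = integral {c..d} f + (d - c)" using \<open>c < d\<close> by (simp add: k_def distrib_right)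
  ultimately show False using \<open>c < d\<close> by simp
qed

text \<open>Absolute continuity of the integral: the null set is enclosed in open sets of measure
  tending to 0, and dominated convergence applies.\<close>

lemma negligible_open_small_integral:
  fixes q :: "real \<Rightarrow> real"
  assumes N: "negligible N" and q: "q integrable_on {a..b}" "\<And>r. 0 \<le> q r" and "0 < e"
  obtains U where "open U" "N \<subseteq> U" "(\<lambda>r. if r \<in> U then q r else 0) integrable_on {a..b}"
    "integral {a..b} (\<lambda>r. if r \<in> U then q r else 0) < e"
proof -
  have qa: "q absolutely_integrable_on {a..b}"
    using q by (intro nonnegative_absolutely_integrable_1) auto
  have "\<exists>U. open U \<and> N \<subseteq> U \<and> U \<in> lmeasurable \<and> measure lebesgue U < 1 / Suc n" for n
  proof -
    have NL: "N \<in> lmeasurable" "measure lebesgue N = 0"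
      using N negligible_iff_measure by auto
    have "0 < 1 / real (Suc n)" by simp
    from sets_lebesgue_outer_open[OF fmeasurableD[OF NL(1)] this]
    obtain U where U: "open U" "N \<subseteq> U" "U - N \<in> lmeasurable" "emeasure lebesgue (U - N) < ennreal (1 / Suc n)"
      by blast
    have "U = (U - N) \<union> N" using U by blast
    moreover have "(U - N) \<union> N \<in> lmeasurable" using U NL by blast
    moreover have "measure lebesgue ((U - N) \<union> N) \<le> measure lebesgue (U - N) + measure lebesgue N"
      using U NL by (intro measure_Un_le) auto
    moreover have "measure lebesgue (U - N) < 1 / Suc n"
      using U(3,4) by (simp add: emeasure_eq_measure2 ennreal_less_iff)
    ultimately show ?thesis using U(1,2) NL(2) by (intro exI[of _ U]) auto
  qed
  then obtain U where U: "\<And>n. open (U n)" "\<And>n. N \<subseteq> U n" "\<And>n. U n \<in> lmeasurable"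
    "\<And>n. measure lebesgue (U n) < 1 / Suc n" by metis
  \<comment> \<open>Finite intersections are still open, and they decrease; so their indicators
    converge pointwise to that of the whole intersection.\<close>
  define W where "W n = (\<Inter>k\<le>n. U k)" for n
  have W: "open (W n)" "N \<subseteq> W n" for n
    using U by (auto simp: W_def intro!: open_INT)
  have neg: "negligible (\<Inter>n. U n)"
  proof (rule negligible_outer_le[THEN iffD2], intro allI impI)
    fix e :: real assume "e > 0"
    then obtain n :: nat where "1 / Suc n < e" using nat_approx_posE by blast
    then show "\<exists>T. (\<Inter>n. U n) \<subseteq> T \<and> T \<in> lmeasurable \<and> measure lebesgue T \<le> e"
      using U(3,4)[of n] by (intro exI[of _ "U n"]) auto
  qed
  have int: "(\<lambda>r. if r \<in> W n then q r else 0) integrable_on {a..b}" for n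
  proof -
    have "set_integrable lebesgue ({a..b} \<inter> W n) q"
      using W(1) by (intro set_integrable_subset[OF qa]) auto
    then have "q integrable_on ({a..b} \<inter> W n)" by (rule set_lebesgue_integral_eq_integral)
    then show ?thesis using integrable_restrict_Int[of "W n" q "{a..b}"] by (simp add: Int_commute)
  qed
  have "(\<lambda>n. integral {a..b} (\<lambda>r. if r \<in> W n then q r else 0)) \<longlonglongrightarrow>
      integral {a..b} (\<lambda>r. if r \<in> (\<Inter>n. U n) then q r else 0)"
  proof (rule dominated_convergence(2)[where h=q])
    fix r assume "r \<in> {a..b}"
    show "(\<lambda>n. if r \<in> W n then q r else 0) \<longlonglongrightarrow> (if r \<in> (\<Inter>n. U n) then q r else 0)"
    proof (cases "r \<in> (\<Inter>n. U n)")
      case False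
      then obtain n where "r \<notin> U n" by auto
      then have "r \<notin> W k" if "k \<ge> n" for k using that by (auto simp: W_def)
      then show ?thesis using False
        by (intro tendsto_eventually eventually_sequentiallyI[of n]) (simp only: if_False simp_thms)
    qed (auto simp: W_def)
  qed (use int q in auto)
  also have "integral {a..b} (\<lambda>r. if r \<in> (\<Inter>n. U n) then q r else 0) = integral {a..b} (\<lambda>_. 0 :: real)"
    by (rule integral_spike[OF neg]) auto
  finally have "(\<lambda>n. integral {a..b} (\<lambda>r. if r \<in> W n then q r else 0)) \<longlonglongrightarrow> 0" by simp
  then have "\<forall>\<^sub>F n in sequentially. integral {a..b} (\<lambda>r. if r \<in> W n then q r else 0) < e"
    using \<open>0 < e\<close> by (rule order_tendstoD)
  then obtain n where "integral {a..b} (\<lambda>r. if r \<in> W n then q r else 0) < e"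
    using eventually_happens'[OF sequentially_bot] by blast
  then show ?thesis using that W int by blast
qed

text \<open>Inside a small open neighbourhood of the exceptional set the increments are controlled by the
  integral of \<open>q\<close>, outside by the lower Dini derivative.\<close>

lemma mono_of_lower_Dini_derivative:
  fixes K q :: "real \<Rightarrow> real"
  assumes "a \<le> b" and q: "q integrable_on {a..b}" "\<And>r. 0 \<le> q r"
    and Kq: "\<And>x y. a \<le> x \<Longrightarrow> x \<le> y \<Longrightarrow> y \<le> b \<Longrightarrow> \<bar>K y - K x\<bar> \<le> integral {x..y} q"
    and N: "negligible N"
    and Dini: "\<And>t e. t \<in> {a<..<b} - N \<Longrightarrow> 0 < e \<Longrightarrow>
      \<exists>d>0. \<forall>h. 0 < h \<and> h < d \<longrightarrow> K t - e * h \<le> K (t + h)"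
  shows "K a \<le> K b"
proof (rule field_le_epsilon)
  fix e :: real assume "0 < e"
  \<comment> \<open>Half of \<open>e\<close> is spent on the linear correction, the other half on
    the integral of \<open>q\<close> over \<open>U\<close>.\<close>
  define e1 where "e1 = e / (2 * (b - a + 1))"
  have e1: "e1 > 0" "e1 * (b - a) \<le> e / 2"
    using \<open>0 < e\<close> \<open>a \<le> b\<close> by (auto simp: e1_def field_simps)
  \<comment> \<open>The Dini hypothesis concerns interior points, so the starting point
    \<open>a\<close> is treated as exceptional.\<close>
  have "negligible (insert a N)" using N by (simp add: negligible_insert)
  then obtain U where U: "open U" "insert a N \<subseteq> U"
    and qU: "(\<lambda>r. if r \<in> U then q r else 0) integrable_on {a..b}"
      "integral {a..b} (\<lambda>r. if r \<in> U then q r else 0) < e / 2"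
    using negligible_open_small_integral[OF _ q, of "insert a N" "e / 2"] \<open>0 < e\<close> by auto
  let ?qU = "\<lambda>r. if r \<in> U then q r else 0"
  \<comment> \<open>With both corrections added, every point of [a, b) has a later point at which
    the function is not smaller; a supremum argument on the closed set \<open>A\<close> then reaches
    \<open>b\<close>.\<close>
  define \<Psi> where "\<Psi> t = K t + e1 * (t - a) + integral {a..t} ?qU" for t
  have Kc: "continuous_on {a..b} K"
    unfolding continuous_on_iff
  proof (intro ballI allI impI)
    fix x \<epsilon> :: real assume x: "x \<in> {a..b}" and "\<epsilon> > 0"
    have "continuous_on {a..b} (\<lambda>x. integral {a..x} q)" by (rule indefinite_integral_continuous_1[OF q(1)])
    then obtain d where d: "d > 0" "\<And>y. y \<in> {a..b} \<Longrightarrow> dist y x < d \<Longrightarrow> dist (integral {a..y} q) (integral {a..x} q) < \<epsilon>"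
      using x \<open>\<epsilon> > 0\<close> unfolding continuous_on_iff by blast
    have "dist (K y) (K x) < \<epsilon>" if y: "y \<in> {a..b}" "dist y x < d" for y
    proof (cases "x \<le> y")
      case True
      then show ?thesis
        using Kq[of x y] d(2)[OF y] integral_Icc_add[OF q(1), of x y] x y by (auto simp: dist_real_def)
    next
      case False
      then show ?thesis
        using Kq[of y x] d(2)[OF y] integral_Icc_add[OF q(1), of y x] x y by (auto simp: dist_real_def)
    qed
    then show "\<exists>d>0. \<forall>y\<in>{a..b}. dist y x < d \<longrightarrow> dist (K y) (K x) < \<epsilon>" using d(1) by blast
  qed
  have \<Psi>c: "continuous_on {a..b} \<Psi>"
    unfolding \<Psi>_def by (intro continuous_intros Kc indefinite_integral_continuous_1 qU)
  have step: "\<exists>h>0. t + h \<le> b \<and> \<Psi> t \<le> \<Psi> (t + h)" if t: "a \<le> t" "t < b" for t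
  proof (cases "t \<in> U")
    case True
    then obtain d where d: "d > 0" "\<And>y. dist y t < d \<Longrightarrow> y \<in> U"
      using U(1) unfolding open_dist by blast
    define h where "h = min (d / 2) (b - t)"
    have h: "h > 0" "t + h \<le> b" "h < d" using d t by (auto simp: h_def)
    have "integral {t..t + h} q = integral {t..t + h} ?qU"
      by (rule integral_cong) (use d(2) h in \<open>auto simp: dist_real_def\<close>)
    then have "K t - K (t + h) \<le> integral {a..t + h} ?qU - integral {a..t} ?qU"
      using Kq[of t "t + h"] t h integral_Icc_add[OF qU(1), of t "t + h"] by auto
    moreover have "e1 * (t - a) \<le> e1 * (t + h - a)" using e1 h by (intro mult_left_mono) auto
    ultimately have "\<Psi> t \<le> \<Psi> (t + h)" by (simp add: \<Psi>_def)
    then show ?thesis using h by blast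
  next
    case False
    then have "t \<in> {a<..<b} - N" using U t by (auto simp: less_le)
    then obtain d where d: "d > 0" "\<And>h. 0 < h \<Longrightarrow> h < d \<Longrightarrow> K t - e1 * h \<le> K (t + h)"
      using Dini[of t e1] e1 by blast
    define h where "h = min (d / 2) (b - t)"
    have h: "h > 0" "t + h \<le> b" "h < d" using d t by (auto simp: h_def)
    have "0 \<le> integral {t..t + h} ?qU"
      by (rule Henstock_Kurzweil_Integration.integral_nonneg[OF integrable_on_Icc_subset[OF qU(1)]]) (use q(2) t h in auto)
    then have "integral {a..t} ?qU \<le> integral {a..t + h} ?qU"
      using integral_Icc_add[OF qU(1), of t "t + h"] t h by auto
    then have "\<Psi> t \<le> \<Psi> (t + h)" using d(2)[of h] h by (simp add: \<Psi>_def algebra_simps)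
    then show ?thesis using h by blast
  qed
  define A where "A = {t \<in> {a..b}. \<Psi> a \<le> \<Psi> t}"
  have "closed A" unfolding A_def
    using continuous_closed_preimage[OF \<Psi>c closed_atLeastAtMost, of "{\<Psi> a..}"]
    by (auto simp: vimage_def Int_def conj_commute)
  moreover have A: "A \<subseteq> {a..b}" "a \<in> A" using \<open>a \<le> b\<close> by (auto simp: A_def)
  moreover have "bdd_above A" using A(1) by (meson bdd_above.I2 bdd_above_Icc bdd_above_mono)
  ultimately have S: "Sup A \<in> A" by (intro closed_contains_Sup) auto
  have "Sup A = b"
  proof (rule ccontr)
    assume "Sup A \<noteq> b"
    then have "a \<le> Sup A" "Sup A < b" using S A(1) by fastforce+
    then obtain h where h: "h > 0" "Sup A + h \<le> b" "\<Psi> (Sup A) \<le> \<Psi> (Sup A + h)" using step by blast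
    then have "Sup A + h \<in> A" using S \<open>a \<le> Sup A\<close> by (auto simp: A_def)
    then have "Sup A + h \<le> Sup A" using \<open>bdd_above A\<close> by (rule cSup_upper)
    then show False using h by simp
  qed
  then have "\<Psi> a \<le> \<Psi> b" using S by (auto simp: A_def)
  then show "K a \<le> K b + e" using e1 qU(2) by (simp add: \<Psi>_def)
qed

text \<open>An abstract curve of energies: \<open>G\<close> is the energy along the curve,
  \<open>D\<close> its expected derivative, \<open>R t \<tau>\<close> the tested increment with base
  time t, \<open>m\<close> the slope, \<open>v\<close> the speed of the curve and \<open>p\<close> a
  further density. In \<open>R_bound\<close> the slope enters at the base time only.
  \<open>Fin\<close> accompanies \<open>G\<close> because the real number \<open>G \<tau>\<close>
  means something only where the energy is finite; accordingly \<open>subgrad\<close> is asked only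
  at finite \<tau>, and \<open>lsc\<close> delivers finiteness together with the bound. The locale
  is instantiated twice, with the energy and with half the squared L2 norm.\<close>

locale subgradient_flow =
  fixes G D m v p :: "real \<Rightarrow> real" and R :: "real \<Rightarrow> real \<Rightarrow> real"
    and Fin :: "real \<Rightarrow> bool" and N :: "real set" and a b :: real
  assumes ab: "a < b"
    and m: "(\<lambda>r. (m r)\<^sup>2) integrable_on {a..b}" "\<And>r. 0 \<le> m r"
    and v: "v integrable_on {a..b}" "(\<lambda>r. (v r)\<^sup>2) integrable_on {a..b}" "\<And>r. 0 \<le> v r"
    and p: "p integrable_on {a..b}" "\<And>r. 0 \<le> p r"
    and D: "D absolutely_integrable_on {a..b}"
    and N: "negligible N"
    and Fin: "\<And>t. t \<in> {a..b} - N \<Longrightarrow> Fin t"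
    and subgrad: "\<And>t \<tau>. t \<in> {a..b} - N \<Longrightarrow> \<tau> \<in> {a..b} \<Longrightarrow> Fin \<tau> \<Longrightarrow> G t + R t \<tau> \<le> G \<tau>"
    and R_bound: "\<And>t \<tau>. t \<in> {a..b} - N \<Longrightarrow> \<tau> \<in> {a..b} \<Longrightarrow>
      \<bar>R t \<tau>\<bar> \<le> m t * integral {min t \<tau>..max t \<tau>} v + integral {min t \<tau>..max t \<tau>} p"
    and R_lim: "\<And>t. t \<in> {a<..<b} - N \<Longrightarrow> ((\<lambda>\<tau>. R t \<tau> / (\<tau> - t)) \<longlongrightarrow> D t) (at t)"
    and lsc: "\<And>t x c c'. t \<in> {a..b} \<Longrightarrow> (\<And>n. x n \<in> {a..b}) \<Longrightarrow> x \<longlonglongrightarrow> t \<Longrightarrow>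
      (\<And>n. Fin (x n)) \<Longrightarrow> (\<And>n::nat. G (x n) \<le> c n) \<Longrightarrow> c \<longlonglongrightarrow> c' \<Longrightarrow> Fin t \<and> G t \<le> c'"
begin

section \<open>Increments along partitions for a subgradient flow\<close>

lemma mono_int: "integral {x..y} f \<le> integral {x'..y'} f"
  if "f integrable_on {a..b}" "\<And>r. 0 \<le> f r" "a \<le> x'" "x' \<le> x" "y \<le> y'" "y' \<le> b" for f :: "real \<Rightarrow> real"
  by (rule integral_subset_le) (use that integrable_on_Icc_subset[OF that(1), of x y] integrable_on_Icc_subset[OF that(1), of x' y'] in auto)

lemma nonneg_int: "0 \<le> integral {x..y} f"
  if "f integrable_on {a..b}" "\<And>r. 0 \<le> f r" "a \<le> x" "y \<le> b" for f :: "real \<Rightarrow> real"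
  by (rule Henstock_Kurzweil_Integration.integral_nonneg[OF integrable_on_Icc_subset[OF that(1)]]) (use that in auto)

text \<open>The density that dominates increments. The weight 2 on the squared speed is what two
  good points in a pair of adjacent cells cost after Young's inequality, and the summand 1 absorbs
  the slack in \<open>good_point\<close>.\<close>

definition q where "q r = (m r)\<^sup>2 + 2 * (v r)\<^sup>2 + p r + 1"

lemma q: "q integrable_on {a..b}" "0 \<le> q r"
  unfolding q_def using p(2)[of r]
  by (auto intro!: Henstock_Kurzweil_Integration.integrable_add integrable_on_mult_right m v p simp: add_nonneg_nonneg)

lemma integral_q: "integral {x..y} q = integral {x..y} (\<lambda>r. (m r)\<^sup>2) + 2 * integral {x..y} (\<lambda>r. (v r)\<^sup>2)
    + integral {x..y} p + (y - x)" if "a \<le> x" "x \<le> y" "y \<le> b"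
proof -
  have "((\<lambda>r. (m r)\<^sup>2 + 2 * (v r)\<^sup>2 + p r + 1) has_integral (integral {x..y} (\<lambda>r. (m r)\<^sup>2) + 2 * integral {x..y} (\<lambda>r. (v r)\<^sup>2)
    + integral {x..y} p + (y - x))) {x..y}"
    by (intro has_integral_add has_integral_mult_right integrable_integral integrable_on_Icc_subset[OF m(1)] integrable_on_Icc_subset[OF v(2)] integrable_on_Icc_subset[OF p(1)])
      (use that has_integral_const_real[of "1::real" x y] in auto)
  then show ?thesis unfolding q_def[abs_def] by (rule integral_unique)
qed

lemma good_point:
  assumes "a \<le> c" "c < d" "d \<le> b"
  shows "\<exists>t\<in>{c..d} - N. (m t)\<^sup>2 * (d - c) \<le> integral {c..d} (\<lambda>r. (m r)\<^sup>2) + (d - c)"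
  using exists_below_average[OF integrable_on_Icc_subset[OF m(1)] _ N, of c d] assms by auto

text \<open>Young's inequality with weight h, followed by Cauchy-Schwarz for the integral of
  \<open>v\<close>. The cell length as weight turns the pointwise bound on k into an integral one
  and cancels the length factor of Cauchy-Schwarz.\<close>

lemma slope_times_length:
  assumes "a \<le> c" "0 < h" "c \<le> d" "d \<le> b" and "0 \<le> k" "k\<^sup>2 * h \<le> M + h"
  shows "k * integral {c..d} v \<le> (M + h) / 2 + (d - c) * integral {c..d} (\<lambda>r. (v r)\<^sup>2) / (2 * h)"
proof -
  let ?V = "integral {c..d} v"
  have "0 \<le> (k * h - ?V)\<^sup>2 / (2 * h)" using assms by simp
  also have "\<dots> = k\<^sup>2 * h / 2 + ?V\<^sup>2 / (2 * h) - k * ?V"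
    using assms by (simp add: power2_eq_square field_simps)
  finally have "k * ?V \<le> k\<^sup>2 * h / 2 + ?V\<^sup>2 / (2 * h)" by simp
  moreover have "?V\<^sup>2 / (2 * h) \<le> ((d - c) * integral {c..d} (\<lambda>r. (v r)\<^sup>2)) / (2 * h)"
    using assms by (intro divide_right_mono integral_square_le integrable_on_Icc_subset[OF v(1)] integrable_on_Icc_subset[OF v(2)]) auto
  moreover have "k\<^sup>2 * h / 2 \<le> (M + h) / 2" using assms by simp
  ultimately show ?thesis by (meson add_mono order_trans)
qed

text \<open>Both points are admissible base times, so the one-sided inequality can be read in both
  directions.\<close>

lemma two_point_bound:
  assumes t: "t \<in> {c..d} - N" and \<tau>: "\<tau> \<in> {c..d} - N" and cd: "a \<le> c" "d \<le> b"
  shows "\<bar>G t - G \<tau>\<bar> \<le> (m t + m \<tau>) * integral {c..d} v + integral {c..d} p"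
proof -
  have one: "G x - G y \<le> m x * integral {c..d} v + integral {c..d} p"
    if x: "x \<in> {c..d} - N" and y: "y \<in> {c..d} - N" for x y
  proof -
    have "G x - G y \<le> \<bar>R x y\<bar>" using subgrad[of x y] Fin[of y] x y cd by auto
    also have "\<dots> \<le> m x * integral {min x y..max x y} v + integral {min x y..max x y} p"
      using x y cd by (intro R_bound) auto
    also have "\<dots> \<le> m x * integral {c..d} v + integral {c..d} p"
      using x y cd by (intro add_mono mult_left_mono mono_int v p m) auto
    finally show ?thesis .
  qed
  have "0 \<le> integral {c..d} v" using cd by (intro nonneg_int v)
  then have "0 \<le> m t * integral {c..d} v" "0 \<le> m \<tau> * integral {c..d} v" using m(2) by auto
  then show ?thesis using one[OF t \<tau>] one[OF \<tau> t] by (simp add: distrib_right)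
qed

text \<open>One good point is chosen in each of the n + 1 cells. Consecutive good points lie in two
  adjacent cells, so each cell is charged at most twice, whence the factor 2. The first and last
  good points are returned because they lie within h of the ends.\<close>

lemma partition_bound:
  fixes \<alpha> \<beta> h :: real and n :: nat
  assumes "a \<le> \<alpha>" "\<alpha> < \<beta>" "\<beta> \<le> b" and n: "h * Suc n = \<beta> - \<alpha>"
  shows "\<exists>s t. s \<in> {\<alpha>..\<alpha> + h} - N \<and> t \<in> {\<beta> - h..\<beta>} - N \<and>
    (m s)\<^sup>2 * h \<le> integral {\<alpha>..\<alpha> + h} (\<lambda>r. (m r)\<^sup>2) + h \<and>
    (m t)\<^sup>2 * h \<le> integral {\<beta> - h..\<beta>} (\<lambda>r. (m r)\<^sup>2) + h \<and>
    \<bar>G t - G s\<bar> \<le> 2 * integral {\<alpha>..\<beta>} q"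
proof -
  have h: "h > 0"
  proof (rule ccontr)
    assume "\<not> h > 0"
    then have "h * Suc n \<le> 0" by (intro mult_nonpos_nonneg) auto
    then have "\<beta> - \<alpha> \<le> 0" unfolding n .
    then show False using assms(2) by simp
  qed
  define x where "x i = \<alpha> + h * real i" for i
  have x_Suc: "x (Suc i) = x i + h" for i by (simp add: x_def algebra_simps)
  have x_le: "x i \<le> \<beta>" if "i \<le> Suc n" for i
  proof -
    have "h * real i \<le> h * Suc n" using that h by (intro mult_left_mono) auto
    then show ?thesis using n by (simp add: x_def)
  qed
  have x_ge: "\<alpha> \<le> x i" for i using h by (simp add: x_def)
  have "\<exists>t\<in>{x i..x i + h} - N. (m t)\<^sup>2 * h \<le> integral {x i..x i + h} (\<lambda>r. (m r)\<^sup>2) + h" if "i \<le> n" for i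
    using good_point[of "x i" "x i + h"] x_ge[of i] x_le[of "Suc i"] that assms h by (auto simp: x_Suc)
  then obtain t where t: "\<And>i. i \<le> n \<Longrightarrow> t i \<in> {x i..x i + h} - N"
    "\<And>i. i \<le> n \<Longrightarrow> (m (t i))\<^sup>2 * h \<le> integral {x i..x i + h} (\<lambda>r. (m r)\<^sup>2) + h" by metis
  have qsub: "q integrable_on {c..d}" if "a \<le> c" "d \<le> b" for c d by (rule integrable_on_Icc_subset[OF q(1) that])
  define Q where "Q y = integral {\<alpha>..y} q" for y
  have Q: "integral {c..d} q = Q d - Q c" if "\<alpha> \<le> c" "c \<le> d" "d \<le> b" for c d
    using Henstock_Kurzweil_Integration.integral_combine[of \<alpha> c d q] that assms qsub[of \<alpha> d] by (simp add: Q_def)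
  have link: "\<bar>G (t (Suc i)) - G (t i)\<bar> \<le> Q (x (Suc (Suc i))) - Q (x i)" if i: "Suc i \<le> n" for i
  proof -
    let ?c = "x i" and ?d = "x i + 2 * h"
    have xi: "a \<le> ?c" "\<alpha> \<le> ?c" "?c \<le> ?d" "?d \<le> b"
      using x_ge[of i] x_le[of "Suc (Suc i)"] i assms h by (auto simp: x_Suc)
    let ?V2 = "integral {?c..?d} (\<lambda>r. (v r)\<^sup>2)"
    have "t i \<in> {?c..?d} - N" "t (Suc i) \<in> {?c..?d} - N"
      using t(1)[of i] t(1)[of "Suc i"] i h by (auto simp: x_Suc)
    then have "\<bar>G (t (Suc i)) - G (t i)\<bar> \<le> (m (t (Suc i)) + m (t i)) * integral {?c..?d} v + integral {?c..?d} p"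
      using xi by (intro two_point_bound) auto
    also have "\<dots> = m (t (Suc i)) * integral {?c..?d} v + m (t i) * integral {?c..?d} v + integral {?c..?d} p"
      by (simp add: distrib_right)
    also have "\<dots> \<le> ((integral {x i + h..?d} (\<lambda>r. (m r)\<^sup>2) + h) / 2 + (?d - ?c) * ?V2 / (2 * h)) +
        ((integral {?c..x i + h} (\<lambda>r. (m r)\<^sup>2) + h) / 2 + (?d - ?c) * ?V2 / (2 * h)) + integral {?c..?d} p"
      using t(2)[of i] t(2)[of "Suc i"] i xi h m(2)
      by (intro add_mono slope_times_length) (auto simp: x_Suc algebra_simps)
    also have "\<dots> = (integral {?c..x i + h} (\<lambda>r. (m r)\<^sup>2) + integral {x i + h..?d} (\<lambda>r. (m r)\<^sup>2)) / 2 + h + 2 * ?V2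
        + integral {?c..?d} p"
      using h by (simp add: field_simps)
    also have "integral {?c..x i + h} (\<lambda>r. (m r)\<^sup>2) + integral {x i + h..?d} (\<lambda>r. (m r)\<^sup>2) = integral {?c..?d} (\<lambda>r. (m r)\<^sup>2)"
      using xi h by (intro Henstock_Kurzweil_Integration.integral_combine integrable_on_Icc_subset[OF m(1)]) auto
    also have "integral {?c..?d} (\<lambda>r. (m r)\<^sup>2) / 2 + h + 2 * ?V2 + integral {?c..?d} p \<le> integral {?c..?d} q"
      using integral_q[of ?c ?d] xi h nonneg_int[OF m(1), of ?c ?d] by auto
    also have "\<dots> = Q (x (Suc (Suc i))) - Q (x i)"
      using Q[of ?c ?d] xi by (simp add: x_Suc add.assoc)
    finally show ?thesis .
  qed
  \<comment> \<open>The bounds from \<open>link\<close> skip one grid point, so their sum is two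
    interlaced telescoping sums.\<close>
  have "\<bar>G (t i) - G (t 0)\<bar> \<le> Q (x (Suc i)) + Q (x i)" if "i \<le> n" for i
    using that
  proof (induction i)
    case 0
    have "Q (x 0) \<ge> 0" "Q (x 1) \<ge> 0"
      unfolding Q_def using x_le[of 0] x_le[of 1] assms by (auto intro!: nonneg_int q)
    then show ?case by simp
  next
    case (Suc i)
    then show ?case using link[of i] by simp
  qed
  from this[of n] have "\<bar>G (t n) - G (t 0)\<bar> \<le> Q (x (Suc n)) + Q (x n)" by simp
  also have "\<dots> \<le> Q \<beta> + Q \<beta>"
    unfolding Q_def using x_le assms by (intro add_mono mono_int q) auto
  finally have "\<bar>G (t n) - G (t 0)\<bar> \<le> 2 * integral {\<alpha>..\<beta>} q" by (simp add: Q_def)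
  moreover have "x 0 = \<alpha>" "x n = \<beta> - h" using n by (auto simp: x_def algebra_simps)
  ultimately show ?thesis using t[of 0] t[of n] by (intro exI[of _ "t 0"] exI[of _ "t n"]) auto
qed

text \<open>The slope at y is not controlled, so y cannot serve as base time; only the good point
  \<open>s\<close> does, and only an upper bound for \<open>G s\<close> results.\<close>

lemma end_point:
  assumes "a \<le> c" "0 < h" "c + h \<le> b" and s: "s \<in> {c..c + h} - N"
    and ms: "(m s)\<^sup>2 * h \<le> integral {c..c + h} (\<lambda>r. (m r)\<^sup>2) + h"
    and y: "y \<in> {c..c + h}" "Fin y"
  shows "G s \<le> G y + integral {c..c + h} q"
proof -
  have "G s - G y \<le> \<bar>R s y\<bar>" using subgrad[of s y] assms by auto
  also have "\<dots> \<le> m s * integral {min s y..max s y} v + integral {min s y..max s y} p"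
    using assms by (intro R_bound) auto
  also have "\<dots> \<le> m s * integral {c..c + h} v + integral {c..c + h} p"
    using assms by (intro add_mono mult_left_mono mono_int v p m) auto
  also have "\<dots> \<le> ((integral {c..c + h} (\<lambda>r. (m r)\<^sup>2) + h) / 2 + (c + h - c) * integral {c..c + h} (\<lambda>r. (v r)\<^sup>2) / (2 * h))
      + integral {c..c + h} p"
    using assms m(2) by (intro add_mono slope_times_length) auto
  also have "(c + h - c) * integral {c..c + h} (\<lambda>r. (v r)\<^sup>2) / (2 * h) = integral {c..c + h} (\<lambda>r. (v r)\<^sup>2) / 2"
    using assms by simp
  finally have "G s - G y \<le> (integral {c..c + h} (\<lambda>r. (m r)\<^sup>2) + h) / 2 +
    integral {c..c + h} (\<lambda>r. (v r)\<^sup>2) / 2 + integral {c..c + h} p" .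
  moreover have "0 \<le> integral {c..c + h} (\<lambda>r. (m r)\<^sup>2)" "0 \<le> integral {c..c + h} (\<lambda>r. (v r)\<^sup>2)"
    using assms by (intro nonneg_int m v; simp)+
  moreover have "x - y \<le> (A + h) / 2 + B / 2 + P \<Longrightarrow> 0 \<le> A \<Longrightarrow> 0 \<le> B \<Longrightarrow> x \<le> y + (A + 2 * B + P + h)"
    for x y A B P :: real using assms(2) by (simp add: field_simps)
  ultimately have "G s \<le> G y + (integral {c..c + h} (\<lambda>r. (m r)\<^sup>2) + 2 * integral {c..c + h} (\<lambda>r. (v r)\<^sup>2)
      + integral {c..c + h} p + h)" by blast
  then show ?thesis using integral_q[of c "c + h"] assms(1-3) by simp
qed

text \<open>The mesh tends to 0. At the end whose energy is assumed finite, \<open>end_point\<close>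
  compares it with the nearby good point; at the other end lower semicontinuity along the good
  points gives finiteness and the bound at once.\<close>

lemma increment_bound:
  assumes "a \<le> \<alpha>" "\<alpha> < \<beta>" "\<beta> \<le> b"
  shows "Fin \<beta> \<Longrightarrow> Fin \<alpha> \<and> G \<alpha> \<le> G \<beta> + 2 * integral {\<alpha>..\<beta>} q"
    and "Fin \<alpha> \<Longrightarrow> Fin \<beta> \<and> G \<beta> \<le> G \<alpha> + 2 * integral {\<alpha>..\<beta>} q"
proof -
  define h where "h n = (\<beta> - \<alpha>) / Suc n" for n
  have h: "h n > 0" "h n * Suc n = \<beta> - \<alpha>" "h n \<le> \<beta> - \<alpha>" for n
  proof -
    have "(\<beta> - \<alpha>) / Suc n \<le> (\<beta> - \<alpha>) / 1" using assms by (intro divide_left_mono) auto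
    then show "h n > 0" "h n * Suc n = \<beta> - \<alpha>" "h n \<le> \<beta> - \<alpha>"
      using assms by (simp_all add: h_def del: of_nat_Suc)
  qed
  have h0: "h \<longlonglongrightarrow> 0" unfolding h_def by (rule LIMSEQ_Suc[OF lim_const_over_n])
  have "\<forall>n. \<exists>s t. s \<in> {\<alpha>..\<alpha> + h n} - N \<and> t \<in> {\<beta> - h n..\<beta>} - N \<and>
    (m s)\<^sup>2 * h n \<le> integral {\<alpha>..\<alpha> + h n} (\<lambda>r. (m r)\<^sup>2) + h n \<and>
    (m t)\<^sup>2 * h n \<le> integral {\<beta> - h n..\<beta>} (\<lambda>r. (m r)\<^sup>2) + h n \<and>
    \<bar>G t - G s\<bar> \<le> 2 * integral {\<alpha>..\<beta>} q"
    using partition_bound[OF assms h(2)] by blast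
  then obtain s t where s: "\<And>n. s n \<in> {\<alpha>..\<alpha> + h n} - N" and t: "\<And>n. t n \<in> {\<beta> - h n..\<beta>} - N"
    and ms: "\<And>n. (m (s n))\<^sup>2 * h n \<le> integral {\<alpha>..\<alpha> + h n} (\<lambda>r. (m r)\<^sup>2) + h n"
    and mt: "\<And>n. (m (t n))\<^sup>2 * h n \<le> integral {\<beta> - h n..\<beta>} (\<lambda>r. (m r)\<^sup>2) + h n"
    and st: "\<And>n. \<bar>G (t n) - G (s n)\<bar> \<le> 2 * integral {\<alpha>..\<beta>} q"
    by metis
  have Qc: "continuous_on {a..b} (\<lambda>x. integral {a..x} q)"
    by (rule indefinite_integral_continuous_1[OF q(1)])
  have Q_diff: "integral {c..d} q = integral {a..d} q - integral {a..c} q" if "a \<le> c" "c \<le> d" "d \<le> b" for c d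
    using integral_Icc_add[OF q(1) that] by simp
  have lim_\<alpha>: "(\<lambda>n. integral {\<alpha>..\<alpha> + h n} q) \<longlonglongrightarrow> 0"
  proof -
    have "(\<lambda>n. \<alpha> + h n) \<longlonglongrightarrow> \<alpha>" using tendsto_add[OF tendsto_const h0] by simp
    then have "(\<lambda>n. integral {a..\<alpha> + h n} q) \<longlonglongrightarrow> integral {a..\<alpha>} q"
      using assms h(1,3) by (intro continuous_on_tendsto_compose[OF Qc] always_eventually)
        (auto simp: less_imp_le add_increasing2 algebra_simps intro: order_trans)
    then have "(\<lambda>n. integral {a..\<alpha> + h n} q - integral {a..\<alpha>} q) \<longlonglongrightarrow> 0" by (simp add: LIM_zero)
    moreover have "integral {\<alpha>..\<alpha> + h n} q = integral {a..\<alpha> + h n} q - integral {a..\<alpha>} q" for n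
      using h(1,3)[of n] assms by (intro Q_diff) auto
    ultimately show ?thesis by simp
  qed
  have lim_\<beta>: "(\<lambda>n. integral {\<beta> - h n..\<beta>} q) \<longlonglongrightarrow> 0"
  proof -
    have "(\<lambda>n. \<beta> - h n) \<longlonglongrightarrow> \<beta>" using tendsto_diff[OF tendsto_const h0] by simp
    moreover have "\<beta> - h n \<in> {a..b}" for n using h(1,3)[of n] assms by auto
    ultimately have "(\<lambda>n. integral {a..\<beta> - h n} q) \<longlonglongrightarrow> integral {a..\<beta>} q"
      using assms by (intro continuous_on_tendsto_compose[OF Qc] always_eventually) auto
    then have "(\<lambda>n. integral {a..\<beta>} q - integral {a..\<beta> - h n} q) \<longlonglongrightarrow> integral {a..\<beta>} q - integral {a..\<beta>} q"
      by (intro tendsto_diff tendsto_const)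
    moreover have "integral {\<beta> - h n..\<beta>} q = integral {a..\<beta>} q - integral {a..\<beta> - h n} q" for n
      using h(1,3)[of n] assms by (intro Q_diff) auto
    ultimately show ?thesis by simp
  qed
  have sab: "s n \<in> {a..b} - N" "t n \<in> {a..b} - N" for n
    using s[of n] t[of n] h(1,3)[of n] assms by auto
  have s_lim: "s \<longlonglongrightarrow> \<alpha>"
  proof (rule tendsto_sandwich[of "\<lambda>_. \<alpha>" s _ "\<lambda>n. \<alpha> + h n"])
    show "(\<lambda>n. \<alpha> + h n) \<longlonglongrightarrow> \<alpha>" using tendsto_add[OF tendsto_const h0] by simp
  qed (use s in auto)
  have t_lim: "t \<longlonglongrightarrow> \<beta>"
  proof (rule tendsto_sandwich[of "\<lambda>n. \<beta> - h n" t _ "\<lambda>_. \<beta>"])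
    show "(\<lambda>n. \<beta> - h n) \<longlonglongrightarrow> \<beta>" using tendsto_diff[OF tendsto_const h0] by simp
  qed (use t in auto)
  show "Fin \<alpha> \<and> G \<alpha> \<le> G \<beta> + 2 * integral {\<alpha>..\<beta>} q" if "Fin \<beta>"
  proof (rule lsc[where x=s and c="\<lambda>n. G \<beta> + integral {\<beta> - h n..\<beta>} q + 2 * integral {\<alpha>..\<beta>} q"])
    show "G (s n) \<le> G \<beta> + integral {\<beta> - h n..\<beta>} q + 2 * integral {\<alpha>..\<beta>} q" for n
      using end_point[of "\<beta> - h n" "h n" "t n" \<beta>] t[of n] mt[of n] st[of n] h(1,3)[of n] assms that by auto
    show "(\<lambda>n. G \<beta> + integral {\<beta> - h n..\<beta>} q + 2 * integral {\<alpha>..\<beta>} q) \<longlonglongrightarrow> G \<beta> + 2 * integral {\<alpha>..\<beta>} q"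
      using lim_\<beta> by (auto intro!: tendsto_eq_intros)
  qed (use sab s_lim Fin assms in auto)
  show "Fin \<beta> \<and> G \<beta> \<le> G \<alpha> + 2 * integral {\<alpha>..\<beta>} q" if "Fin \<alpha>"
  proof (rule lsc[where x=t and c="\<lambda>n. G \<alpha> + integral {\<alpha>..\<alpha> + h n} q + 2 * integral {\<alpha>..\<beta>} q"])
    show "G (t n) \<le> G \<alpha> + integral {\<alpha>..\<alpha> + h n} q + 2 * integral {\<alpha>..\<beta>} q" for n
      using end_point[of \<alpha> "h n" "s n" \<alpha>] s[of n] ms[of n] st[of n] h(1,3)[of n] assms that by auto
    show "(\<lambda>n. G \<alpha> + integral {\<alpha>..\<alpha> + h n} q + 2 * integral {\<alpha>..\<beta>} q) \<longlonglongrightarrow> G \<alpha> + 2 * integral {\<alpha>..\<beta>} q"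
      using lim_\<alpha> by (auto intro!: tendsto_eq_intros)
  qed (use sab t_lim Fin assms in auto)
qed

lemma Fin_everywhere: "Fin t" if "t \<in> {a..b}"
proof -
  \<comment> \<open>Almost every time is finite; one such time spreads finiteness to the whole
    interval.\<close>
  obtain t0 where "t0 \<in> {a..b}" "Fin t0" using good_point[of a b] ab Fin by auto
  then show ?thesis
    using increment_bound[of t t0] increment_bound[of t0 t] that by (cases t t0 rule: linorder_cases) auto
qed

text \<open>Subtracting the integral of \<open>D\<close> leaves a function \<open>K\<close> whose
  increments are bounded below to first order on both sides of almost every point. Read forwards
  this makes \<open>K\<close> nondecreasing, read backwards nonincreasing.\<close>

theorem integral_of_slope: "G b - G a = integral {a..b} D"
proof -
  define K where "K t = G t - integral {a..t} D" for t
  have Di: "D integrable_on {a..b}" and aDi: "(\<lambda>r. \<bar>D r\<bar>) integrable_on {a..b}"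
    using D by (auto simp: absolutely_integrable_on_def)
  define Q where "Q r = 2 * q r + \<bar>D r\<bar>" for r
  have Q: "Q integrable_on {a..b}" "\<And>r. 0 \<le> Q r"
    unfolding Q_def using q by (auto intro!: Henstock_Kurzweil_Integration.integrable_add integrable_on_mult_right aDi)
  have KQ: "\<bar>K y - K x\<bar> \<le> integral {x..y} Q" if xy: "a \<le> x" "x \<le> y" "y \<le> b" for x y
  proof -
    have "\<bar>G y - G x\<bar> \<le> 2 * integral {x..y} q"
      using increment_bound[of x y] Fin_everywhere[of x] Fin_everywhere[of y] xy by (cases "x = y") auto
    moreover have "\<bar>integral {x..y} D\<bar> \<le> integral {x..y} (\<lambda>r. \<bar>D r\<bar>)"
      using integral_norm_bound_integral[of D "{x..y}" "\<lambda>r. \<bar>D r\<bar>"] integrable_on_Icc_subset[OF Di] integrable_on_Icc_subset[OF aDi] xy by auto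
    moreover have "integral {x..y} Q = 2 * integral {x..y} q + integral {x..y} (\<lambda>r. \<bar>D r\<bar>)"
      unfolding Q_def using xy integrable_on_Icc_subset[OF q(1), of x y] integrable_on_Icc_subset[OF aDi, of x y]
      by (subst Henstock_Kurzweil_Integration.integral_add) (auto intro: integrable_on_mult_right)
    ultimately show ?thesis using integral_Icc_add[OF Di xy] unfolding K_def by linarith
  qed
  obtain N1 where N1: "negligible N1"
    "\<And>t. t \<in> {a<..<b} - N1 \<Longrightarrow> ((\<lambda>t. integral {a..t} D) has_real_derivative D t) (at t)"
    using lebesgue_differentiation[OF Di] by metis
  \<comment> \<open>The sign of h is free: for negative h the same subgradient inequality bounds
    \<open>K\<close> from below at an earlier time.\<close>
  have Dini: "\<exists>d>0. \<forall>h. h \<noteq> 0 \<and> \<bar>h\<bar> < d \<longrightarrow> K t - e * \<bar>h\<bar> \<le> K (t + h)"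
    if t: "t \<in> {a<..<b} - (N \<union> N1)" and "0 < e" for t e
  proof -
    have "((\<lambda>h. (integral {a..t + h} D - integral {a..t} D) / h) \<longlongrightarrow> D t) (at 0)"
      using N1(2)[of t] t unfolding DERIV_def by auto
    moreover have "((\<lambda>h. R t (t + h) / h) \<longlongrightarrow> D t) (at 0)"
      using LIM_offset_zero[OF R_lim[of t]] t by auto
    ultimately have "((\<lambda>h. R t (t + h) / h - (integral {a..t + h} D - integral {a..t} D) / h) \<longlongrightarrow> D t - D t) (at 0)"
      by (intro tendsto_diff)
    from LIM_D[OF this \<open>0 < e\<close>]
    obtain d where d: "d > 0" "\<And>h. h \<noteq> 0 \<Longrightarrow> \<bar>h\<bar> < d \<Longrightarrow>
       \<bar>R t (t + h) / h - (integral {a..t + h} D - integral {a..t} D) / h\<bar> < e"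
      by auto
    show ?thesis
    proof (intro exI[of _ "min d (min (t - a) (b - t))"] conjI allI impI)
      show "0 < min d (min (t - a) (b - t))" using d t by auto
      fix h assume h: "h \<noteq> 0 \<and> \<bar>h\<bar> < min d (min (t - a) (b - t))"
      have "\<bar>(R t (t + h) - (integral {a..t + h} D - integral {a..t} D)) / h\<bar> < e"
        using d(2)[of h] h by (simp add: diff_divide_distrib)
      then have "\<bar>R t (t + h) - (integral {a..t + h} D - integral {a..t} D)\<bar> < e * \<bar>h\<bar>"
        using h by (simp add: abs_divide divide_less_eq)
      moreover have "G t + R t (t + h) \<le> G (t + h)"
        using t h by (intro subgrad Fin_everywhere) auto
      ultimately show "K t - e * \<bar>h\<bar> \<le> K (t + h)" unfolding K_def by linarith
    qed
  qed
  have neg: "negligible (N \<union> N1)" using N N1(1) by (rule negligible_Un)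
  have "K a \<le> K b"
  proof (rule mono_of_lower_Dini_derivative[OF _ Q KQ neg])
    fix t e :: real assume "t \<in> {a<..<b} - (N \<union> N1)" "0 < e"
    from Dini[OF this] obtain d where d: "d > 0" "\<And>h. h \<noteq> 0 \<Longrightarrow> \<bar>h\<bar> < d \<Longrightarrow> K t - e * \<bar>h\<bar> \<le> K (t + h)" by blast
    show "\<exists>d>0. \<forall>h. 0 < h \<and> h < d \<longrightarrow> K t - e * h \<le> K (t + h)"
    proof (intro exI[of _ d] conjI allI impI)
      fix h assume "0 < h \<and> h < d"
      then show "K t - e * h \<le> K (t + h)" using d(2)[of h] by simp
    qed (rule d(1))
  qed (use ab in auto)
  \<comment> \<open>The time-reversed function satisfies the same hypotheses, which yields
    \<open>K b \<le> K a\<close>.\<close>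
  moreover have "K (- (- b)) \<le> K (- (- a))"
  proof (rule mono_of_lower_Dini_derivative[where K="\<lambda>x. K (- x)" and q="\<lambda>x. Q (- x)"])
    show "(\<lambda>x. Q (- x)) integrable_on {- b..- a}"
      using Q(1) Henstock_Kurzweil_Integration.integrable_reflect_real by blast
    show "negligible (uminus ` (N \<union> N1))"
      using neg by (intro negligible_differentiable_image_negligible)
        (auto intro!: differentiable_on_minus differentiable_on_ident)
    fix x y assume xy: "- b \<le> x" "x \<le> y" "y \<le> - a"
    have "integral {x..y} (\<lambda>x. Q (- x)) = integral {- y..- x} Q"
      using Henstock_Kurzweil_Integration.integral_reflect_real[of "- x" "- y" Q] by simp
    then show "\<bar>K (- y) - K (- x)\<bar> \<le> integral {x..y} (\<lambda>x. Q (- x))"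
      using KQ[of "- y" "- x"] xy by (simp add: abs_minus_commute)
  next
    fix t e :: real assume t: "t \<in> {- b<..<- a} - uminus ` (N \<union> N1)" and "0 < e"
    have "- t \<in> {a<..<b} - (N \<union> N1)" using t by (force simp: image_iff)
    from Dini[OF this \<open>0 < e\<close>] obtain d where d: "d > 0"
      "\<And>h. h \<noteq> 0 \<Longrightarrow> \<bar>h\<bar> < d \<Longrightarrow> K (- t) - e * \<bar>h\<bar> \<le> K (- t + h)" by blast
    show "\<exists>d>0. \<forall>h. 0 < h \<and> h < d \<longrightarrow> K (- t) - e * h \<le> K (- (t + h))"
    proof (intro exI[of _ d] conjI allI impI)
      fix h assume "0 < h \<and> h < d"
      then show "K (- t) - e * h \<le> K (- (t + h))" using d(2)[of "- h"] by simp
    qed (rule d(1))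
  qed (use ab Q in auto)
  ultimately show ?thesis by (simp add: K_def)
qed

end

section \<open>Measurability and Lebesgue points in semi-inner product spaces\<close>

text \<open>The definitions speak of \<open>AE\<close>, the gauge integral of negligible sets;
  exceptional sets are carried as the latter so that they can be united.\<close>

lemma AE_lebesgue_on_iff_negligible:
  assumes "I \<in> sets lebesgue"
  shows "(AE t in lebesgue_on I. P t) \<longleftrightarrow> (\<exists>N. negligible N \<and> (\<forall>t\<in>I - N. P t))"
proof
  assume "AE t in lebesgue_on I. P t"
  then have "AE t in lebesgue. t \<in> I \<longrightarrow> P t" using assms by (simp add: AE_restrict_space_iff)
  then have "{t \<in> space lebesgue. \<not> (t \<in> I \<longrightarrow> P t)} \<in> null_sets lebesgue"
    by (simp only: completion.AE_iff_null_sets)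
  then show "\<exists>N. negligible N \<and> (\<forall>t\<in>I - N. P t)"
    by (intro exI[of _ "{t \<in> space lebesgue. \<not> (t \<in> I \<longrightarrow> P t)}"]) (simp add: negligible_iff_null_sets)
next
  assume "\<exists>N. negligible N \<and> (\<forall>t\<in>I - N. P t)"
  then obtain N where N: "N \<in> null_sets lebesgue" "\<forall>t\<in>I - N. P t"
    by (auto simp: negligible_iff_null_sets)
  then have "AE t in lebesgue. t \<in> I \<longrightarrow> P t" by (intro AE_I'[of N]) auto
  then show "AE t in lebesgue_on I. P t" using assms by (simp add: AE_restrict_space_iff)
qed

text \<open>Rests on the completeness of Lebesgue measure. It lets a limit that is identified only
  almost everywhere inherit measurability.\<close>

lemma borel_measurable_lebesgue_on_AE:
  fixes f :: "'a::euclidean_space \<Rightarrow> real"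
  assumes f: "f \<in> borel_measurable (lebesgue_on I)" and I: "I \<in> sets lebesgue"
    and ae: "AE t in lebesgue_on I. f t = h t"
  shows "h \<in> borel_measurable (lebesgue_on I)"
proof -
  have "(\<lambda>t. indicator I t *\<^sub>R f t) \<in> borel_measurable lebesgue"
    using f I by (subst (asm) borel_measurable_restrict_space_iff) auto
  moreover have "AE t in lebesgue. indicator I t *\<^sub>R f t = indicator I t *\<^sub>R h t"
    using ae I by (subst (asm) AE_restrict_space_iff) (auto simp: indicator_def elim!: eventually_mono)
  ultimately have "(\<lambda>t. indicator I t *\<^sub>R h t) \<in> borel_measurable lebesgue"
    by (rule borel_measurable_AE)
  then show ?thesis using I by (subst borel_measurable_restrict_space_iff) auto
qed

lemma integrable_lebesgue_imp_integrable_on: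
  fixes f :: "real \<Rightarrow> real"
  assumes "integrable lebesgue f"
  shows "f absolutely_integrable_on {a..b}" "f integrable_on {a..b}"
proof -
  have "set_integrable lebesgue UNIV f" using assms by (simp add: set_integrable_def)
  then show "f absolutely_integrable_on {a..b}" by (rule set_integrable_subset) auto
  then show "f integrable_on {a..b}" by (rule set_lebesgue_integral_eq_integral)
qed

text \<open>Common frame for \<open>L2_space \<Omega>\<close> and \<open>X0 \<Omega> a\<close>. The
  form may be degenerate, because elements are representatives and almost everywhere vanishing
  functions have norm 0. The elements form a set inside a function type, so closure under two-term
  combinations replaces vector space classes.\<close>

locale semi_inner_space =
  fixes V :: "('b \<Rightarrow> real) set" and ip :: "('b \<Rightarrow> real) \<Rightarrow> ('b \<Rightarrow> real) \<Rightarrow> real"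
    and nrm :: "('b \<Rightarrow> real) \<Rightarrow> real"
  assumes zero: "(\<lambda>_. 0) \<in> V"
    and lin: "\<And>u v c d. u \<in> V \<Longrightarrow> v \<in> V \<Longrightarrow> (\<lambda>x. c * u x + d * v x) \<in> V"
    and ip_lin: "\<And>u v z c d. u \<in> V \<Longrightarrow> v \<in> V \<Longrightarrow> z \<in> V \<Longrightarrow>
      ip (\<lambda>x. c * u x + d * v x) z = c * ip u z + d * ip v z"
    and sym: "\<And>u v. u \<in> V \<Longrightarrow> v \<in> V \<Longrightarrow> ip u v = ip v u"
    and nrm_nonneg: "\<And>u. u \<in> V \<Longrightarrow> 0 \<le> nrm u"
    and nrm_sq: "\<And>u. u \<in> V \<Longrightarrow> (nrm u)\<^sup>2 = ip u u"
begin

lemma diff: "u \<in> V \<Longrightarrow> v \<in> V \<Longrightarrow> (\<lambda>x. u x - v x) \<in> V"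
  using lin[of u v 1 "-1"] by (simp only: mult_1 mult_minus1 diff_conv_add_uminus)

lemma ip_diff_left: "u \<in> V \<Longrightarrow> v \<in> V \<Longrightarrow> z \<in> V \<Longrightarrow> ip (\<lambda>x. u x - v x) z = ip u z - ip v z"
  using ip_lin[of u v z 1 "-1"] by (simp only: mult_1 mult_minus1 diff_conv_add_uminus)

lemma ip_diff_right: "u \<in> V \<Longrightarrow> v \<in> V \<Longrightarrow> z \<in> V \<Longrightarrow> ip z (\<lambda>x. u x - v x) = ip z u - ip z v"
  using ip_diff_left[of u v z] sym[of "\<lambda>x. u x - v x" z] sym[of u z] sym[of v z] diff[of u v]
  by (simp only:)

lemma nrm_lin_sq:
  assumes "u \<in> V" "v \<in> V"
  shows "(nrm (\<lambda>x. c * u x + d * v x))\<^sup>2 = c\<^sup>2 * (nrm u)\<^sup>2 + 2 * c * d * ip u v + d\<^sup>2 * (nrm v)\<^sup>2"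
proof -
  let ?w = "\<lambda>x. c * u x + d * v x"
  have wV: "?w \<in> V" using assms by (rule lin)
  have "ip ?w ?w = c * ip u ?w + d * ip v ?w" using assms wV by (intro ip_lin)
  moreover have "ip u ?w = c * ip u u + d * ip u v"
    using ip_lin[OF assms assms(1), of c d] sym[OF assms(1) wV] sym[OF assms] by (simp only:)
  moreover have "ip v ?w = c * ip u v + d * ip v v"
    using ip_lin[OF assms assms(2), of c d] sym[OF assms(2) wV] by (simp only:)
  ultimately show ?thesis
    unfolding nrm_sq[OF assms(1)] nrm_sq[OF assms(2)] nrm_sq[OF wV]
    by (simp add: algebra_simps power2_eq_square)
qed

lemma nrm_diff_sq:
  assumes "u \<in> V" "v \<in> V"
  shows "(nrm (\<lambda>x. u x - v x))\<^sup>2 = (nrm u)\<^sup>2 - 2 * ip u v + (nrm v)\<^sup>2"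
  using nrm_lin_sq[OF assms, of 1 "-1"] by (simp add: diff_conv_add_uminus del: add_uminus_conv_diff)

lemma Cauchy_Schwarz:
  assumes "u \<in> V" "v \<in> V"
  shows "\<bar>ip u v\<bar> \<le> nrm u * nrm v"
proof -
  have n: "0 \<le> nrm u" "0 \<le> nrm v" using assms nrm_nonneg by auto
  have "\<bar>ip u v\<bar> \<le> (nrm u + e) * (nrm v + e)" if "e > 0" for e
  proof -
    \<comment> \<open>Both norms may be 0, so they are enlarged by e to permit division; e tends to
      0 at the end.\<close>
    define A B where "A = nrm u + e" and "B = nrm v + e"
    have AB: "A > 0" "B > 0" using n that by (auto simp: A_def B_def)
    have s: "0 \<le> B\<^sup>2 * (nrm u)\<^sup>2 + 2 * B * (k * A) * ip u v + (k * A)\<^sup>2 * (nrm v)\<^sup>2" for k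
      using nrm_lin_sq[OF assms, of B "k * A"] by (metis zero_le_power2)
    have "(nrm u)\<^sup>2 \<le> A\<^sup>2" "(nrm v)\<^sup>2 \<le> B\<^sup>2" using n that by (auto simp: A_def B_def intro!: power_mono)
    then have "B\<^sup>2 * (nrm u)\<^sup>2 + A\<^sup>2 * (nrm v)\<^sup>2 \<le> B\<^sup>2 * A\<^sup>2 + A\<^sup>2 * B\<^sup>2"
      by (intro add_mono mult_left_mono) auto
    with s[of 1] s[of "-1"] have "2 * (A * B) * ip u v \<le> 2 * (A * B) * (A * B)"
      "- (2 * (A * B) * ip u v) \<le> 2 * (A * B) * (A * B)"
      by (simp_all add: power2_eq_square algebra_simps)
    then have "\<bar>2 * (A * B) * ip u v\<bar> \<le> 2 * (A * B) * (A * B)" by (rule abs_leI)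
    then have "2 * (A * B) * \<bar>ip u v\<bar> \<le> 2 * (A * B) * (A * B)" using AB by (simp add: abs_mult)
    then show ?thesis using AB by (simp add: A_def B_def)
  qed
  then have "\<bar>ip u v\<bar> \<le> (nrm u + 1 / Suc n) * (nrm v + 1 / Suc n)" for n by simp
  moreover have "(\<lambda>n. (nrm u + 1 / Suc n) * (nrm v + 1 / Suc n)) \<longlonglongrightarrow> (nrm u + 0) * (nrm v + 0)"
    by (intro tendsto_intros LIMSEQ_Suc[OF lim_const_over_n])
  ultimately show ?thesis by (intro LIMSEQ_le_const[where a="\<bar>ip u v\<bar>"]) auto
qed

lemma ip_tendsto:
  assumes u: "\<And>n. u n \<in> V" "u0 \<in> V" "(\<lambda>n. nrm (\<lambda>x. u n x - u0 x)) \<longlonglongrightarrow> 0"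
    and v: "\<And>n. v n \<in> V" "v0 \<in> V" "(\<lambda>n. nrm (\<lambda>x. v n x - v0 x)) \<longlonglongrightarrow> 0"
  shows "(\<lambda>n. ip (u n) (v n)) \<longlonglongrightarrow> ip u0 v0"
proof -
  let ?du = "\<lambda>n x. u n x - u0 x" and ?dv = "\<lambda>n x. v n x - v0 x"
  have dV: "?du n \<in> V" "?dv n \<in> V" for n using u v diff by auto
  have eq: "ip (u n) (v n) - ip u0 v0 = ip (?du n) (?dv n) + ip (?du n) v0 + ip u0 (?dv n)" for n
    using u v dV by (simp add: ip_diff_left ip_diff_right)
  have "(\<lambda>n. ip (u n) (v n) - ip u0 v0) \<longlonglongrightarrow> 0"
  proof (rule Lim_null_comparison)
    show "\<forall>\<^sub>F n in sequentially. norm (ip (u n) (v n) - ip u0 v0) \<le>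
        nrm (?du n) * nrm (?dv n) + nrm (?du n) * nrm v0 + nrm u0 * nrm (?dv n)"
    proof (rule always_eventually, rule allI)
      fix n
      show "norm (ip (u n) (v n) - ip u0 v0) \<le>
        nrm (?du n) * nrm (?dv n) + nrm (?du n) * nrm v0 + nrm u0 * nrm (?dv n)"
        using Cauchy_Schwarz[OF dV[of n]] Cauchy_Schwarz[OF dV(1)[of n] v(2)] Cauchy_Schwarz[OF u(2) dV(2)[of n]]
        unfolding eq by simp
    qed
    show "(\<lambda>n. nrm (?du n) * nrm (?dv n) + nrm (?du n) * nrm v0 + nrm u0 * nrm (?dv n)) \<longlonglongrightarrow> 0"
      using u(3) v(3) by (auto intro!: tendsto_eq_intros)
  qed
  then show ?thesis by (simp add: LIM_zero_cancel)
qed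

lemma nrm_0: "nrm (\<lambda>_. 0) = 0"
proof -
  have "(nrm (\<lambda>_. 0))\<^sup>2 = 0" using nrm_lin_sq[OF zero zero, of 0 0] by (simp only: mult_zero_left) simp
  then show ?thesis by simp
qed

text \<open>A pair of simple functions composed with \<open>ip\<close> is a real simple function, so
  no sigma-algebra on \<open>V\<close> is involved; \<open>ip_tendsto\<close> identifies the
  limit.\<close>

lemma ip_measurable:
  assumes f: "strongly_measurable I V nrm f" and h: "strongly_measurable I V nrm h"
    and I: "I \<in> sets lebesgue"
  shows "(\<lambda>t. ip (f t) (h t)) \<in> borel_measurable (lebesgue_on I)"
proof -
  from f obtain F where F: "AE t in lebesgue_on I. f t \<in> V" "\<And>n. simple_function (lebesgue_on I) (F n)"
    "\<And>n. F n ` I \<subseteq> V" "AE t in lebesgue_on I. (\<lambda>n. nrm (\<lambda>x. F n t x - f t x)) \<longlonglongrightarrow> 0"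
    unfolding strongly_measurable_def by blast
  from h obtain H where H: "AE t in lebesgue_on I. h t \<in> V" "\<And>n. simple_function (lebesgue_on I) (H n)"
    "\<And>n. H n ` I \<subseteq> V" "AE t in lebesgue_on I. (\<lambda>n. nrm (\<lambda>x. H n t x - h t x)) \<longlonglongrightarrow> 0"
    unfolding strongly_measurable_def by blast
  have "(\<lambda>t. lim (\<lambda>n. ip (F n t) (H n t))) \<in> borel_measurable (lebesgue_on I)"
    by (intro borel_measurable_lim_metric borel_measurable_simple_function
        simple_function_compose2[OF F(2) H(2), where h=ip])
  moreover have "AE t in lebesgue_on I. lim (\<lambda>n. ip (F n t) (H n t)) = ip (f t) (h t)"
    using F(1,4) H(1,4) AE_space
  proof eventually_elim
    case (elim t)
    then have "F n t \<in> V" "H n t \<in> V" for n using F(3)[of n] H(3)[of n] by auto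
    then have "(\<lambda>n. ip (F n t) (H n t)) \<longlonglongrightarrow> ip (f t) (h t)"
      using elim by (intro ip_tendsto) auto
    then show ?case by (rule limI)
  qed
  ultimately show ?thesis by (rule borel_measurable_lebesgue_on_AE[OF _ I])
qed

lemma strongly_measurable_const: "z \<in> V \<Longrightarrow> strongly_measurable I V nrm (\<lambda>_. z)"
  unfolding strongly_measurable_def
  by (auto intro!: exI[of _ "\<lambda>_ _. z"] simp: nrm_0)

lemma nrm_measurable:
  assumes f: "strongly_measurable I V nrm f" and I: "I \<in> sets lebesgue"
  shows "(\<lambda>t. nrm (f t)) \<in> borel_measurable (lebesgue_on I)"
proof (rule borel_measurable_lebesgue_on_AE[OF _ I])
  show "(\<lambda>t. sqrt (ip (f t) (f t))) \<in> borel_measurable (lebesgue_on I)"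
    using ip_measurable[OF f f I] by measurable
  show "AE t in lebesgue_on I. sqrt (ip (f t) (f t)) = nrm (f t)"
    using f unfolding strongly_measurable_def
    by (auto elim!: eventually_mono simp: nrm_sq[symmetric] nrm_nonneg)
qed

lemma strongly_measurable_mono:
  assumes f: "strongly_measurable I V nrm f" and J: "J \<subseteq> I" "J \<in> sets lebesgue" "I \<in> sets lebesgue"
  shows "strongly_measurable J V nrm f"
proof -
  from f obtain F where F: "AE t in lebesgue_on I. f t \<in> V" "\<And>n. simple_function (lebesgue_on I) (F n)"
    "\<And>n. F n ` I \<subseteq> V" "AE t in lebesgue_on I. (\<lambda>n. nrm (\<lambda>x. F n t x - f t x)) \<longlonglongrightarrow> 0"
    unfolding strongly_measurable_def by blast
  have ae: "AE t in lebesgue_on J. P t" if "AE t in lebesgue_on I. P t" for P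
    using that J by (auto simp: AE_restrict_space_iff elim!: eventually_mono)
  have "simple_function (lebesgue_on J) (F n)" for n
  proof -
    have "F n -` {y} \<inter> J \<in> sets (lebesgue_on J)" for y
    \<comment> \<open>Simplicity on \<open>I\<close> makes the level sets of attained values
      measurable; any other value has an empty level set.\<close>
    proof (cases "F n -` {y} \<inter> I \<in> sets lebesgue")
      case True
      then have "F n -` {y} \<inter> I \<inter> J \<in> sets lebesgue" using J by blast
      then show ?thesis using J by (simp add: sets_restrict_space_iff Int_assoc inf_absorb2)
    next
      case False
      then have "y \<notin> F n ` I" using F(2)[of n] J(3) unfolding simple_function_def
        by (auto simp: sets_restrict_space_iff)
      then have "F n -` {y} \<inter> J = {}" using J by auto
      then show ?thesis by simp
    qed
    moreover have "finite (F n ` J)"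
      using F(2)[of n] J by (auto simp: simple_function_def intro: finite_subset[OF image_mono])
    ultimately show ?thesis unfolding simple_function_def by simp
  qed
  moreover have "F n ` J \<subseteq> V" for n using F(3)[of n] J(1) by (meson image_mono subset_trans)
  ultimately show ?thesis unfolding strongly_measurable_def
    using ae[OF F(1)] ae[OF F(4)] by blast
qed

text \<open>Square integrability on the line gives integrability on bounded intervals through y
  \<le> 1 + y^2; pairings follow by Cauchy-Schwarz.\<close>

lemma locally_integrable:
  fixes f :: "real \<Rightarrow> 'b \<Rightarrow> real"
  assumes f: "\<And>t. f t \<in> V" "strongly_measurable UNIV V nrm f" "integrable lebesgue (\<lambda>t. (nrm (f t))\<^sup>2)"
  shows "(\<lambda>t. nrm (f t)) absolutely_integrable_on {a..b}"
    and "z \<in> V \<Longrightarrow> (\<lambda>t. ip (f t) z) absolutely_integrable_on {a..b}"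
proof -
  have m: "strongly_measurable {a..b} V nrm f" by (rule strongly_measurable_mono[OF f(2)]) auto
  show n: "(\<lambda>t. nrm (f t)) absolutely_integrable_on {a..b}"
  proof (rule measurable_bounded_by_integrable_imp_absolutely_integrable[where g="\<lambda>r. 1 + (nrm (f r))\<^sup>2"])
    show "(\<lambda>r. nrm (f r)) \<in> borel_measurable (lebesgue_on {a..b})"
      by (rule nrm_measurable[OF m]) simp
    show "(\<lambda>r. 1 + (nrm (f r))\<^sup>2) integrable_on {a..b}"
      using integrable_lebesgue_imp_integrable_on(2)[OF f(3)]
      by (intro Henstock_Kurzweil_Integration.integrable_add) auto
    have "y \<le> 1 + y\<^sup>2" if "0 \<le> y" for y :: real
      using zero_le_power2[of "y - 1"] that by (simp add: power2_eq_square algebra_simps)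
    then show "norm (nrm (f r)) \<le> 1 + (nrm (f r))\<^sup>2" for r using nrm_nonneg[OF f(1)] by simp
  qed simp
  show "(\<lambda>t. ip (f t) z) absolutely_integrable_on {a..b}" if z: "z \<in> V"
  proof (rule measurable_bounded_by_integrable_imp_absolutely_integrable[where g="\<lambda>r. nrm (f r) * nrm z"])
    show "(\<lambda>r. ip (f r) z) \<in> borel_measurable (lebesgue_on {a..b})"
      by (rule ip_measurable[OF m strongly_measurable_const[OF z]]) simp
    show "(\<lambda>r. nrm (f r) * nrm z) integrable_on {a..b}"
      using set_lebesgue_integral_eq_integral(1)[OF n] by (rule integrable_on_mult_left)
  qed (use Cauchy_Schwarz[OF f(1) z] in auto)
qed

text \<open>The source of \<open>R_bound\<close> in \<open>subgradient_flow\<close>: with z taken at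
  the base time, its norm is the slope and the norm of \<open>f\<close> is the speed.\<close>

lemma increment_bound:
  fixes f :: "real \<Rightarrow> 'b \<Rightarrow> real"
  assumes f: "\<And>t. f t \<in> V" "strongly_measurable UNIV V nrm f" "integrable lebesgue (\<lambda>t. (nrm (f t))\<^sup>2)"
    and z: "z \<in> V" and t: "t \<in> {a..b}" "\<tau> \<in> {a..b}"
  shows "\<bar>integral {a..\<tau>} (\<lambda>r. ip (f r) z) - integral {a..t} (\<lambda>r. ip (f r) z)\<bar>
    \<le> nrm z * integral {min t \<tau>..max t \<tau>} (\<lambda>r. nrm (f r))"
proof -
  have n: "(\<lambda>r. nrm (f r)) integrable_on {c..d}" for c d
    using locally_integrable(1)[OF f] by (rule set_lebesgue_integral_eq_integral)
  have "\<bar>integral {a..\<tau>} (\<lambda>r. ip (f r) z) - integral {a..t} (\<lambda>r. ip (f r) z)\<bar>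
    \<le> integral {min t \<tau>..max t \<tau>} (\<lambda>r. nrm z * nrm (f r))"
  proof (rule abs_integral_diff_le[OF _ _ _ t])
    show "(\<lambda>r. ip (f r) z) integrable_on {a..b}"
      using locally_integrable(2)[OF f z] by (rule set_lebesgue_integral_eq_integral)
    show "(\<lambda>r. nrm z * nrm (f r)) integrable_on {a..b}" by (rule integrable_on_mult_right[OF n])
    show "\<bar>ip (f r) z\<bar> \<le> nrm z * nrm (f r)" for r
      using Cauchy_Schwarz[OF f(1) z] by (simp add: mult.commute)
  qed
  then show ?thesis by simp
qed

text \<open>Only countably many values of approximating simple functions have to be tested, and the error is
  controlled by the Lebesgue points of the norm of \<open>w\<close>.\<close>

lemma lebesgue_point:
  fixes a b :: real
  assumes w: "\<And>r. w r \<in> V" "strongly_measurable UNIV V nrm w" "integrable lebesgue (\<lambda>r. (nrm (w r))\<^sup>2)"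
    and \<xi>: "strongly_measurable UNIV V nrm \<xi>"
  shows "\<exists>N. negligible N \<and> (\<forall>t\<in>{a<..<b} - N.
    ((\<lambda>\<tau>. integral {a..\<tau>} (\<lambda>r. ip (w r) (\<xi> t))) has_real_derivative ip (w t) (\<xi> t)) (at t))"
proof -
  have n_int: "(\<lambda>r. nrm (w r)) integrable_on {a..b}"
    using locally_integrable(1)[OF w] by (rule set_lebesgue_integral_eq_integral)
  have ip_int: "(\<lambda>r. ip (w r) z) integrable_on {c..d}" if "z \<in> V" for z c d
    using locally_integrable(2)[OF w that] by (rule set_lebesgue_integral_eq_integral)
  from \<xi> obtain F where F: "AE t in lebesgue. \<xi> t \<in> V" "\<And>n. simple_function lebesgue (F n)"
    "\<And>n. F n ` UNIV \<subseteq> V" "AE t in lebesgue. (\<lambda>n. nrm (\<lambda>x. F n t x - \<xi> t x)) \<longlonglongrightarrow> 0"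
    unfolding strongly_measurable_def lebesgue_on_UNIV_eq by blast
  have "AE t in lebesgue_on UNIV. \<xi> t \<in> V \<and> (\<lambda>n. nrm (\<lambda>x. F n t x - \<xi> t x)) \<longlonglongrightarrow> 0"
    unfolding lebesgue_on_UNIV_eq using F(1,4) by eventually_elim auto
  then have "\<exists>N. negligible N \<and> (\<forall>t\<in>UNIV - N. \<xi> t \<in> V \<and> (\<lambda>n. nrm (\<lambda>x. F n t x - \<xi> t x)) \<longlonglongrightarrow> 0)"
    by (subst (asm) AE_lebesgue_on_iff_negligible) simp_all
  then obtain N0 where N0: "negligible N0"
    "\<And>t. t \<notin> N0 \<Longrightarrow> \<xi> t \<in> V \<and> (\<lambda>n. nrm (\<lambda>x. F n t x - \<xi> t x)) \<longlonglongrightarrow> 0"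
    by blast
  \<comment> \<open>For a fixed z the differentiation theorem has an exceptional set depending on z,
    while here the tested element varies with t. Over the countable set \<open>Z\<close> the
    exceptional sets can be united.\<close>
  define Z where "Z = (\<Union>n. range (F n))"
  have Z: "countable Z" "Z \<subseteq> V"
  proof -
    have fin: "finite (range (F n))" for n using F(2)[of n] by (simp add: simple_function_def)
    show "countable Z" unfolding Z_def by (rule countable_UN[OF countableI_type countable_finite[OF fin]])
    show "Z \<subseteq> V" unfolding Z_def by (rule UN_least) (rule F(3))
  qed
  have "\<forall>z\<in>Z. \<exists>N. negligible N \<and> (\<forall>t\<in>{a<..<b} - N.
      ((\<lambda>\<tau>. integral {a..\<tau>} (\<lambda>r. ip (w r) z)) has_real_derivative ip (w t) z) (at t))"
    using lebesgue_differentiation[OF ip_int] Z by (metis subsetD)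
  then obtain N1 where N1: "\<And>z. z \<in> Z \<Longrightarrow> negligible (N1 z)"
    "\<And>z t. z \<in> Z \<Longrightarrow> t \<in> {a<..<b} - N1 z \<Longrightarrow>
      ((\<lambda>\<tau>. integral {a..\<tau>} (\<lambda>r. ip (w r) z)) has_real_derivative ip (w t) z) (at t)" by metis
  obtain N2 where N2: "negligible N2" "\<And>t. t \<in> {a<..<b} - N2 \<Longrightarrow>
      ((\<lambda>\<tau>. integral {a..\<tau>} (\<lambda>r. nrm (w r))) has_real_derivative nrm (w t)) (at t)"
    using lebesgue_differentiation[OF n_int] by metis
  show ?thesis
  proof (intro exI conjI ballI)
    show "negligible (N0 \<union> (\<Union>z\<in>Z. N1 z) \<union> N2)"
      using N0(1) N1(1) N2(1) Z(1)
      by (intro negligible_Un) (auto simp: negligible_iff_null_sets intro!: null_sets_UN')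
    fix t assume t: "t \<in> {a<..<b} - (N0 \<union> (\<Union>z\<in>Z. N1 z) \<union> N2)"
    then have \<xi>t: "\<xi> t \<in> V" "(\<lambda>n. nrm (\<lambda>x. F n t x - \<xi> t x)) \<longlonglongrightarrow> 0" using N0(2)[of t] by auto
    let ?A = "\<lambda>z h. (integral {a..t + h} (\<lambda>r. ip (w r) z) - integral {a..t} (\<lambda>r. ip (w r) z)) / h"
    let ?C = "\<lambda>h. (integral {a..t + h} (\<lambda>r. nrm (w r)) - integral {a..t} (\<lambda>r. nrm (w r))) / h"
    have bound: "\<bar>?A (\<xi> t) h - ?A z h\<bar> \<le> nrm (\<lambda>x. z x - \<xi> t x) * \<bar>?C h\<bar>"
      if z: "z \<in> V" and h: "t + h \<in> {a..b}" for z h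
    proof -
      let ?d = "\<lambda>x. z x - \<xi> t x"
      have dV: "?d \<in> V" and tI: "t \<in> {a..b}" using z \<xi>t t diff by auto
      have int_d: "integral {a..y} (\<lambda>r. ip (w r) ?d) = integral {a..y} (\<lambda>r. ip (w r) z) - integral {a..y} (\<lambda>r. ip (w r) (\<xi> t))" for y
        unfolding ip_diff_right[OF z \<xi>t(1) w(1)]
        by (rule Henstock_Kurzweil_Integration.integral_diff[OF ip_int[OF z] ip_int[OF \<xi>t(1)]])
      have "\<bar>?A (\<xi> t) h - ?A z h\<bar> = \<bar>integral {a..t + h} (\<lambda>r. ip (w r) ?d) - integral {a..t} (\<lambda>r. ip (w r) ?d)\<bar> / \<bar>h\<bar>"
      proof -
        have "(p - q) / h - (p' - q') / h = - (((p' - p) - (q' - q)) / h)" for p q p' q' :: real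
          by (simp add: diff_divide_distrib)
        then show ?thesis unfolding int_d by (simp only: abs_minus_cancel abs_divide)
      qed
      also have "\<dots> \<le> (nrm ?d * \<bar>integral {a..t + h} (\<lambda>r. nrm (w r)) - integral {a..t} (\<lambda>r. nrm (w r))\<bar>) / \<bar>h\<bar>"
        using increment_bound[OF w dV tI h] integral_min_max_eq_abs[OF n_int nrm_nonneg[OF w(1)] tI h]
        by (intro divide_right_mono) auto
      finally show ?thesis by (simp add: abs_divide)
    qed
    show "((\<lambda>\<tau>. integral {a..\<tau>} (\<lambda>r. ip (w r) (\<xi> t))) has_real_derivative ip (w t) (\<xi> t)) (at t)"
      unfolding DERIV_def
    proof (rule tendstoI)
      fix e :: real assume e: "e > 0"
      \<comment> \<open>Replacing \<open>\<xi> t\<close> by z costs \<delta> times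
        \<open>nrm (w t) + 1\<close> in the difference quotient and \<delta> times
        \<open>nrm (w t)\<close> in the limit; c adds the two.\<close>
      define c where "c = 2 * nrm (w t) + 1"
      have c: "c > 0" using nrm_nonneg[OF w(1)[of t]] by (simp add: c_def)
      have "\<forall>\<^sub>F n in sequentially. nrm (\<lambda>x. F n t x - \<xi> t x) < e / (2 * c)"
        using \<xi>t(2) e c by (intro order_tendstoD) auto
      then obtain n where n: "nrm (\<lambda>x. F n t x - \<xi> t x) < e / (2 * c)"
        using eventually_happens'[OF sequentially_bot] by blast
      define z where "z = F n t"
      define \<delta> where "\<delta> = nrm (\<lambda>x. z x - \<xi> t x)"
      have "F n t \<in> range (F n)" using t by (intro imageI) auto
      then have zZ: "z \<in> Z" unfolding z_def Z_def by blast
      note zZ = zZ subsetD[OF Z(2) zZ]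
      have dV: "(\<lambda>x. z x - \<xi> t x) \<in> V" using zZ \<xi>t diff by auto
      have \<delta>: "0 \<le> \<delta>" "\<delta> * c < e / 2"
        using n c nrm_nonneg[OF dV] by (auto simp: \<delta>_def z_def field_simps)
      have "?A z \<midarrow>0\<rightarrow> ip (w t) z"
        using N1(2)[OF zZ(1), of t] t zZ unfolding DERIV_def by auto
      then have 1: "\<forall>\<^sub>F h in at 0. \<bar>?A z h - ip (w t) z\<bar> < e / 2"
        using e by (auto dest!: tendstoD[where e="e / 2"] simp: dist_real_def)
      have "?C \<midarrow>0\<rightarrow> nrm (w t)" using N2(2)[of t] t unfolding DERIV_def by auto
      then have 2: "\<forall>\<^sub>F h in at 0. \<bar>?C h - nrm (w t)\<bar> < 1"
        by (auto dest!: tendstoD[where e=1] simp: dist_real_def)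
      have "((\<lambda>h. t + h) \<longlongrightarrow> t + 0) (at 0)" by (intro tendsto_intros)
      then have 3: "\<forall>\<^sub>F h in at 0. t + h \<in> {a<..<b}"
        using t by (intro topological_tendstoD) auto
      show "\<forall>\<^sub>F h in at 0. dist (?A (\<xi> t) h) (ip (w t) (\<xi> t)) < e"
        using 1 2 3
      proof eventually_elim
        case (elim h)
        have "\<bar>?C h\<bar> \<le> nrm (w t) + 1" using elim(2) nrm_nonneg[OF w(1)[of t]] by linarith
        then have "\<delta> * \<bar>?C h\<bar> \<le> \<delta> * (nrm (w t) + 1)" using \<delta> by (intro mult_left_mono)
        moreover have "\<bar>?A (\<xi> t) h - ?A z h\<bar> \<le> \<delta> * \<bar>?C h\<bar>"
          unfolding \<delta>_def using elim(3) zZ by (intro bound) auto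
        moreover have "\<bar>ip (w t) z - ip (w t) (\<xi> t)\<bar> \<le> \<delta> * nrm (w t)"
          using Cauchy_Schwarz[OF w(1)[of t] dV] ip_diff_right[OF zZ(2) \<xi>t(1) w(1)[of t]]
          by (simp add: \<delta>_def mult.commute)
        moreover have "\<delta> * (nrm (w t) + 1) + \<delta> * nrm (w t) = \<delta> * c"
          by (simp add: c_def algebra_simps)
        ultimately show ?case using elim(1) \<delta>(2) unfolding dist_real_def by linarith
      qed
    qed
  qed
qed

end

section \<open>Fractional Sobolev spaces\<close>

lemma square_integrable_mult:
  fixes f h :: "'b \<Rightarrow> real"
  assumes [measurable]: "f \<in> borel_measurable M" "h \<in> borel_measurable M"
    and "integrable M (\<lambda>x. (f x)\<^sup>2)" "integrable M (\<lambda>x. (h x)\<^sup>2)"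
  shows "integrable M (\<lambda>x. f x * h x)"
proof (rule Bochner_Integration.integrable_bound)
  show "integrable M (\<lambda>x. (f x)\<^sup>2 + (h x)\<^sup>2)" using assms by simp
  show "AE x in M. norm (f x * h x) \<le> norm ((f x)\<^sup>2 + (h x)\<^sup>2)"
  proof (rule AE_I2)
    fix x
    have "2 * (f x * h x) \<le> (f x)\<^sup>2 + (h x)\<^sup>2" "- (2 * (f x * h x)) \<le> (f x)\<^sup>2 + (h x)\<^sup>2"
      using zero_le_power2[of "f x - h x"] zero_le_power2[of "f x + h x"]
      by (simp_all add: power2_eq_square algebra_simps)
    then have "2 * \<bar>f x * h x\<bar> \<le> (f x)\<^sup>2 + (h x)\<^sup>2" by linarith
    then show "norm (f x * h x) \<le> norm ((f x)\<^sup>2 + (h x)\<^sup>2)" by simp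
  qed
qed simp

lemma square_integrable_lin:
  fixes f h :: "'b \<Rightarrow> real"
  assumes [measurable]: "f \<in> borel_measurable M" "h \<in> borel_measurable M"
    and "integrable M (\<lambda>x. (f x)\<^sup>2)" "integrable M (\<lambda>x. (h x)\<^sup>2)"
  shows "integrable M (\<lambda>x. (c * f x + d * h x)\<^sup>2)"
proof -
  have "(c * f x + d * h x)\<^sup>2 = c\<^sup>2 * (f x)\<^sup>2 + 2 * c * d * (f x * h x) + d\<^sup>2 * (h x)\<^sup>2" for x
    by (simp add: power2_eq_square algebra_simps)
  then show ?thesis using assms square_integrable_mult[OF assms] by simp
qed

lemma L2_spaceD:
  assumes "v \<in> L2_space \<Omega>"
  shows "v \<in> borel_measurable borel" "integrable lborel (\<lambda>x. (v x)\<^sup>2)" "AE x in lborel. x \<notin> \<Omega> \<longrightarrow> v x = 0"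
  using assms by (auto simp: L2_space_def)

lemma L2_inner_eq:
  assumes "u \<in> L2_space \<Omega>" "v \<in> L2_space \<Omega>" and \<Omega>: "\<Omega> \<in> sets borel"
  shows "L2_inner \<Omega> u v = (LINT x|lborel. u x * v x)" "integrable lborel (\<lambda>x. u x * v x)"
proof -
  note [measurable] = L2_spaceD(1)[OF assms(1)] L2_spaceD(1)[OF assms(2)] \<Omega>
  show "integrable lborel (\<lambda>x. u x * v x)"
    using L2_spaceD[OF assms(1)] L2_spaceD[OF assms(2)] by (intro square_integrable_mult) auto
  show "L2_inner \<Omega> u v = (LINT x|lborel. u x * v x)"
    unfolding L2_inner_def set_lebesgue_integral_def
    by (rule integral_cong_AE) (use L2_spaceD(3)[OF assms(1)] in \<open>auto elim!: eventually_mono simp: indicator_def\<close>)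
qed

lemma semi_inner_space_L2:
  assumes \<Omega>: "\<Omega> \<in> sets borel"
  shows "semi_inner_space (L2_space \<Omega>) (L2_inner \<Omega>) (L2_norm \<Omega>)"
proof
  show "(\<lambda>_. 0) \<in> L2_space \<Omega>" by (simp add: L2_space_def)
  show lin: "(\<lambda>x. c * u x + d * v x) \<in> L2_space \<Omega>" if "u \<in> L2_space \<Omega>" "v \<in> L2_space \<Omega>" for u v c d
  proof -
    note [measurable] = L2_spaceD(1)[OF that(1)] L2_spaceD(1)[OF that(2)]
    have "integrable lborel (\<lambda>x. (c * u x + d * v x)\<^sup>2)"
      by (rule square_integrable_lin) (use L2_spaceD[OF that(1)] L2_spaceD[OF that(2)] in auto)
    moreover have "AE x in lborel. x \<notin> \<Omega> \<longrightarrow> c * u x + d * v x = 0"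
      using L2_spaceD(3)[OF that(1)] L2_spaceD(3)[OF that(2)] by eventually_elim auto
    ultimately show ?thesis unfolding L2_space_def by simp
  qed
  show "L2_inner \<Omega> (\<lambda>x. c * u x + d * v x) z = c * L2_inner \<Omega> u z + d * L2_inner \<Omega> v z"
    if V: "u \<in> L2_space \<Omega>" "v \<in> L2_space \<Omega>" "z \<in> L2_space \<Omega>" for u v z c d
  proof -
    have "L2_inner \<Omega> (\<lambda>x. c * u x + d * v x) z = (LINT x|lborel. c * (u x * z x) + d * (v x * z x))"
      using V lin[OF V(1,2), of c d] by (simp add: L2_inner_eq \<Omega> algebra_simps)
    also have "\<dots> = c * (LINT x|lborel. u x * z x) + d * (LINT x|lborel. v x * z x)"
      using L2_inner_eq(2)[OF V(1,3) \<Omega>] L2_inner_eq(2)[OF V(2,3) \<Omega>] by simp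
    finally show ?thesis using V by (simp add: L2_inner_eq \<Omega>)
  qed
  show "L2_inner \<Omega> u v = L2_inner \<Omega> v u" for u v
    by (simp add: L2_inner_def mult.commute)
  have nn: "0 \<le> L2_inner \<Omega> u u" for u
    unfolding L2_inner_def set_lebesgue_integral_def by (intro integral_nonneg_AE AE_I2) auto
  then show "0 \<le> L2_norm \<Omega> u" "(L2_norm \<Omega> u)\<^sup>2 = L2_inner \<Omega> u u" for u
    by (simp_all add: L2_norm_def)
qed

lemma frac_kernel_nonneg: "0 \<le> frac_kernel a x y"
  by (simp add: frac_kernel_def)

lemma frac_kernel_measurable [measurable]:
  "(\<lambda>(x, y). frac_kernel a x y) \<in> borel_measurable (lborel \<Otimes>\<^sub>M lborel)"
  unfolding frac_kernel_def split_beta' by measurable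

text \<open>The square root of the kernel is attached to each difference, so the fractional form
  becomes an L2 product on the product space and bilinearity and integrability are inherited from
  there.\<close>

definition frac_diff :: "real \<Rightarrow> ('a::euclidean_space \<Rightarrow> real) \<Rightarrow> 'a \<times> 'a \<Rightarrow> real" where
  "frac_diff a u = (\<lambda>(x, y). (u x - u y) * sqrt (frac_kernel a x y))"

lemma frac_diff_measurable [measurable]:
  fixes u :: "'a::euclidean_space \<Rightarrow> real"
  assumes [measurable]: "u \<in> borel_measurable borel"
  shows "frac_diff a u \<in> borel_measurable (lborel \<Otimes>\<^sub>M lborel)"
proof -
  have "(\<lambda>p. (u (fst p) - u (snd p)) * sqrt ((\<lambda>(x, y). frac_kernel a x y) p)) \<in> borel_measurable (lborel \<Otimes>\<^sub>M lborel)"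
    by measurable
  then show ?thesis by (simp add: frac_diff_def split_beta')
qed

lemma frac_diff_mult:
  "(\<lambda>(x, y). (u x - u y) * (v x - v y) * frac_kernel a x y) = (\<lambda>p. frac_diff a u p * frac_diff a v p)"
proof -
  have "sqrt (frac_kernel a x y) * sqrt (frac_kernel a x y) = frac_kernel a x y" for x y :: 'a
    by (simp add: frac_kernel_nonneg)
  then show ?thesis by (simp add: fun_eq_iff frac_diff_def algebra_simps)
qed

lemma frac_diff_square: "(\<lambda>(x, y). (u x - u y)\<^sup>2 * frac_kernel a x y) = (\<lambda>p. (frac_diff a u p)\<^sup>2)"
  using frac_diff_mult[of u u a] by (simp add: power2_eq_square)

lemma frac_diff_lin: "frac_diff a (\<lambda>x. c * u x + d * v x) p = c * frac_diff a u p + d * frac_diff a v p"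
  by (simp add: frac_diff_def split_beta' algebra_simps)

lemma H_frac_iff: "v \<in> H_frac a \<longleftrightarrow> v \<in> borel_measurable borel \<and> integrable lborel (\<lambda>x. (v x)\<^sup>2) \<and>
    integrable (lborel \<Otimes>\<^sub>M lborel) (\<lambda>p. (frac_diff a v p)\<^sup>2)"
  by (simp add: H_frac_def frac_diff_square)

lemma X0D:
  assumes "v \<in> X0 \<Omega> a"
  shows "v \<in> borel_measurable borel" "integrable lborel (\<lambda>x. (v x)\<^sup>2)"
    "integrable (lborel \<Otimes>\<^sub>M lborel) (\<lambda>p. (frac_diff a v p)\<^sup>2)" "AE x in lborel. x \<notin> \<Omega> \<longrightarrow> v x = 0"
  using assms by (auto simp: X0_def H_frac_iff)

lemma X0_subset_L2_space: "X0 \<Omega> a \<subseteq> L2_space \<Omega>"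
  by (auto simp: X0_def H_frac_def L2_space_def)

lemma frac_const_pos: "0 < a \<Longrightarrow> a < 1 \<Longrightarrow> 0 < frac_const N a"
  unfolding frac_const_def by (intro divide_pos_pos mult_pos_pos Gamma_real_pos) auto

lemma frac_lap_eq: "frac_lap a u v = frac_const DIM('a) a / 2 *
    (\<integral>p. frac_diff a u p * frac_diff a v p \<partial>(lborel \<Otimes>\<^sub>M lborel))"
  for u v :: "'a::euclidean_space \<Rightarrow> real"
  by (simp add: frac_lap_def frac_diff_mult)

lemma X0_norm_sq:
  fixes v :: "'a::euclidean_space \<Rightarrow> real"
  assumes "0 < a" "a < 1"
  shows "(X0_norm a v)\<^sup>2 = frac_const DIM('a) a / 2 * (\<integral>p. (frac_diff a v p)\<^sup>2 \<partial>(lborel \<Otimes>\<^sub>M lborel))"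
  unfolding X0_norm_def frac_diff_square
  using frac_const_pos[OF assms, of "DIM('a)"]
  by (intro real_sqrt_pow2 mult_nonneg_nonneg integral_nonneg_AE AE_I2) auto

lemma semi_inner_space_X0:
  fixes \<Omega> :: "'a::euclidean_space set"
  assumes a: "0 < a" "a < 1"
  shows "semi_inner_space (X0 \<Omega> a) (frac_lap a) (X0_norm a)"
proof
  show "(\<lambda>_. 0) \<in> X0 \<Omega> a" by (simp add: X0_def H_frac_iff frac_diff_def)
  show lin: "(\<lambda>x. c * u x + d * v x) \<in> X0 \<Omega> a" if "u \<in> X0 \<Omega> a" "v \<in> X0 \<Omega> a" for u v c d
  proof -
    note [measurable] = X0D(1)[OF that(1)] X0D(1)[OF that(2)]
    have "integrable lborel (\<lambda>x. (c * u x + d * v x)\<^sup>2)"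
      by (rule square_integrable_lin) (use X0D[OF that(1)] X0D[OF that(2)] in auto)
    moreover have "integrable (lborel \<Otimes>\<^sub>M lborel) (\<lambda>p. (c * frac_diff a u p + d * frac_diff a v p)\<^sup>2)"
      by (rule square_integrable_lin) (use X0D[OF that(1)] X0D[OF that(2)] in auto)
    moreover have "AE x in lborel. x \<notin> \<Omega> \<longrightarrow> c * u x + d * v x = 0"
      using X0D(4)[OF that(1)] X0D(4)[OF that(2)] by eventually_elim auto
    ultimately show ?thesis unfolding X0_def H_frac_iff by (simp add: frac_diff_lin)
  qed
  show "frac_lap a (\<lambda>x. c * u x + d * v x) z = c * frac_lap a u z + d * frac_lap a v z"
    if V: "u \<in> X0 \<Omega> a" "v \<in> X0 \<Omega> a" "z \<in> X0 \<Omega> a" for u v z c d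
  proof -
    note [measurable] = X0D(1)[OF V(1)] X0D(1)[OF V(2)] X0D(1)[OF V(3)]
    have "integrable (lborel \<Otimes>\<^sub>M lborel) (\<lambda>p. frac_diff a u p * frac_diff a z p)"
      "integrable (lborel \<Otimes>\<^sub>M lborel) (\<lambda>p. frac_diff a v p * frac_diff a z p)"
      using X0D[OF V(1)] X0D[OF V(2)] X0D[OF V(3)] by (auto intro!: square_integrable_mult)
    moreover have "(\<lambda>p. frac_diff a (\<lambda>x. c * u x + d * v x) p * frac_diff a z p) =
        (\<lambda>p. c * (frac_diff a u p * frac_diff a z p) + d * (frac_diff a v p * frac_diff a z p))"
      by (simp add: fun_eq_iff frac_diff_lin algebra_simps)
    ultimately show ?thesis unfolding frac_lap_eq by (simp add: algebra_simps)
  qed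
  show "frac_lap a u v = frac_lap a v u" for u v :: "'a \<Rightarrow> real"
    by (simp add: frac_lap_eq mult.commute)
  show "0 \<le> X0_norm a u" for u :: "'a \<Rightarrow> real"
    unfolding X0_norm_def frac_diff_square using frac_const_pos[OF a, of "DIM('a)"]
    by (intro real_sqrt_ge_zero mult_nonneg_nonneg integral_nonneg_AE AE_I2) auto
  show "(X0_norm a u)\<^sup>2 = frac_lap a u u" for u :: "'a \<Rightarrow> real"
    unfolding X0_norm_sq[OF a] frac_lap_eq by (simp add: power2_eq_square)
qed

text \<open>The kernel is bounded below on \<open>\<Omega> \<times> B\<close> for a ball \<open>B\<close> outside of \<open>\<Omega>\<close>, where \<open>v\<close> vanishes.\<close>

lemma fractional_Poincare:
  fixes \<Omega> :: "'a::euclidean_space set"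
  assumes a: "0 < a" "a < 1" and \<Omega>: "bounded \<Omega>" "\<Omega> \<in> sets borel"
  obtains C where "0 < C" "\<And>v. v \<in> X0 \<Omega> a \<Longrightarrow> L2_norm \<Omega> v \<le> C * X0_norm a v"
proof -
  obtain M where M: "M > 0" "\<And>x. x \<in> \<Omega> \<Longrightarrow> norm x \<le> M"
    using \<Omega>(1) bounded_pos by blast
  obtain e :: 'a where e: "e \<in> Basis" using nonempty_Basis by blast
  \<comment> \<open>A unit ball around a point of norm M + 2: its points have norm greater than M,
    hence lie outside \<Omega>, and less than M + 3. So \<open>L\<close> = M + (M + 3) bounds the
    distances to points of \<Omega>, and \<open>k\<close> is the kernel value at distance
    \<open>L\<close>.\<close>
  define B where "B = ball ((M + 2) *\<^sub>R e) 1"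
  define L where "L = 2 * M + 3"
  define k where "k = 1 / L powr (real DIM('a) + 2 * a)"
  have norm_B: "M < norm y \<and> norm y < M + 3" if "y \<in> B" for y
  proof -
    have "norm ((M + 2) *\<^sub>R e - y) < 1" using that by (simp add: B_def dist_norm)
    moreover have "norm ((M + 2) *\<^sub>R e) = M + 2" using e M by simp
    ultimately show ?thesis
      using norm_triangle_ineq2[of "(M + 2) *\<^sub>R e" y] norm_triangle_ineq2[of y "(M + 2) *\<^sub>R e"]
      by (auto simp: norm_minus_commute)
  qed
  have k: "k > 0" using M by (simp add: k_def L_def)
  have kernel: "k \<le> frac_kernel a x y" if "x \<in> \<Omega>" "y \<in> B" for x y
  proof -
    have "x \<noteq> y" using norm_B[OF that(2)] M(2)[OF that(1)] by auto
    moreover have "norm (x - y) \<le> L"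
      using norm_triangle_ineq4[of x y] norm_B[OF that(2)] M(2)[OF that(1)] by (simp add: L_def)
    ultimately show ?thesis
      unfolding k_def frac_kernel_def using a M
      by (intro divide_left_mono powr_mono2 mult_pos_pos) (auto simp: L_def)
  qed
  define c where "c = measure lborel B"
  have c: "c > 0" "emeasure lborel B = ennreal c"
  proof -
    show "c > 0" unfolding c_def B_def by (rule content_ball_pos) simp
    show "emeasure lborel B = ennreal c"
      unfolding c_def B_def using emeasure_lborel_ball_finite[of "(M + 2) *\<^sub>R e" 1]
      by (intro emeasure_eq_ennreal_measure) auto
  qed
  define C where "C = sqrt (2 / (frac_const DIM('a) a * k * c))"
  have fc: "frac_const DIM('a) a > 0" by (rule frac_const_pos[OF a])
  have main: "L2_norm \<Omega> v \<le> C * X0_norm a v" if v: "v \<in> X0 \<Omega> a" for v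
  proof -
    note [measurable] = X0D(1)[OF v] \<Omega>(2)
    have [measurable]: "B \<in> sets borel" by (simp add: B_def)
    define J where "J = (\<integral>p. (frac_diff a v p)\<^sup>2 \<partial>(lborel \<Otimes>\<^sub>M lborel))"
    have v0: "AE x in lborel. x \<notin> \<Omega> \<longrightarrow> v x = 0" by (rule X0D(4)[OF v])
    have inner: "ennreal (k * (v x)\<^sup>2) * ennreal c \<le> (\<integral>\<^sup>+y. ennreal ((frac_diff a v (x, y))\<^sup>2) \<partial>lborel)"
      if x: "x \<in> \<Omega>" for x
    proof -
      have "ennreal (k * (v x)\<^sup>2) * ennreal c = (\<integral>\<^sup>+y. ennreal (k * (v x)\<^sup>2) * indicator B y \<partial>lborel)"
        using c by (simp add: nn_integral_cmult_indicator)
      also have "\<dots> \<le> (\<integral>\<^sup>+y. ennreal ((frac_diff a v (x, y))\<^sup>2) \<partial>lborel)"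
      proof (rule nn_integral_mono_AE)
        show "AE y in lborel. ennreal (k * (v x)\<^sup>2) * indicator B y \<le> ennreal ((frac_diff a v (x, y))\<^sup>2)"
          using v0
        proof eventually_elim
          case (elim y)
          show ?case
          proof (cases "y \<in> B")
            case True
            then have "y \<notin> \<Omega>" using norm_B[of y] M(2)[of y] by auto
            then have "v y = 0" using elim by auto
            then have "(frac_diff a v (x, y))\<^sup>2 = (v x)\<^sup>2 * frac_kernel a x y"
              by (simp add: frac_diff_def power_mult_distrib frac_kernel_nonneg)
            moreover have "k * (v x)\<^sup>2 \<le> (v x)\<^sup>2 * frac_kernel a x y"
              using kernel[OF x True] by (simp add: mult.commute[of k] mult_left_mono)
            ultimately show ?thesis using True by (simp add: ennreal_leI)
          qed simp
        qed
      qed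
      finally show ?thesis .
    qed
    have int_v2: "(\<integral>\<^sup>+x. ennreal ((v x)\<^sup>2) * indicator \<Omega> x \<partial>lborel) = ennreal (L2_inner \<Omega> v v)"
    proof -
      have "(\<integral>\<^sup>+x. ennreal ((v x)\<^sup>2) * indicator \<Omega> x \<partial>lborel) = (\<integral>\<^sup>+x. ennreal ((v x)\<^sup>2) \<partial>lborel)"
        using v0 by (intro nn_integral_cong_AE) (auto elim!: eventually_mono simp: indicator_def)
      also have "\<dots> = ennreal (LINT x|lborel. (v x)\<^sup>2)"
        using X0D(2)[OF v] by (intro nn_integral_eq_integral) auto
      finally show ?thesis
        using L2_inner_eq(1)[OF subsetD[OF X0_subset_L2_space v] subsetD[OF X0_subset_L2_space v] \<Omega>(2)]
        by (simp add: power2_eq_square)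
    qed
    have "ennreal (k * c) * ennreal (L2_inner \<Omega> v v) = (\<integral>\<^sup>+x. ennreal (k * c) * (ennreal ((v x)\<^sup>2) * indicator \<Omega> x) \<partial>lborel)"
      by (subst nn_integral_cmult) (auto simp: int_v2)
    also have "\<dots> \<le> (\<integral>\<^sup>+x. (\<integral>\<^sup>+y. ennreal ((frac_diff a v (x, y))\<^sup>2) \<partial>lborel) \<partial>lborel)"
    proof (rule nn_integral_mono)
      fix x
      show "ennreal (k * c) * (ennreal ((v x)\<^sup>2) * indicator \<Omega> x) \<le> (\<integral>\<^sup>+y. ennreal ((frac_diff a v (x, y))\<^sup>2) \<partial>lborel)"
      proof (cases "x \<in> \<Omega>")
        case True
        have "ennreal (k * c) * (ennreal ((v x)\<^sup>2) * indicator \<Omega> x) = ennreal (k * (v x)\<^sup>2) * ennreal c"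
          using True k c by (simp add: ennreal_mult[symmetric] mult_ac)
        then show ?thesis using inner[OF True] by simp
      qed simp
    qed
    also have "\<dots> = (\<integral>\<^sup>+p. ennreal ((frac_diff a v p)\<^sup>2) \<partial>(lborel \<Otimes>\<^sub>M lborel))"
      by (rule lborel.nn_integral_fst) measurable
    also have "\<dots> = ennreal J"
      unfolding J_def using X0D(3)[OF v] by (intro nn_integral_eq_integral) auto
    finally have "ennreal (k * c * L2_inner \<Omega> v v) \<le> ennreal J"
      using k c by (simp add: ennreal_mult')
    moreover have "0 \<le> J" unfolding J_def by (intro integral_nonneg_AE AE_I2) auto
    ultimately have "k * c * L2_inner \<Omega> v v \<le> J" by simp
    then have "L2_inner \<Omega> v v \<le> J / (k * c)" using k c by (simp add: field_simps)
    also have "\<dots> = (2 / (frac_const DIM('a) a * k * c)) * (X0_norm a v)\<^sup>2"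
      using X0_norm_sq[OF a, of v] fc k c by (simp add: J_def field_simps)
    finally have "L2_norm \<Omega> v \<le> sqrt ((2 / (frac_const DIM('a) a * k * c)) * (X0_norm a v)\<^sup>2)"
      unfolding L2_norm_def by (rule real_sqrt_le_mono)
    also have "\<dots> = C * X0_norm a v"
      using semi_inner_space.nrm_nonneg[OF semi_inner_space_X0[OF a] v]
      unfolding C_def by (subst real_sqrt_mult) simp
    finally show ?thesis .
  qed
  have "C > 0" using fc k c by (simp add: C_def)
  then show ?thesis using that main by blast
qed

text \<open>Weak continuity is stated with functionals on \<open>X0 \<Omega> \<sigma>\<close>; this
  makes it applicable to L2 pairings. The dual bound uses only the seminorm \<open>X0_norm\<close>,
  which is why the Poincare inequality enters.\<close>

lemma L2_inner_in_X0_dual: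
  fixes \<Omega> :: "'a::euclidean_space set"
  assumes a: "0 < a" "a < 1" and \<Omega>: "bounded \<Omega>" "\<Omega> \<in> sets borel" and z: "z \<in> L2_space \<Omega>"
  shows "(\<lambda>v. L2_inner \<Omega> v z) \<in> X0_dual \<Omega> a"
proof -
  interpret L2: semi_inner_space "L2_space \<Omega>" "L2_inner \<Omega>" "L2_norm \<Omega>"
    by (rule semi_inner_space_L2[OF \<Omega>(2)])
  obtain C where C: "\<And>v. v \<in> X0 \<Omega> a \<Longrightarrow> L2_norm \<Omega> v \<le> C * X0_norm a v"
    using fractional_Poincare[OF a \<Omega>] by blast
  have sub: "v \<in> L2_space \<Omega>" if "v \<in> X0 \<Omega> a" for v using that X0_subset_L2_space by blast
  show ?thesis unfolding X0_dual_def
  proof (intro CollectI conjI ballI allI exI)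
    fix u v assume "u \<in> X0 \<Omega> a" "v \<in> X0 \<Omega> a"
    then show "L2_inner \<Omega> (\<lambda>x. u x + v x) z = L2_inner \<Omega> u z + L2_inner \<Omega> v z"
      using L2.ip_lin[of u v z 1 1] sub z by simp
  next
    fix c v assume "v \<in> X0 \<Omega> a"
    then show "L2_inner \<Omega> (\<lambda>x. c * v x) z = c * L2_inner \<Omega> v z"
      using L2.ip_lin[of v v z c 0] sub z by simp
  next
    fix v assume v: "v \<in> X0 \<Omega> a"
    have "\<bar>L2_inner \<Omega> v z\<bar> \<le> L2_norm \<Omega> v * L2_norm \<Omega> z" by (rule L2.Cauchy_Schwarz[OF sub[OF v] z])
    also have "\<dots> \<le> C * X0_norm a v * L2_norm \<Omega> z"
      using C[OF v] L2.nrm_nonneg[OF z] by (rule mult_right_mono)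
    finally show "\<bar>L2_inner \<Omega> v z\<bar> \<le> (C * L2_norm \<Omega> z) * X0_norm a v" by (simp add: mult_ac)
  qed
qed

section \<open>Density of \<open>X0 \<Omega> a\<close> in \<open>L2_space \<Omega>\<close>\<close>

lemma dyadic_shell:
  fixes r :: real
  assumes "0 < r"
  obtains k :: nat where "r < 1" "(1 / 2) ^ Suc k \<le> r" "r < (1 / 2) ^ k"
  | k :: nat where "2 ^ k \<le> r" "r < 2 ^ Suc k"
proof (cases "r < 1")
  case True
  obtain n :: nat where "(1 / 2) ^ n < r" using real_arch_pow_inv[OF assms, of "1 / 2"] by auto
  moreover have "(1 / 2 :: real) ^ Suc n \<le> (1 / 2) ^ n" by (rule power_decreasing) auto
  ultimately have ex: "(1 / 2) ^ Suc n \<le> r" by linarith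
  define k where "k = (LEAST n. (1 / 2) ^ Suc n \<le> r)"
  have k: "(1 / 2) ^ Suc k \<le> r" unfolding k_def using ex by (rule LeastI)
  have "r < (1 / 2) ^ k"
  proof (cases k)
    case (Suc j)
    then have "\<not> (1 / 2) ^ Suc j \<le> r" using not_less_Least[of j "\<lambda>n. (1 / 2) ^ Suc n \<le> r"] by (simp add: k_def)
    then show ?thesis using Suc by simp
  qed (use True in simp)
  then show ?thesis using that(1) True k by blast
next
  case False
  obtain n :: nat where "r < 2 ^ n" using real_arch_pow[of 2 r] by auto
  then have ex: "r < 2 ^ Suc n" using assms by (simp add: less_trans[where y="2 ^ n"])
  define k where "k = (LEAST n. r < 2 ^ Suc n)"
  have k: "r < 2 ^ Suc k" unfolding k_def using ex by (rule LeastI)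
  have "2 ^ k \<le> r"
  proof (cases k)
    case (Suc j)
    then have "\<not> r < 2 ^ Suc j" using not_less_Least[of j "\<lambda>n. r < 2 ^ Suc n"] by (simp add: k_def)
    then show ?thesis using Suc by simp
  qed (use False in simp)
  then show ?thesis using that(2) k by blast
qed

lemma suminf_ennreal_geometric_finite:
  assumes "0 \<le> c" "0 \<le> q" "q < 1"
  shows "(\<Sum>k. ennreal (c * q ^ k)) < \<infinity>"
proof -
  have "summable (\<lambda>k. c * q ^ k)" using assms by (intro summable_mult summable_geometric) auto
  then have "(\<Sum>k. ennreal (c * q ^ k)) = ennreal (\<Sum>k. c * q ^ k)"
    using assms by (intro suminf_ennreal2) auto
  then show ?thesis by simp
qed

text \<open>The kernel is integrated over the dyadic shells around \<open>x\<close>; near the diagonal the factor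
  \<open>|x - y|\<^sup>2\<close> compensates its singularity because \<open>a < 1\<close>.\<close>

lemma truncated_kernel_integral_finite:
  fixes L :: real
  assumes a: "0 < a" "a < 1"
  obtains J :: ennreal where "J < \<infinity>" "\<And>x :: 'a::euclidean_space.
    (\<integral>\<^sup>+y. ennreal (min 1 ((L * norm (x - y))\<^sup>2) * frac_kernel a x y) \<partial>lborel) \<le> J"
proof -
  define N where "N = DIM('a)"
  define p where "p = real N + 2 * a"
  define V where "V = measure lborel (ball (0::'a) 1)"
  have p: "p > 0" using a by (simp add: p_def add_nonneg_pos)
  have V: "0 \<le> V" by (simp add: V_def)
  have ball: "emeasure lborel (ball x r) = ennreal (r ^ N * V)" if "r \<ge> 0" for x :: 'a and r
  proof -
    have "emeasure lborel (ball x r) = ennreal (measure lborel (ball x r))"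
      using emeasure_lborel_ball_finite[of x r] by (intro emeasure_eq_ennreal_measure) auto
    then show ?thesis using content_ball_conv_unit_ball[OF that, of x] by (simp add: N_def V_def)
  qed
  \<comment> \<open>On an inner shell the numerator is bounded at the outer radius and the kernel at
    the inner radius; \<open>c2\<close> bounds the kernel at the inner radius of an outer shell.
    Multiplied by ball volumes these are geometric sequences.\<close>
  define c1 where "c1 k = (L * (1 / 2) ^ k)\<^sup>2 * (1 / ((1 / 2) ^ Suc k) powr p)" for k :: nat
  define c2 where "c2 k = 1 / (2 ^ k) powr p" for k :: nat
  define J where "J = (\<Sum>k. ennreal (c1 k) * ennreal (((1 / 2) ^ k) ^ N * V)) +
    (\<Sum>k. ennreal (c2 k) * ennreal ((2 ^ Suc k) ^ N * V))"
  have h1: "(1 / 2) ^ m = 2 powr (- real m)" and h2: "2 ^ m = (2::real) powr real m" for m :: nat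
  proof -
    show two: "2 ^ m = (2::real) powr real m" by (rule powr_realpow[symmetric]) simp
    show "(1 / 2) ^ m = 2 powr (- real m)"
      unfolding powr_minus two[symmetric] by (simp add: power_one_over inverse_eq_divide)
  qed
  have t1: "ennreal (c1 k) * ennreal (((1 / 2) ^ k) ^ N * V) = ennreal (L\<^sup>2 * 2 powr p * V * (2 powr (2 * a - 2)) ^ k)" for k
  proof -
    have "((1 / 2) ^ k)\<^sup>2 = 2 powr (- 2 * real k)"
      unfolding h1 power2_eq_square powr_add[symmetric] by simp
    moreover have "1 / ((1 / 2) ^ Suc k) powr p = 2 powr ((real k + 1) * p)"
      unfolding h1 powr_powr powr_minus_divide[symmetric] by (simp add: algebra_simps)
    moreover have "((1 / 2) ^ k) ^ N = 2 powr (- real k * real N)"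
      using h1[of "k * N"] by (simp add: power_mult)
    moreover have "(2 powr (2 * a - 2)) ^ k = 2 powr ((2 * a - 2) * real k)"
      by (simp add: powr_powr powr_realpow[symmetric])
    moreover have "2 powr (- 2 * real k) * 2 powr ((real k + 1) * p) * 2 powr (- real k * real N) =
        2 powr p * 2 powr ((2 * a - 2) * real k)"
      unfolding powr_add[symmetric] by (simp add: p_def algebra_simps)
    ultimately have "c1 k * (((1 / 2) ^ k) ^ N * V) = L\<^sup>2 * 2 powr p * V * (2 powr (2 * a - 2)) ^ k"
      unfolding c1_def power_mult_distrib[of L] by (simp only: mult.assoc mult.commute mult.left_commute)
    then show ?thesis using V by (subst ennreal_mult[symmetric]) (auto simp: c1_def)
  qed
  have t2: "ennreal (c2 k) * ennreal ((2 ^ Suc k) ^ N * V) = ennreal (2 powr real N * V * (2 powr (- 2 * a)) ^ k)" for k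
  proof -
    have "1 / (2 ^ k) powr p = 2 powr (- real k * p)"
      unfolding h2 powr_powr powr_minus_divide[symmetric] by simp
    moreover have "(2 ^ Suc k) ^ N = 2 powr ((real k + 1) * real N)"
      using h2[of "Suc k * N"] by (simp only: power_mult) (simp add: algebra_simps)
    moreover have "(2 powr (- 2 * a)) ^ k = 2 powr (- 2 * a * real k)"
      by (simp add: powr_powr powr_realpow[symmetric])
    moreover have "2 powr (- real k * p) * 2 powr ((real k + 1) * real N) = 2 powr real N * 2 powr (- 2 * a * real k)"
      unfolding powr_add[symmetric] by (simp add: p_def algebra_simps)
    ultimately have "c2 k * ((2 ^ Suc k) ^ N * V) = 2 powr real N * V * (2 powr (- 2 * a)) ^ k"
      unfolding c2_def by (simp only: mult.assoc mult.commute mult.left_commute)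
    then show ?thesis using V by (subst ennreal_mult[symmetric]) (auto simp: c2_def)
  qed
  \<comment> \<open>The inner ratio is below 1 because a < 1, the outer one because a > 0.\<close>
  have q: "2 powr (2 * a - 2) < 1" "2 powr (- 2 * a) < 1" using a by (auto intro!: powr_less_one)
  have "(\<Sum>k. ennreal (L\<^sup>2 * 2 powr p * V * (2 powr (2 * a - 2)) ^ k)) < \<infinity>"
    by (rule suminf_ennreal_geometric_finite[OF _ _ q(1)]) (use V in auto)
  moreover have "(\<Sum>k. ennreal (2 powr real N * V * (2 powr (- 2 * a)) ^ k)) < \<infinity>"
    by (rule suminf_ennreal_geometric_finite[OF _ _ q(2)]) (use V in auto)
  moreover have "x < \<infinity> \<Longrightarrow> y < \<infinity> \<Longrightarrow> x + y < \<infinity>" for x y :: ennreal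
    by (simp add: ennreal_add_less_top)
  ultimately have fin: "J < \<infinity>" unfolding J_def t1 t2 by blast
  have bound: "(\<integral>\<^sup>+y. ennreal (min 1 ((L * norm (x - y))\<^sup>2) * frac_kernel a x y) \<partial>lborel) \<le> J" for x :: 'a
  proof -
    let ?f = "\<lambda>k y. ennreal (c1 k) * indicator (ball x ((1 / 2) ^ k)) y"
    let ?g = "\<lambda>k y. ennreal (c2 k) * indicator (ball x (2 ^ Suc k)) y"
    have [measurable]: "ball x r \<in> sets borel" for r by simp
    have le: "ennreal (min 1 ((L * norm (x - y))\<^sup>2) * frac_kernel a x y) \<le> (\<Sum>k. ?f k y) + (\<Sum>k. ?g k y)" for y
    proof (cases "x = y")
      case True
      then show ?thesis by (simp add: frac_kernel_def)
    next
      case False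
      define r where "r = norm (x - y)"
      have r: "0 < r" using False by (simp add: r_def)
      have kern: "frac_kernel a x y = 1 / r powr p" by (simp add: frac_kernel_def r_def p_def N_def)
      have single: "h k \<le> (\<Sum>k. h k)" for h :: "nat \<Rightarrow> ennreal" and k
        using sum_le_suminf[of h "{k}"] by simp
      from r show ?thesis
      proof (cases r rule: dyadic_shell)
        case (1 k)
        have "min 1 ((L * r)\<^sup>2) * (1 / r powr p) \<le> c1 k"
          unfolding c1_def
        proof (intro mult_mono)
          have "(L * r)\<^sup>2 \<le> (L * (1 / 2) ^ k)\<^sup>2"
            unfolding power_mult_distrib[of L] using 1 r by (intro mult_left_mono power_mono) auto
          then show "min 1 ((L * r)\<^sup>2) \<le> (L * (1 / 2) ^ k)\<^sup>2" by simp
          show "1 / r powr p \<le> 1 / ((1 / 2) ^ Suc k) powr p"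
            using 1 r p by (intro divide_left_mono powr_mono2 mult_pos_pos) auto
        qed auto
        then have "ennreal (min 1 ((L * r)\<^sup>2) * (1 / r powr p)) \<le> ?f k y"
          using 1 by (simp add: r_def dist_norm ennreal_leI)
        also have "\<dots> \<le> (\<Sum>k. ?f k y)" by (rule single)
        finally show ?thesis by (simp add: kern r_def[symmetric] add_increasing2)
      next
        case (2 k)
        have "min 1 ((L * r)\<^sup>2) * (1 / r powr p) \<le> 1 * (1 / r powr p)" by (intro mult_right_mono) auto
        also have "\<dots> \<le> c2 k"
          unfolding c2_def mult_1 using 2 r p by (intro divide_left_mono powr_mono2 mult_pos_pos) auto
        finally have "ennreal (min 1 ((L * r)\<^sup>2) * (1 / r powr p)) \<le> ?g k y"
          using 2 by (simp add: r_def dist_norm ennreal_leI)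
        also have "\<dots> \<le> (\<Sum>k. ?g k y)" by (rule single)
        finally show ?thesis by (simp add: kern r_def[symmetric] add_increasing)
      qed
    qed
    have "(\<integral>\<^sup>+y. ennreal (min 1 ((L * norm (x - y))\<^sup>2) * frac_kernel a x y) \<partial>lborel) \<le>
        (\<integral>\<^sup>+y. (\<Sum>k. ?f k y) + (\<Sum>k. ?g k y) \<partial>lborel)"
      by (rule nn_integral_mono) (rule le)
    also have "\<dots> = (\<Sum>k. \<integral>\<^sup>+y. ?f k y \<partial>lborel) + (\<Sum>k. \<integral>\<^sup>+y. ?g k y \<partial>lborel)"
      by (subst nn_integral_add; (measurable)?)
        (intro arg_cong2[where f="(+)"] nn_integral_suminf; measurable)
    also have "\<dots> = J"
      unfolding J_def by (simp add: nn_integral_cmult_indicator ball del: power_Suc)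
    finally show ?thesis .
  qed
  from that[OF fin bound] show ?thesis .
qed

text \<open>The squared difference is at most min 1 (L |x - y|)^2 and vanishes unless one of the
  points lies in \<Omega>. So the double integral is at most twice the measure of \<Omega> times the
  uniform bound for the truncated kernel.\<close>

lemma Lipschitz_cutoff_in_X0:
  fixes \<Omega> :: "'a::euclidean_space set"
  assumes a: "0 < a" "a < 1" and \<Omega>: "bounded \<Omega>" "open \<Omega>"
    and f: "\<And>x. 0 \<le> f x" "\<And>x. f x \<le> 1" "\<And>x. x \<notin> \<Omega> \<Longrightarrow> f x = 0"
      "\<And>x y. \<bar>f x - f y\<bar> \<le> L * norm (x - y)"
  shows "f \<in> X0 \<Omega> a"
proof -
  have "continuous_on UNIV f"
  proof (rule lipschitz_on_continuous_on)
    show "\<bar>L\<bar>-lipschitz_on UNIV f"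
    proof (rule lipschitz_onI)
      show "dist (f x) (f y) \<le> \<bar>L\<bar> * dist x y" for x y
        using f(4)[of x y] abs_ge_self[of L] mult_right_mono[OF abs_ge_self[of L] norm_ge_zero[of "x - y"]]
        by (simp add: dist_norm)
    qed simp
  qed
  then have [measurable]: "f \<in> borel_measurable borel" by (rule borel_measurable_continuous_onI)
  have [measurable]: "\<Omega> \<in> sets borel" using \<Omega> by simp
  have fin: "emeasure lborel \<Omega> < \<infinity>" using \<Omega>(1) by (rule emeasure_bounded_finite)
  have sq: "integrable lborel (\<lambda>x. (f x)\<^sup>2)"
  proof (rule Bochner_Integration.integrable_bound)
    show "integrable lborel (indicator \<Omega> :: 'a \<Rightarrow> real)" using fin by (intro integrable_real_indicator) auto
    have "(f x)\<^sup>2 \<le> 1" for x using f(1,2)[of x] by (simp add: power_le_one)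
    then show "AE x in lborel. norm ((f x)\<^sup>2) \<le> norm (indicator \<Omega> x :: real)"
      using f(3) by (intro AE_I2) (auto simp: indicator_def)
  qed simp
  obtain J where J: "J < \<infinity>" "\<And>x :: 'a.
    (\<integral>\<^sup>+y. ennreal (min 1 ((L * norm (x - y))\<^sup>2) * frac_kernel a x y) \<partial>lborel) \<le> J"
    using truncated_kernel_integral_finite[OF a, of L, where 'a='a] by metis
  let ?\<phi> = "\<lambda>(x :: 'a, y). ennreal (min 1 ((L * norm (x - y))\<^sup>2) * frac_kernel a x y)"
  have \<phi>_eq: "?\<phi> = (\<lambda>p. ennreal (min 1 ((L * norm (fst p - snd p))\<^sup>2) * (\<lambda>(x, y). frac_kernel a x y) p))"
    by (auto simp: fun_eq_iff)
  have [measurable]: "?\<phi> \<in> borel_measurable (lborel \<Otimes>\<^sub>M lborel)"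
    unfolding \<phi>_eq by measurable
  have \<phi>_sym: "?\<phi> (x, y) = ?\<phi> (y, x)" for x y :: 'a
    by (simp add: frac_kernel_def norm_minus_commute)
  have half: "(\<integral>\<^sup>+p. indicator \<Omega> (fst p) * ?\<phi> p \<partial>(lborel \<Otimes>\<^sub>M lborel)) \<le> emeasure lborel \<Omega> * J"
  proof -
    have "(\<integral>\<^sup>+p. indicator \<Omega> (fst p) * ?\<phi> p \<partial>(lborel \<Otimes>\<^sub>M lborel)) =
        (\<integral>\<^sup>+x. \<integral>\<^sup>+y. indicator \<Omega> (fst (x, y)) * ?\<phi> (x, y) \<partial>lborel \<partial>lborel)"
      by (rule lborel.nn_integral_fst[symmetric]) measurable
    also have "\<dots> = (\<integral>\<^sup>+x. indicator \<Omega> x * (\<integral>\<^sup>+y. ?\<phi> (x, y) \<partial>lborel) \<partial>lborel)"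
      by (intro nn_integral_cong) (auto simp: indicator_def)
    also have "\<dots> \<le> (\<integral>\<^sup>+x. indicator \<Omega> x * J \<partial>lborel)"
      using J(2) by (intro nn_integral_mono mult_left_mono) auto
    also have "\<dots> = emeasure lborel \<Omega> * J" by (simp add: nn_integral_multc)
    finally show ?thesis .
  qed
  have half': "(\<integral>\<^sup>+p. indicator \<Omega> (snd p) * ?\<phi> p \<partial>(lborel \<Otimes>\<^sub>M lborel)) \<le> emeasure lborel \<Omega> * J"
  proof -
    have "(\<integral>\<^sup>+p. indicator \<Omega> (snd p) * ?\<phi> p \<partial>(lborel \<Otimes>\<^sub>M lborel)) =
        (\<integral>\<^sup>+y. \<integral>\<^sup>+x. indicator \<Omega> (snd (x, y)) * ?\<phi> (x, y) \<partial>lborel \<partial>lborel)"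
      by (rule lborel_pair.nn_integral_snd[symmetric]) measurable
    also have "\<dots> = (\<integral>\<^sup>+y. indicator \<Omega> y * (\<integral>\<^sup>+x. ?\<phi> (y, x) \<partial>lborel) \<partial>lborel)"
      by (intro nn_integral_cong) (auto simp: indicator_def frac_kernel_def norm_minus_commute)
    also have "\<dots> \<le> (\<integral>\<^sup>+x. indicator \<Omega> x * J \<partial>lborel)"
      using J(2) by (intro nn_integral_mono mult_left_mono) auto
    also have "\<dots> = emeasure lborel \<Omega> * J" by (simp add: nn_integral_multc)
    finally show ?thesis .
  qed
  have "integrable (lborel \<Otimes>\<^sub>M lborel) (\<lambda>p. (frac_diff a f p)\<^sup>2)"
  proof (rule integrableI_bounded)
    have "ennreal (norm ((frac_diff a f p)\<^sup>2)) \<le> indicator \<Omega> (fst p) * ?\<phi> p + indicator \<Omega> (snd p) * ?\<phi> p" for p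
    proof -
      obtain x y where p: "p = (x, y)" by (cases p)
      have eq: "(frac_diff a f p)\<^sup>2 = (f x - f y)\<^sup>2 * frac_kernel a x y"
        by (simp add: p frac_diff_def power_mult_distrib frac_kernel_nonneg)
      have "\<bar>f x - f y\<bar> \<le> 1" using f(1,2)[of x] f(1,2)[of y] by linarith
      then have "(f x - f y)\<^sup>2 \<le> 1" using abs_square_le_1 by blast
      moreover have "(f x - f y)\<^sup>2 \<le> (L * norm (x - y))\<^sup>2"
        using f(4)[of x y] by (metis abs_ge_zero order_trans power2_abs power_mono)
      ultimately have "(frac_diff a f p)\<^sup>2 \<le> min 1 ((L * norm (x - y))\<^sup>2) * frac_kernel a x y"
        unfolding eq by (intro mult_right_mono frac_kernel_nonneg) simp
      then have le: "ennreal ((frac_diff a f p)\<^sup>2) \<le> ?\<phi> p" by (simp add: p ennreal_leI)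
      show ?thesis
      proof (cases "x \<in> \<Omega> \<or> y \<in> \<Omega>")
        case True
        then show ?thesis using le by (auto simp: p indicator_def add_increasing add_increasing2)
      next
        case False
        then have "frac_diff a f p = 0" using f(3) by (simp add: p frac_diff_def)
        then show ?thesis by simp
      qed
    qed
    then have "(\<integral>\<^sup>+p. ennreal (norm ((frac_diff a f p)\<^sup>2)) \<partial>(lborel \<Otimes>\<^sub>M lborel)) \<le>
        (\<integral>\<^sup>+p. indicator \<Omega> (fst p) * ?\<phi> p + indicator \<Omega> (snd p) * ?\<phi> p \<partial>(lborel \<Otimes>\<^sub>M lborel))"
      by (intro nn_integral_mono)
    also have "\<dots> = (\<integral>\<^sup>+p. indicator \<Omega> (fst p) * ?\<phi> p \<partial>(lborel \<Otimes>\<^sub>M lborel)) +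
        (\<integral>\<^sup>+p. indicator \<Omega> (snd p) * ?\<phi> p \<partial>(lborel \<Otimes>\<^sub>M lborel))"
      by (rule nn_integral_add) measurable
    also have "\<dots> \<le> emeasure lborel \<Omega> * J + emeasure lborel \<Omega> * J" by (rule add_mono[OF half half'])
    also have "\<dots> < \<infinity>" using fin J(1) by (simp add: ennreal_mult_less_top ennreal_add_less_top)
    finally show "(\<integral>\<^sup>+p. ennreal (norm ((frac_diff a f p)\<^sup>2)) \<partial>(lborel \<Otimes>\<^sub>M lborel)) < \<infinity>" .
  qed measurable
  then show ?thesis using sq f(3) unfolding X0_def H_frac_iff by simp
qed

text \<open>The L2 closure of \<open>X0 \<Omega> a\<close>. Being stable under L2 limits and linear
  combinations, it can be enlarged from cut-offs to indicators of open sets, of Borel sets, and then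
  to all of \<open>L2_space \<Omega>\<close>.\<close>

definition X0_approximable :: "'a::euclidean_space set \<Rightarrow> real \<Rightarrow> ('a \<Rightarrow> real) \<Rightarrow> bool" where
  "X0_approximable \<Omega> a v \<longleftrightarrow> v \<in> L2_space \<Omega> \<and> (\<forall>e>0. \<exists>z\<in>X0 \<Omega> a. L2_norm \<Omega> (\<lambda>x. v x - z x) < e)"

lemma (in semi_inner_space) triangle:
  assumes "u \<in> V" "v \<in> V"
  shows "nrm (\<lambda>x. c * u x + d * v x) \<le> \<bar>c\<bar> * nrm u + \<bar>d\<bar> * nrm v"
proof (rule power2_le_imp_le)
  have "c * d * ip u v \<le> \<bar>c * d\<bar> * \<bar>ip u v\<bar>" by (metis abs_ge_self abs_mult)
  also have "\<dots> \<le> \<bar>c * d\<bar> * (nrm u * nrm v)" using Cauchy_Schwarz[OF assms] by (intro mult_left_mono) auto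
  finally show "(nrm (\<lambda>x. c * u x + d * v x))\<^sup>2 \<le> (\<bar>c\<bar> * nrm u + \<bar>d\<bar> * nrm v)\<^sup>2"
    unfolding nrm_lin_sq[OF assms] by (simp add: power2_eq_square algebra_simps abs_mult)
  show "0 \<le> \<bar>c\<bar> * nrm u + \<bar>d\<bar> * nrm v" using assms nrm_nonneg by simp
qed

lemma L2_norm_tendsto_0:
  fixes v :: "'a::euclidean_space \<Rightarrow> real" and z :: "nat \<Rightarrow> 'a \<Rightarrow> real"
  assumes \<Omega>: "\<Omega> \<in> sets borel" and v: "v \<in> L2_space \<Omega>" and z: "\<And>n. z n \<in> L2_space \<Omega>"
    and lim: "AE x in lborel. (\<lambda>n. z n x) \<longlonglongrightarrow> v x"
    and dom: "integrable lborel q" "\<And>n. AE x in lborel. (v x - z n x)\<^sup>2 \<le> q x"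
  shows "(\<lambda>n. L2_norm \<Omega> (\<lambda>x. v x - z n x)) \<longlonglongrightarrow> 0"
proof -
  interpret L2: semi_inner_space "L2_space \<Omega>" "L2_inner \<Omega>" "L2_norm \<Omega>"
    by (rule semi_inner_space_L2[OF \<Omega>])
  note [measurable] = L2_spaceD(1)[OF v] L2_spaceD(1)[OF z]
  have "(\<lambda>n. LINT x|lborel. (v x - z n x)\<^sup>2) \<longlonglongrightarrow> (LINT x::'a|lborel. (0::real))"
  proof (rule Bochner_Integration.integral_dominated_convergence[where w=q and s="\<lambda>n x. (v x - z n x)\<^sup>2" and f="\<lambda>_. 0"])
    show "AE x in lborel. (\<lambda>n. (v x - z n x)\<^sup>2) \<longlonglongrightarrow> 0"
      using lim by eventually_elim (auto intro!: tendsto_eq_intros)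
  qed (use dom in auto)
  then have "(\<lambda>n. sqrt (LINT x|lborel. (v x - z n x)\<^sup>2)) \<longlonglongrightarrow> sqrt 0"
    by (intro tendsto_real_sqrt) simp
  moreover have "L2_norm \<Omega> (\<lambda>x. v x - z n x) = sqrt (LINT x|lborel. (v x - z n x)\<^sup>2)" for n
    unfolding L2_norm_def using L2_inner_eq(1)[OF L2.diff[OF v z] L2.diff[OF v z] \<Omega>, of n n]
    by (simp add: power2_eq_square)
  ultimately show ?thesis by simp
qed

lemma X0_approximable_limit:
  assumes \<Omega>: "\<Omega> \<in> sets borel" and v: "v \<in> L2_space \<Omega>" and z: "\<And>n. X0_approximable \<Omega> a (z n)"
    and lim: "(\<lambda>n. L2_norm \<Omega> (\<lambda>x. v x - z n x)) \<longlonglongrightarrow> 0"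
  shows "X0_approximable \<Omega> a v"
  unfolding X0_approximable_def
proof (intro conjI allI impI v)
  interpret L2: semi_inner_space "L2_space \<Omega>" "L2_inner \<Omega>" "L2_norm \<Omega>"
    by (rule semi_inner_space_L2[OF \<Omega>])
  fix e :: real assume e: "0 < e"
  have "\<forall>\<^sub>F n in sequentially. L2_norm \<Omega> (\<lambda>x. v x - z n x) < e / 2"
    using lim e by (intro order_tendstoD) auto
  then obtain n where n: "L2_norm \<Omega> (\<lambda>x. v x - z n x) < e / 2"
    using eventually_happens'[OF sequentially_bot] by blast
  have zn: "z n \<in> L2_space \<Omega>" using z by (simp add: X0_approximable_def)
  have "e / 2 > 0" using e by simp
  then obtain y where y: "y \<in> X0 \<Omega> a" "L2_norm \<Omega> (\<lambda>x. z n x - y x) < e / 2"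
    using z[of n] unfolding X0_approximable_def by blast
  have yL: "y \<in> L2_space \<Omega>" using y X0_subset_L2_space by blast
  have "L2_norm \<Omega> (\<lambda>x. v x - y x) \<le> L2_norm \<Omega> (\<lambda>x. v x - z n x) + L2_norm \<Omega> (\<lambda>x. z n x - y x)"
    using L2.triangle[OF L2.diff[OF v zn] L2.diff[OF zn yL], of 1 1] by simp
  then show "\<exists>y\<in>X0 \<Omega> a. L2_norm \<Omega> (\<lambda>x. v x - y x) < e" using y n by force
qed

lemma X0_approximable_lin:
  assumes a: "0 < a" "a < 1" and \<Omega>: "\<Omega> \<in> sets borel"
    and u: "X0_approximable \<Omega> a u" and v: "X0_approximable \<Omega> a v"
  shows "X0_approximable \<Omega> a (\<lambda>x. c * u x + d * v x)"
  unfolding X0_approximable_def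
proof (intro conjI allI impI)
  interpret L2: semi_inner_space "L2_space \<Omega>" "L2_inner \<Omega>" "L2_norm \<Omega>"
    by (rule semi_inner_space_L2[OF \<Omega>])
  interpret X: semi_inner_space "X0 \<Omega> a" "frac_lap a" "X0_norm a"
    by (rule semi_inner_space_X0[OF a])
  have uv: "u \<in> L2_space \<Omega>" "v \<in> L2_space \<Omega>" using u v by (auto simp: X0_approximable_def)
  then show "(\<lambda>x. c * u x + d * v x) \<in> L2_space \<Omega>" by (rule L2.lin)
  fix e :: real assume e: "0 < e"
  \<comment> \<open>The summand 1 keeps the denominator positive when both coefficients vanish and
    makes the final estimate strict.\<close>
  define k where "k = e / (\<bar>c\<bar> + \<bar>d\<bar> + 1)"
  have cd: "\<bar>c\<bar> + \<bar>d\<bar> + 1 > 0" by (simp add: add_nonneg_pos)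
  have k: "k > 0" "k * (\<bar>c\<bar> + \<bar>d\<bar> + 1) = e" using e cd by (simp_all add: k_def)
  obtain y where y: "y \<in> X0 \<Omega> a" "L2_norm \<Omega> (\<lambda>x. u x - y x) < k"
    using u k(1) unfolding X0_approximable_def by blast
  obtain z where z: "z \<in> X0 \<Omega> a" "L2_norm \<Omega> (\<lambda>x. v x - z x) < k"
    using v k(1) unfolding X0_approximable_def by blast
  have yz: "y \<in> L2_space \<Omega>" "z \<in> L2_space \<Omega>" using y z X0_subset_L2_space by blast+
  have "L2_norm \<Omega> (\<lambda>x. (c * u x + d * v x) - (c * y x + d * z x)) =
      L2_norm \<Omega> (\<lambda>x. c * (u x - y x) + d * (v x - z x))" by (simp add: algebra_simps)
  also have "\<dots> \<le> \<bar>c\<bar> * L2_norm \<Omega> (\<lambda>x. u x - y x) + \<bar>d\<bar> * L2_norm \<Omega> (\<lambda>x. v x - z x)"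
    using uv yz by (intro L2.triangle L2.diff)
  also have "\<dots> \<le> \<bar>c\<bar> * k + \<bar>d\<bar> * k" using y z by (intro add_mono mult_left_mono) auto
  also have "\<dots> < e" using k by (simp add: algebra_simps)
  finally show "\<exists>w\<in>X0 \<Omega> a. L2_norm \<Omega> (\<lambda>x. (c * u x + d * v x) - w x) < e"
    using X.lin[OF y(1) z(1)] by (intro bexI[of _ "\<lambda>x. c * y x + d * z x"]) auto
qed

text \<open>The cut-offs min 1 (n dist(x, complement of U)) are n-Lipschitz, vanish off U and
  eventually equal 1 at each point of U.\<close>

lemma X0_approximable_open:
  fixes \<Omega> :: "'a::euclidean_space set"
  assumes a: "0 < a" "a < 1" and \<Omega>: "bounded \<Omega>" "open \<Omega>" and U: "open U" "U \<subseteq> \<Omega>"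
  shows "X0_approximable \<Omega> a (indicator U)"
proof -
  have \<Omega>b [measurable]: "\<Omega> \<in> sets borel" and [measurable]: "U \<in> sets borel" using \<Omega> U by auto
  interpret L2: semi_inner_space "L2_space \<Omega>" "L2_inner \<Omega>" "L2_norm \<Omega>"
    by (rule semi_inner_space_L2[OF \<Omega>b])
  have fin: "integrable lborel (indicator \<Omega> :: 'a \<Rightarrow> real)"
    using emeasure_bounded_finite[OF \<Omega>(1)] by (intro integrable_real_indicator) auto
  have "U \<noteq> UNIV" using \<Omega>(1) U(2) not_bounded_UNIV bounded_subset by blast
  then have ne: "- U \<noteq> {}" by auto
  define f where "f n x = min 1 (real n * infdist x (- U))" for n x
  have f_X0: "f n \<in> X0 \<Omega> a" for n
  proof (rule Lipschitz_cutoff_in_X0[OF a \<Omega>])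
    show "0 \<le> f n x" "f n x \<le> 1" for x by (auto simp: f_def infdist_nonneg)
    show "f n x = 0" if "x \<notin> \<Omega>" for x
    proof -
      have "x \<in> - U" using that U(2) by auto
      then show ?thesis by (simp add: f_def)
    qed
    show "\<bar>f n x - f n y\<bar> \<le> real n * norm (x - y)" for x y
    proof -
      have "\<bar>f n x - f n y\<bar> \<le> \<bar>real n * infdist x (- U) - real n * infdist y (- U)\<bar>" by (simp add: f_def)
      also have "\<dots> = real n * \<bar>infdist x (- U) - infdist y (- U)\<bar>"
        by (simp add: abs_mult right_diff_distrib[symmetric])
      also have "\<dots> \<le> real n * dist x y" by (intro mult_left_mono infdist_triangle_abs) auto
      finally show ?thesis by (simp add: dist_norm)
    qed
  qed
  then have f_L2: "f n \<in> L2_space \<Omega>" for n using X0_subset_L2_space by blast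
  have U_L2: "indicator U \<in> L2_space \<Omega>"
  proof -
    have "integrable lborel (\<lambda>x. (indicator U x :: real)\<^sup>2)"
      by (rule Bochner_Integration.integrable_bound[OF fin]) (use U in \<open>auto simp: indicator_def\<close>)
    then show ?thesis using U by (auto simp: L2_space_def indicator_def)
  qed
  show ?thesis
  proof (rule X0_approximable_limit[OF \<Omega>b U_L2, of a f])
    show "X0_approximable \<Omega> a (f n)" for n
      unfolding X0_approximable_def using f_L2 f_X0 by (auto intro!: bexI[of _ "f n"] simp: L2.nrm_0)
    show "(\<lambda>n. L2_norm \<Omega> (\<lambda>x. indicator U x - f n x)) \<longlonglongrightarrow> 0"
    proof (rule L2_norm_tendsto_0[OF \<Omega>b U_L2 f_L2 _ fin])
      show "AE x in lborel. (\<lambda>n. f n x) \<longlonglongrightarrow> indicator U x"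
      proof (rule AE_I2)
        fix x
        show "(\<lambda>n. f n x) \<longlonglongrightarrow> indicator U x"
        proof (cases "x \<in> U")
          case True
          then have "infdist x (- U) > 0"
            using infdist_pos_not_in_closed[of "- U" x] U(1) ne by auto
          then obtain n :: nat where n: "1 < real n * infdist x (- U)" using reals_Archimedean3 by blast
          have "f k x = 1" if "k \<ge> n" for k
          proof -
            have "real n * infdist x (- U) \<le> real k * infdist x (- U)"
              using that by (intro mult_right_mono infdist_nonneg) auto
            then show ?thesis using n by (simp add: f_def)
          qed
          then show ?thesis using True by (intro tendsto_eventually eventually_sequentiallyI[of n]) simp
        qed (simp add: f_def)
      qed
      show "AE x in lborel. (indicator U x - f n x)\<^sup>2 \<le> indicator \<Omega> x" for n
      proof (rule AE_I2)
        fix x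
        have "0 \<le> f n x" "f n x \<le> 1" by (auto simp: f_def infdist_nonneg)
        then have "(1 - f n x)\<^sup>2 \<le> 1" by (simp add: power_le_one)
        moreover have "f n x = 0" if "x \<notin> U" using that by (simp add: f_def)
        ultimately show "(indicator U x - f n x)\<^sup>2 \<le> indicator \<Omega> x"
          using U(2) by (auto simp: indicator_def)
      qed
    qed
  qed
qed

text \<open>Outer regularity; the open supersets are intersected with \<Omega> so that their
  indicators stay in the space.\<close>

lemma X0_approximable_indicator:
  fixes \<Omega> :: "'a::euclidean_space set"
  assumes a: "0 < a" "a < 1" and \<Omega>: "bounded \<Omega>" "open \<Omega>" and A: "A \<in> sets borel" "A \<subseteq> \<Omega>"
  shows "X0_approximable \<Omega> a (indicator A)"
proof -
  note [measurable] = A(1)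
  have \<Omega>b [measurable]: "\<Omega> \<in> sets borel" using \<Omega> by auto
  interpret L2: semi_inner_space "L2_space \<Omega>" "L2_inner \<Omega>" "L2_norm \<Omega>"
    by (rule semi_inner_space_L2[OF \<Omega>b])
  have fin: "emeasure lborel B < \<infinity>" if "B \<subseteq> \<Omega>" for B
    using emeasure_bounded_finite[OF bounded_subset[OF \<Omega>(1) that]] .
  have ind: "indicator B \<in> L2_space \<Omega>" if [measurable]: "B \<in> sets borel" and "B \<subseteq> \<Omega>" for B
  proof -
    have "(indicator B x :: real)\<^sup>2 = indicator B x" for x by (simp add: indicator_def)
    then have "integrable lborel (\<lambda>x. (indicator B x :: real)\<^sup>2)"
      using fin[OF that(2)] by simp
    then show ?thesis using that by (auto simp: L2_space_def indicator_def)
  qed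
  have "\<exists>U. open U \<and> A \<subseteq> U \<and> emeasure lborel (U - A) < ennreal (1 / Suc n)" for n
    using outer_regular_lborel[OF A(1), of "1 / Suc n"] by (metis of_nat_0_less_iff zero_less_Suc zero_less_divide_1_iff)
  then obtain U where U: "\<And>n. open (U n)" "\<And>n. A \<subseteq> U n" "\<And>n. emeasure lborel (U n - A) < ennreal (1 / Suc n)"
    by metis
  define W where "W n = U n \<inter> \<Omega>" for n
  have W: "open (W n)" "A \<subseteq> W n" "W n \<subseteq> \<Omega>" for n using U \<Omega> A by (auto simp: W_def)
  have [measurable]: "W n \<in> sets borel" for n using W(1) by auto
  have AW: "indicator A \<in> L2_space \<Omega>" "indicator (W n) \<in> L2_space \<Omega>" for n using ind W A by auto
  have small: "L2_norm \<Omega> (\<lambda>x. indicator A x - indicator (W n) x) \<le> sqrt (1 / Suc n)" for n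
  proof -
    have "L2_inner \<Omega> (\<lambda>x. indicator A x - indicator (W n) x) (\<lambda>x. indicator A x - indicator (W n) x)
        = (LINT x|lborel. (indicator A x - indicator (W n) x) * (indicator A x - indicator (W n) x))"
      by (intro L2_inner_eq(1)[OF _ _ \<Omega>b] L2.diff AW)
    also have "\<dots> = (LINT x|lborel. indicator (W n - A) x)"
      using W(2) by (intro Bochner_Integration.integral_cong) (auto simp: indicator_def)
    also have "\<dots> = measure lborel (W n - A)" by simp
    also have "\<dots> \<le> 1 / Suc n"
    proof -
      have "emeasure lborel (W n - A) \<le> emeasure lborel (U n - A)"
        using U(1)[of n] by (intro emeasure_mono) (auto simp: W_def)
      then have "emeasure lborel (W n - A) \<le> ennreal (1 / Suc n)"
        using U(3)[of n] by (meson less_imp_le order_trans)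
      then show ?thesis unfolding measure_def by (intro enn2real_leI) auto
    qed
    finally show ?thesis unfolding L2_norm_def by (rule real_sqrt_le_mono)
  qed
  show ?thesis
  proof (rule X0_approximable_limit[OF \<Omega>b AW(1), of a "\<lambda>n. indicator (W n)"])
    show "X0_approximable \<Omega> a (indicator (W n))" for n
      by (rule X0_approximable_open[OF a \<Omega> W(1,3)])
    show "(\<lambda>n. L2_norm \<Omega> (\<lambda>x. indicator A x - indicator (W n) x)) \<longlonglongrightarrow> 0"
    proof (rule tendsto_sandwich[of "\<lambda>_. 0" _ _ "\<lambda>n. sqrt (1 / Suc n)"])
      have "(\<lambda>n. sqrt (1 / Suc n)) \<longlonglongrightarrow> sqrt 0"
        by (intro tendsto_real_sqrt LIMSEQ_Suc[OF lim_const_over_n])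
      then show "(\<lambda>n. sqrt (1 / Suc n)) \<longlonglongrightarrow> 0" by simp
    qed (use small L2.nrm_nonneg[OF L2.diff[OF AW]] in auto)
  qed
qed

lemma X0_dense_in_L2_space:
  fixes \<Omega> :: "'a::euclidean_space set"
  assumes a: "0 < a" "a < 1" and \<Omega>: "bounded \<Omega>" "open \<Omega>" and v: "v \<in> L2_space \<Omega>"
  shows "X0_approximable \<Omega> a v"
proof -
  have \<Omega>b [measurable]: "\<Omega> \<in> sets borel" using \<Omega> by auto
  note [measurable] = L2_spaceD(1)[OF v]
  interpret L2: semi_inner_space "L2_space \<Omega>" "L2_inner \<Omega>" "L2_norm \<Omega>"
    by (rule semi_inner_space_L2[OF \<Omega>b])
  have zero: "X0_approximable \<Omega> a (\<lambda>_. 0)"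
    using X0_approximable_indicator[OF a \<Omega>, of "{}"] by (simp add: indicator_def[abs_def])
  have v_lborel: "v \<in> borel_measurable lborel" by simp
  obtain F where F: "\<And>i. simple_function lborel (F i)" "\<And>x. (\<lambda>i. F i x) \<longlonglongrightarrow> v x"
    "\<And>i x. \<bar>F i x\<bar> \<le> 2 * \<bar>v x\<bar>"
    using borel_measurable_implies_sequence_metric[OF v_lborel, of 0] by (auto simp: dist_real_def)
  \<comment> \<open>The simple approximations are cut down to \<Omega>, where the level sets fall
    under \<open>X0_approximable_indicator\<close>; \<open>v\<close> vanishes almost everywhere
    outside, so the limit is unchanged.\<close>
  define G where "G i x = (\<Sum>y\<in>range (F i). y * indicator (\<Omega> \<inter> F i -` {y}) x)" for i x
  have fin: "finite (range (F i))" for i using F(1)[of i] by (simp add: simple_function_def)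
  have GF: "G i x = indicator \<Omega> x * F i x" for i x
  proof -
    have "G i x = (\<Sum>y\<in>range (F i). if F i x = y then indicator \<Omega> x * y else 0)"
      unfolding G_def by (intro sum.cong) (auto simp: indicator_def)
    then show ?thesis using fin[of i] by (simp add: sum.delta)
  qed
  have G: "X0_approximable \<Omega> a (G i)" for i
  proof -
    have "X0_approximable \<Omega> a (\<lambda>x. \<Sum>y\<in>Y. y * indicator (\<Omega> \<inter> F i -` {y}) x)" if "finite Y" for Y
      using that
    proof induction
      case (insert y Y)
      have "F i -` {y} \<inter> space lborel \<in> sets lborel" by (rule simple_functionD(2)[OF F(1)])
      then have "X0_approximable \<Omega> a (indicator (\<Omega> \<inter> F i -` {y}))"
        by (intro X0_approximable_indicator[OF a \<Omega>]) auto
      from X0_approximable_lin[OF a \<Omega>b this insert.IH, of y 1] show ?case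
        by (simp only: sum.insert[OF insert.hyps] mult_1)
    qed (simp add: zero)
    then show ?thesis unfolding G_def[abs_def] using fin by blast
  qed
  show ?thesis
  proof (rule X0_approximable_limit[OF \<Omega>b v G])
    show "(\<lambda>n. L2_norm \<Omega> (\<lambda>x. v x - G n x)) \<longlonglongrightarrow> 0"
    proof (rule L2_norm_tendsto_0[OF \<Omega>b v])
      show "G n \<in> L2_space \<Omega>" for n using G by (simp add: X0_approximable_def)
      show "AE x in lborel. (\<lambda>n. G n x) \<longlonglongrightarrow> v x"
        using L2_spaceD(3)[OF v]
      proof eventually_elim
        case (elim x)
        then show ?case using F(2)[of x] by (cases "x \<in> \<Omega>") (auto simp: GF)
      qed
      \<comment> \<open>The approximations satisfy |G| \<le> 2 |v|, so the error is at most 3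
        |v|.\<close>
      show "integrable lborel (\<lambda>x. 9 * (v x)\<^sup>2)" using L2_spaceD(2)[OF v] by simp
      show "AE x in lborel. (v x - G n x)\<^sup>2 \<le> 9 * (v x)\<^sup>2" for n
      proof (rule AE_I2)
        fix x
        have "\<bar>G n x\<bar> \<le> 2 * \<bar>v x\<bar>" using F(3)[of n x] by (auto simp: GF indicator_def)
        then have "\<bar>v x - G n x\<bar> \<le> 3 * \<bar>v x\<bar>" by linarith
        then have "\<bar>v x - G n x\<bar>\<^sup>2 \<le> (3 * \<bar>v x\<bar>)\<^sup>2" by (intro power_mono) auto
        then show "(v x - G n x)\<^sup>2 \<le> 9 * (v x)\<^sup>2" by (simp add: power_mult_distrib)
      qed
    qed
  qed
qed

text \<open>By density \<open>v\<close> may be paired with an element of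
  \<open>X0 \<Omega> a\<close> close to \<open>v\<close> itself, which reproduces the square of its
  norm up to a small error.\<close>

lemma L2_norm_le_of_X0_pairing:
  fixes \<Omega> :: "'a::euclidean_space set"
  assumes a: "0 < a" "a < 1" and \<Omega>: "bounded \<Omega>" "open \<Omega>" and v: "v \<in> L2_space \<Omega>"
    and K: "0 \<le> K" "\<And>z. z \<in> X0 \<Omega> a \<Longrightarrow> \<bar>L2_inner \<Omega> v z\<bar> \<le> K * L2_norm \<Omega> z"
  shows "L2_norm \<Omega> v \<le> K"
proof -
  have \<Omega>b: "\<Omega> \<in> sets borel" using \<Omega> by auto
  interpret L2: semi_inner_space "L2_space \<Omega>" "L2_inner \<Omega>" "L2_norm \<Omega>"
    by (rule semi_inner_space_L2[OF \<Omega>b])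
  have le: "(L2_norm \<Omega> v)\<^sup>2 \<le> K * L2_norm \<Omega> v + (K + L2_norm \<Omega> v) * e" if e: "e > 0" for e
  proof -
    obtain z where z: "z \<in> X0 \<Omega> a" "L2_norm \<Omega> (\<lambda>x. v x - z x) < e"
      using X0_dense_in_L2_space[OF a \<Omega> v] e unfolding X0_approximable_def by blast
    have zL: "z \<in> L2_space \<Omega>" using z X0_subset_L2_space by blast
    have "L2_norm \<Omega> z \<le> L2_norm \<Omega> v + L2_norm \<Omega> (\<lambda>x. v x - z x)"
      using L2.triangle[OF v L2.diff[OF v zL], of 1 "-1"] by simp
    then have nz: "L2_norm \<Omega> z \<le> L2_norm \<Omega> v + e" using z by simp
    have "(L2_norm \<Omega> v)\<^sup>2 = L2_inner \<Omega> v z + L2_inner \<Omega> v (\<lambda>x. v x - z x)"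
      using L2.ip_diff_right[OF v zL v] L2.nrm_sq[OF v] by simp
    also have "\<dots> \<le> K * L2_norm \<Omega> z + L2_norm \<Omega> v * L2_norm \<Omega> (\<lambda>x. v x - z x)"
      using K(2)[OF z(1)] L2.Cauchy_Schwarz[OF v L2.diff[OF v zL]] by linarith
    also have "\<dots> \<le> K * (L2_norm \<Omega> v + e) + L2_norm \<Omega> v * e"
      using nz z(2) K(1) L2.nrm_nonneg[OF v] by (intro add_mono mult_left_mono) auto
    finally show ?thesis by (simp add: algebra_simps)
  qed
  have "(L2_norm \<Omega> v)\<^sup>2 \<le> K * L2_norm \<Omega> v"
  proof (rule field_le_epsilon)
    fix d :: real assume "d > 0"
    define c where "c = K + L2_norm \<Omega> v + 1"
    have c: "c > 0" using K(1) L2.nrm_nonneg[OF v] by (simp add: c_def)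
    have "(K + L2_norm \<Omega> v) * (d / c) \<le> c * (d / c)"
      using c \<open>d > 0\<close> by (intro mult_right_mono) (auto simp: c_def)
    also have "\<dots> = d" using c by simp
    finally show "(L2_norm \<Omega> v)\<^sup>2 \<le> K * L2_norm \<Omega> v + d"
      using le[of "d / c"] c \<open>d > 0\<close> by simp
  qed
  then show ?thesis
    using K(1) L2.nrm_nonneg[OF v] by (cases "L2_norm \<Omega> v = 0") (auto simp: power2_eq_square)
qed

section \<open>Semiconvex energies\<close>

context semi_inner_space
begin

text \<open>A function that leaves \<open>V\<close> on a null set of times is replaced by one with
  values in \<open>V\<close> at every real time, so later arguments need no exceptional set for
  membership.\<close>

lemma strongly_measurable_extend:
  assumes f: "strongly_measurable I V nrm f" and I: "I \<in> sets lebesgue"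
  defines "F \<equiv> \<lambda>t. if t \<in> I \<and> f t \<in> V then f t else (\<lambda>_. 0)"
  shows "strongly_measurable UNIV V nrm F" "\<And>t. F t \<in> V" "AE t in lebesgue_on I. F t = f t"
proof -
  from f obtain h where h: "AE t in lebesgue_on I. f t \<in> V" "\<And>n. simple_function (lebesgue_on I) (h n)"
    "\<And>n. h n ` I \<subseteq> V" "AE t in lebesgue_on I. (\<lambda>n. nrm (\<lambda>x. h n t x - f t x)) \<longlonglongrightarrow> 0"
    unfolding strongly_measurable_def by blast
  show FV: "F t \<in> V" for t by (simp add: F_def zero)
  show ae: "AE t in lebesgue_on I. F t = f t"
    using h(1) AE_space by eventually_elim (simp add: F_def)
  define H where "H n t = (if t \<in> I then h n t else (\<lambda>_. 0))" for n t
  have "simple_function lebesgue (H n)" for n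
  proof -
    have fin: "finite (h n ` I)" using h(2)[of n] by (simp add: simple_function_def)
    have "finite (H n ` UNIV)"
      by (rule finite_subset[of _ "insert (\<lambda>_. 0) (h n ` I)"]) (use fin in \<open>auto simp: H_def\<close>)
    moreover have "H n -` {y} \<in> sets lebesgue" for y
    proof -
      have "h n -` {y} \<inter> I \<in> sets lebesgue"
      proof (cases "y \<in> h n ` I")
        case True
        then have "h n -` {y} \<inter> space (lebesgue_on I) \<in> sets (lebesgue_on I)"
          using h(2)[of n] unfolding simple_function_def by auto
        then have "h n -` {y} \<inter> I \<in> sets (lebesgue_on I)" by simp
        then show ?thesis using I by (auto simp: sets_restrict_space)
      next
        case False
        then have "h n -` {y} \<inter> I = {}" by auto
        then show ?thesis by simp
      qed
      moreover have "H n -` {y} = (h n -` {y} \<inter> I) \<union> (if y = (\<lambda>_. 0) then - I else {})"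
        by (auto simp: H_def split: if_splits)
      ultimately show ?thesis using I by (auto simp: Compl_in_sets_lebesgue)
    qed
    ultimately show ?thesis by (simp add: simple_function_def)
  qed
  moreover have "H n ` UNIV \<subseteq> V" for n using h(3)[of n] zero by (auto simp: H_def)
  moreover have "AE t in lebesgue. (\<lambda>n. nrm (\<lambda>x. H n t x - F t x)) \<longlonglongrightarrow> 0"
  proof -
    have "AE t in lebesgue_on I. (\<lambda>n. nrm (\<lambda>x. H n t x - F t x)) \<longlonglongrightarrow> 0"
      using h(4) ae AE_space by eventually_elim (simp add: H_def)
    then have "AE t in lebesgue. t \<in> I \<longrightarrow> (\<lambda>n. nrm (\<lambda>x. H n t x - F t x)) \<longlonglongrightarrow> 0"
      using I by (simp add: AE_restrict_space_iff)
    then show ?thesis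
    proof eventually_elim
      case (elim t)
      show ?case
      proof (cases "t \<in> I")
        case False
        then have "(\<lambda>x. H n t x - F t x) = (\<lambda>_. 0)" for n by (simp add: H_def F_def)
        then show ?thesis by (simp only: nrm_0) simp
      qed (use elim in simp)
    qed
  qed
  ultimately show "strongly_measurable UNIV V nrm F"
    unfolding strongly_measurable_def lebesgue_on_UNIV_eq using FV by (auto intro!: exI[of _ H])
qed

lemma bochner_L2_extend:
  assumes f: "bochner_L2 I V nrm f" and I: "I \<in> sets lebesgue"
  obtains F where "\<And>t. F t \<in> V" "\<And>t. t \<notin> I \<Longrightarrow> F t = (\<lambda>_. 0)" "AE t in lebesgue_on I. F t = f t"
    "strongly_measurable UNIV V nrm F" "integrable lebesgue (\<lambda>t. (nrm (F t))\<^sup>2)"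
proof
  define F where "F = (\<lambda>t. if t \<in> I \<and> f t \<in> V then f t else (\<lambda>_. 0))"
  have sm: "strongly_measurable I V nrm f" and int: "integrable (lebesgue_on I) (\<lambda>t. (nrm (f t))\<^sup>2)"
    using f by (auto simp: bochner_L2_def)
  note extend = strongly_measurable_extend[OF sm I]
  show "F t \<in> V" for t by (simp add: F_def zero)
  show "F t = (\<lambda>_. 0)" if "t \<notin> I" for t using that by (simp add: F_def)
  show ae: "AE t in lebesgue_on I. F t = f t" unfolding F_def by (rule extend(3))
  show m: "strongly_measurable UNIV V nrm F" unfolding F_def by (rule extend(1))
  have "(\<lambda>t. nrm (F t)) \<in> borel_measurable lebesgue"
    using nrm_measurable[OF m] by simp
  then have mF: "(\<lambda>t. (nrm (F t))\<^sup>2) \<in> borel_measurable lebesgue" by measurable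
  have "integrable lebesgue (\<lambda>t. indicator I t *\<^sub>R (nrm (f t))\<^sup>2)"
    using int I by (simp add: integrable_restrict_space)
  moreover have "AE t in lebesgue. indicator I t *\<^sub>R (nrm (f t))\<^sup>2 = (nrm (F t))\<^sup>2"
  proof -
    have "AE t in lebesgue. t \<in> I \<longrightarrow> F t = f t" using ae I by (simp add: AE_restrict_space_iff)
    then show ?thesis
    proof eventually_elim
      case (elim t)
      then show ?case by (cases "t \<in> I") (simp_all, simp add: F_def nrm_0)
    qed
  qed
  ultimately show "integrable lebesgue (\<lambda>t. (nrm (F t))\<^sup>2)"
    using mF by (subst integrable_cong_AE[symmetric]) auto
qed

end

lemma (in semi_inner_space) nrm_ip_integrable:
  fixes f h :: "real \<Rightarrow> 'b \<Rightarrow> real"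
  assumes f: "\<And>t. f t \<in> V" "strongly_measurable UNIV V nrm f" "integrable lebesgue (\<lambda>t. (nrm (f t))\<^sup>2)"
    and h: "\<And>t. h t \<in> V" "strongly_measurable UNIV V nrm h" "integrable lebesgue (\<lambda>t. (nrm (h t))\<^sup>2)"
  shows "integrable lebesgue (\<lambda>t. ip (f t) (h t))"
proof (rule Bochner_Integration.integrable_bound)
  show "integrable lebesgue (\<lambda>t. (nrm (f t))\<^sup>2 + (nrm (h t))\<^sup>2)" using f h by simp
  show "(\<lambda>t. ip (f t) (h t)) \<in> borel_measurable lebesgue" using ip_measurable[OF f(2) h(2)] by simp
  have "\<bar>ip (f t) (h t)\<bar> \<le> (nrm (f t))\<^sup>2 + (nrm (h t))\<^sup>2" for t
  proof -
    have "2 * (nrm (f t) * nrm (h t)) \<le> (nrm (f t))\<^sup>2 + (nrm (h t))\<^sup>2"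
      using zero_le_power2[of "nrm (f t) - nrm (h t)"] by (simp add: power2_eq_square algebra_simps)
    moreover have "0 \<le> nrm (f t) * nrm (h t)" using f h nrm_nonneg by simp
    ultimately show ?thesis using Cauchy_Schwarz[OF f(1)[of t] h(1)[of t]] by linarith
  qed
  then show "AE t in lebesgue. norm (ip (f t) (h t)) \<le> norm ((nrm (f t))\<^sup>2 + (nrm (h t))\<^sup>2)"
    by simp
qed

section \<open>Semiconvex potentials: subgradients and lower semicontinuity\<close>

lemma ennreal_liminf_add_le:
  fixes f h :: "nat \<Rightarrow> ennreal"
  shows "liminf f + liminf h \<le> liminf (\<lambda>n. f n + h n)"
proof -
  have "incseq (\<lambda>n. INF m\<in>{n..}. f m)" "incseq (\<lambda>n. INF m\<in>{n..}. h m)"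
    by (auto simp: incseq_def intro!: INF_superset_mono)
  then have "liminf f + liminf h = (SUP n. (INF m\<in>{n..}. f m) + (INF m\<in>{n..}. h m))"
    unfolding liminf_SUP_INF by (rule ennreal_SUP_add[symmetric])
  also have "\<dots> \<le> liminf (\<lambda>n. f n + h n)"
    unfolding liminf_SUP_INF by (intro SUP_mono' INF_greatest add_mono INF_lower)
  finally show ?thesis .
qed

locale semiconvex_potential =
  fixes \<Omega> :: "'a::euclidean_space set" and \<sigma> lam :: real and g gh :: "real \<Rightarrow> real"
  assumes \<Omega>: "bounded \<Omega>" "open \<Omega>" and \<sigma>: "0 < \<sigma>" "\<sigma> < 1"
    and g_diff: "\<And>r. g differentiable (at r)" and g0: "g 0 = 0" and g_deriv: "\<And>r. - lam \<le> deriv g r"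
    and gh: "\<And>r. (gh has_real_derivative g r) (at r)"
begin

lemma \<Omega>_borel [measurable]: "\<Omega> \<in> sets borel"
  using \<Omega> by auto

lemma gh_measurable [measurable]: "gh \<in> borel_measurable borel"
proof (rule borel_measurable_continuous_onI)
  show "continuous_on UNIV gh"
    using gh DERIV_isCont by (auto simp: continuous_on_eq_continuous_at)
qed

text \<open>The function gh + (lam / 2) z^2 has the nondecreasing derivative g + lam z, hence lies
  above its tangents; removing the quadratic leaves the stated error.\<close>

lemma semiconvex: "gh x + g x * (y - x) - lam / 2 * (y - x)\<^sup>2 \<le> gh y"
proof -
  define k where "k z = gh z + lam / 2 * z\<^sup>2" for z
  have dg: "(g has_real_derivative deriv g z) (at z)" for z
    using g_diff[of z] by (simp add: DERIV_deriv_iff_real_differentiable)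
  have mono: "g z + lam * z \<le> g z' + lam * z'" if "z \<le> z'" for z z'
  proof (rule DERIV_nonneg_imp_nondecreasing[OF that])
    fix t
    have "((\<lambda>z. g z + lam * z) has_real_derivative deriv g t + lam) (at t)"
      using dg[of t] by (auto intro!: derivative_eq_intros)
    then show "\<exists>d. ((\<lambda>z. g z + lam * z) has_real_derivative d) (at t) \<and> 0 \<le> d"
      using g_deriv[of t] by (intro exI[of _ "deriv g t + lam"]) auto
  qed
  have dk: "(k has_real_derivative g z + lam * z) (at z)" for z
    unfolding k_def[abs_def] using gh[of z] by (auto intro!: derivative_eq_intros)
  have "k x + (g x + lam * x) * (y - x) \<le> k y"
  proof (cases x y rule: linorder_cases)
    case less
    obtain z where z: "x < z" "z < y" "k y - k x = (y - x) * (g z + lam * z)"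
      using MVT2[OF less dk] by blast
    have "(y - x) * (g x + lam * x) \<le> (y - x) * (g z + lam * z)"
      using less mono[of x z] z by (intro mult_left_mono) auto
    then show ?thesis using z(3) by (simp add: mult.commute)
  next
    case greater
    obtain z where z: "y < z" "z < x" "k x - k y = (x - y) * (g z + lam * z)"
      using MVT2[OF greater dk] by blast
    have "(x - y) * (g z + lam * z) \<le> (x - y) * (g x + lam * x)"
      using greater mono[of z x] z by (intro mult_left_mono) auto
    then show ?thesis using z(3) by (simp add: algebra_simps)
  qed simp
  then show ?thesis unfolding k_def by (simp add: power2_eq_square algebra_simps)
qed

text \<open>The tangent at 0 is horizontal because g 0 = 0.\<close>

lemma gh_lower: "gh 0 - lam / 2 * r\<^sup>2 \<le> gh r"
  using semiconvex[of 0 r] g0 by simp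

lemma gh_upper: "gh r \<le> gh 0 + g r * r + lam / 2 * r\<^sup>2"
  using semiconvex[of r 0] by simp

definition fin_energy :: "('a \<Rightarrow> real) \<Rightarrow> bool" where
  "fin_energy v \<longleftrightarrow> set_integrable lborel \<Omega> (\<lambda>x. gh (v x))"

text \<open>A set integral of a nonintegrable function is 0 by default, so this number represents
  the energy only together with \<open>fin_energy\<close>.\<close>

definition real_energy :: "('a \<Rightarrow> real) \<Rightarrow> real" where
  "real_energy v = (X0_norm \<sigma> v)\<^sup>2 / 2 + (LINT x:\<Omega>|lborel. gh (v x))"

lemma energy_eq_real_energy:
  assumes "fin_energy v"
  shows "energy \<Omega> \<sigma> gh v = ereal (real_energy v)"
proof -
  let ?f = "\<lambda>x. indicator \<Omega> x * gh (v x)"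
  have int: "integrable lborel ?f" using assms by (simp add: fin_energy_def set_integrable_def)
  have p: "(\<integral>\<^sup>+x\<in>\<Omega>. ennreal (gh (v x)) \<partial>lborel) = (\<integral>\<^sup>+x. ennreal (?f x) \<partial>lborel)"
    "(\<integral>\<^sup>+x\<in>\<Omega>. ennreal (- gh (v x)) \<partial>lborel) = (\<integral>\<^sup>+x. ennreal (- ?f x) \<partial>lborel)"
    by (auto intro!: nn_integral_cong simp: indicator_def)
  have f: "(\<integral>\<^sup>+x. ennreal (?f x) \<partial>lborel) \<noteq> \<infinity>" "(\<integral>\<^sup>+x. ennreal (- ?f x) \<partial>lborel) \<noteq> \<infinity>"
    using int by (auto simp: real_integrable_def)
  obtain A B where AB: "(\<integral>\<^sup>+x. ennreal (?f x) \<partial>lborel) = ennreal A" "(\<integral>\<^sup>+x. ennreal (- ?f x) \<partial>lborel) = ennreal B"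
    "0 \<le> A" "0 \<le> B"
  proof -
    have ex: "\<exists>C\<ge>0. y = ennreal C" if "y \<noteq> \<infinity>" for y :: ennreal
      using that by (cases y) auto
    show ?thesis using ex[OF f(1)] ex[OF f(2)] that by blast
  qed
  have "(LINT x:\<Omega>|lborel. gh (v x)) = A - B"
    using real_lebesgue_integral_def[OF int] AB by (simp add: set_lebesgue_integral_def)
  then show ?thesis
    unfolding energy_def p AB using AB(3,4) by (simp add: real_energy_def enn2ereal_ennreal)
qed

lemma finite_measure_\<Omega>: "set_integrable lborel \<Omega> (\<lambda>_. c :: real)"
  unfolding set_integrable_def using emeasure_bounded_finite[OF \<Omega>(1)]
  by (simp add: integrable_real_indicator)

lemma X0_norm_diff_sq:
  assumes "u \<in> X0 \<Omega> \<sigma>" "v \<in> X0 \<Omega> \<sigma>"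
  shows "(X0_norm \<sigma> u)\<^sup>2 / 2 + frac_lap \<sigma> u (\<lambda>x. v x - u x) \<le> (X0_norm \<sigma> v)\<^sup>2 / 2"
proof -
  interpret X: semi_inner_space "X0 \<Omega> \<sigma>" "frac_lap \<sigma>" "X0_norm \<sigma>"
    by (rule semi_inner_space_X0[OF \<sigma>])
  have "0 \<le> (X0_norm \<sigma> (\<lambda>x. v x - u x))\<^sup>2" by simp
  then show ?thesis
    using X.nrm_diff_sq[OF assms(2,1)] X.ip_diff_right[OF assms(2,1,1)] X.nrm_sq[OF assms(1)] X.sym[OF assms]
    by simp
qed

text \<open>\<open>gh (u x)\<close> lies between the bounds \<open>gh_lower\<close> and
  \<open>gh_upper\<close>, and the product g(u) u in the latter is integrable as a product of L2
  functions. Thus the energy is finite whenever g(u) is square integrable.\<close>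

lemma fin_energy_of_L2:
  assumes u: "u \<in> L2_space \<Omega>" and gu: "(\<lambda>x. g (u x)) \<in> L2_space \<Omega>"
  shows "fin_energy u"
proof -
  note [measurable] = L2_spaceD(1)[OF u]
  have gu_u: "integrable lborel (\<lambda>x. g (u x) * u x)"
    using L2_inner_eq(2)[OF gu u \<Omega>_borel] .
  have "integrable lborel (\<lambda>x. indicator \<Omega> x * gh (u x))"
  proof (rule Bochner_Integration.integrable_bound)
    show "integrable lborel (\<lambda>x. indicator \<Omega> x *\<^sub>R \<bar>gh 0\<bar> + \<bar>g (u x) * u x\<bar> + \<bar>lam\<bar> / 2 * (u x)\<^sup>2)"
      using finite_measure_\<Omega>[of "\<bar>gh 0\<bar>"] gu_u L2_spaceD(2)[OF u] by (simp add: set_integrable_def)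
    show "AE x in lborel. norm (indicator \<Omega> x * gh (u x)) \<le>
        norm (indicator \<Omega> x *\<^sub>R \<bar>gh 0\<bar> + \<bar>g (u x) * u x\<bar> + \<bar>lam\<bar> / 2 * (u x)\<^sup>2)"
    proof (rule AE_I2)
      fix x
      have "lam / 2 * (u x)\<^sup>2 \<le> \<bar>lam\<bar> / 2 * (u x)\<^sup>2" "- (\<bar>lam\<bar> / 2) * (u x)\<^sup>2 \<le> lam / 2 * (u x)\<^sup>2"
        by (intro mult_right_mono; simp add: abs_if)+
      then have "\<bar>gh (u x)\<bar> \<le> \<bar>gh 0\<bar> + \<bar>g (u x) * u x\<bar> + \<bar>lam\<bar> / 2 * (u x)\<^sup>2"
        using gh_lower[of "u x"] gh_upper[of "u x"] by linarith
      moreover have "0 \<le> \<bar>gh 0\<bar> + \<bar>g (u x) * u x\<bar> + \<bar>lam\<bar> / 2 * (u x)\<^sup>2"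
        "0 \<le> \<bar>g (u x) * u x\<bar> + \<bar>lam\<bar> / 2 * (u x)\<^sup>2" by simp_all
      ultimately show "norm (indicator \<Omega> x * gh (u x)) \<le>
        norm (indicator \<Omega> x *\<^sub>R \<bar>gh 0\<bar> + \<bar>g (u x) * u x\<bar> + \<bar>lam\<bar> / 2 * (u x)\<^sup>2)"
        by (cases "x \<in> \<Omega>") (simp_all del: abs_mult)
    qed
  qed measurable
  then show ?thesis by (simp add: fin_energy_def set_integrable_def)
qed

text \<open>Convexity of the quadratic part and pointwise semiconvexity of the potential are added;
  the linear terms are exactly the second equation tested with v - u, and combine into the pairing
  with w.\<close>

lemma energy_subgradient:
  assumes u: "u \<in> X0 \<Omega> \<sigma>" and v: "v \<in> X0 \<Omega> \<sigma>" and w: "w \<in> L2_space \<Omega>"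
    and gu: "(\<lambda>x. g (u x)) \<in> L2_space \<Omega>"
    and eq: "\<And>z. z \<in> X0 \<Omega> \<sigma> \<Longrightarrow> L2_inner \<Omega> w z = frac_lap \<sigma> u z + L2_inner \<Omega> (\<lambda>x. g (u x)) z"
    and fin: "fin_energy v"
  shows "real_energy u + L2_inner \<Omega> w (\<lambda>x. v x - u x) - lam / 2 * (L2_norm \<Omega> (\<lambda>x. v x - u x))\<^sup>2 \<le> real_energy v"
proof -
  interpret X: semi_inner_space "X0 \<Omega> \<sigma>" "frac_lap \<sigma>" "X0_norm \<sigma>"
    by (rule semi_inner_space_X0[OF \<sigma>])
  interpret L2: semi_inner_space "L2_space \<Omega>" "L2_inner \<Omega>" "L2_norm \<Omega>"
    by (rule semi_inner_space_L2[OF \<Omega>_borel])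
  have uL: "u \<in> L2_space \<Omega>" and vL: "v \<in> L2_space \<Omega>" using u v X0_subset_L2_space by blast+
  let ?d = "\<lambda>x. v x - u x"
  have dX: "?d \<in> X0 \<Omega> \<sigma>" by (rule X.diff[OF v u])
  have dL: "?d \<in> L2_space \<Omega>" by (rule L2.diff[OF vL uL])
  have set_int: "set_integrable lborel \<Omega> f" if "integrable lborel f" for f :: "'a \<Rightarrow> real"
    using that unfolding set_integrable_def by (intro integrable_mult_indicator) auto
  have i1: "set_integrable lborel \<Omega> (\<lambda>x. gh (u x))"
    using fin_energy_of_L2[OF uL gu] by (simp add: fin_energy_def)
  have i2: "set_integrable lborel \<Omega> (\<lambda>x. g (u x) * ?d x)"
    by (rule set_int[OF L2_inner_eq(2)[OF gu dL \<Omega>_borel]])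
  have i3: "set_integrable lborel \<Omega> (\<lambda>x. ?d x * ?d x)"
    by (rule set_int[OF L2_inner_eq(2)[OF dL dL \<Omega>_borel]])
  have i4: "set_integrable lborel \<Omega> (\<lambda>x. lam / 2 * (?d x * ?d x))" using i3 by (rule set_integrable_mult_right)
  have "(LINT x:\<Omega>|lborel. gh (u x) + g (u x) * ?d x - lam / 2 * (?d x * ?d x)) \<le> (LINT x:\<Omega>|lborel. gh (v x))"
    using i1 i2 i4 fin semiconvex[of "u _" "v _"]
    by (intro set_integral_mono set_integral_add set_integral_diff) (auto simp: fin_energy_def power2_eq_square)
  also have "(LINT x:\<Omega>|lborel. gh (u x) + g (u x) * ?d x - lam / 2 * (?d x * ?d x)) =
      (LINT x:\<Omega>|lborel. gh (u x)) + L2_inner \<Omega> (\<lambda>x. g (u x)) ?d - lam / 2 * L2_inner \<Omega> ?d ?d"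
    unfolding L2_inner_def using i1 i2 i4 by (simp add: set_integral_add set_integral_diff)
  finally show ?thesis
    using X0_norm_diff_sq[OF u v] eq[OF dX] L2.nrm_sq[OF dL] by (simp add: real_energy_def)
qed

text \<open>For finite energy this is the energy plus (lam / 2) |v|^2, shifted by the constant gh 0
  times the measure of \<Omega>. As a sum of integrals of nonnegative functions it suits Fatou's
  lemma and may be infinite. The 4 combines the 2 in the norm with the 2 in the energy.\<close>

definition convex_part :: "('a \<Rightarrow> real) \<Rightarrow> ennreal" where
  "convex_part v = (\<integral>\<^sup>+p. ennreal (frac_const DIM('a) \<sigma> / 4 * (frac_diff \<sigma> v p)\<^sup>2) \<partial>(lborel \<Otimes>\<^sub>M lborel))
    + (\<integral>\<^sup>+x\<in>\<Omega>. ennreal (gh (v x) + lam / 2 * (v x)\<^sup>2 - gh 0) \<partial>lborel)"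

lemma potential_nonneg: "0 \<le> gh r + lam / 2 * r\<^sup>2 - gh 0"
  using gh_lower[of r] by simp

lemma set_integrable_square:
  assumes "v \<in> L2_space \<Omega>"
  shows "set_integrable lborel \<Omega> (\<lambda>x. (v x)\<^sup>2)" "(LINT x:\<Omega>|lborel. (v x)\<^sup>2) = (L2_norm \<Omega> v)\<^sup>2"
proof -
  interpret L2: semi_inner_space "L2_space \<Omega>" "L2_inner \<Omega>" "L2_norm \<Omega>"
    by (rule semi_inner_space_L2[OF \<Omega>_borel])
  show "set_integrable lborel \<Omega> (\<lambda>x. (v x)\<^sup>2)"
    using L2_spaceD(2)[OF assms] unfolding set_integrable_def by (intro integrable_mult_indicator) auto
  show "(LINT x:\<Omega>|lborel. (v x)\<^sup>2) = (L2_norm \<Omega> v)\<^sup>2"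
    using L2.nrm_sq[OF assms] by (simp add: L2_inner_def power2_eq_square)
qed

lemma convex_part_eq:
  assumes v: "v \<in> X0 \<Omega> \<sigma>" and fin: "fin_energy v"
  shows "convex_part v = ennreal (real_energy v + lam / 2 * (L2_norm \<Omega> v)\<^sup>2 - gh 0 * measure lborel \<Omega>)"
    and "0 \<le> real_energy v + lam / 2 * (L2_norm \<Omega> v)\<^sup>2 - gh 0 * measure lborel \<Omega>"
proof -
  note [measurable] = X0D(1)[OF v]
  have vL: "v \<in> L2_space \<Omega>" using v X0_subset_L2_space by blast
  have fc: "0 < frac_const DIM('a) \<sigma>" by (rule frac_const_pos[OF \<sigma>])
  let ?D = "\<integral>p. (frac_diff \<sigma> v p)\<^sup>2 \<partial>(lborel \<Otimes>\<^sub>M lborel)"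
  let ?P = "\<lambda>x. gh (v x) + lam / 2 * (v x)\<^sup>2 - gh 0"
  have D: "(\<integral>\<^sup>+p. ennreal (frac_const DIM('a) \<sigma> / 4 * (frac_diff \<sigma> v p)\<^sup>2) \<partial>(lborel \<Otimes>\<^sub>M lborel))
      = ennreal (frac_const DIM('a) \<sigma> / 4 * ?D)"
    using X0D(3)[OF v] fc by (subst nn_integral_eq_integral) auto
  have D0: "0 \<le> ?D" by (intro integral_nonneg_AE AE_I2) auto
  have i: "set_integrable lborel \<Omega> (\<lambda>x. gh (v x))" "set_integrable lborel \<Omega> (\<lambda>x. lam / 2 * (v x)\<^sup>2)"
    "set_integrable lborel \<Omega> (\<lambda>_. gh 0)"
    using fin set_integrable_square(1)[OF vL] finite_measure_\<Omega> by (auto simp: fin_energy_def)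
  have iP: "set_integrable lborel \<Omega> ?P" using i by (intro set_integral_diff set_integral_add)
  have P: "(\<integral>\<^sup>+x\<in>\<Omega>. ennreal (?P x) \<partial>lborel) = ennreal (LINT x:\<Omega>|lborel. ?P x)"
  proof -
    have "(\<integral>\<^sup>+x\<in>\<Omega>. ennreal (?P x) \<partial>lborel) = (\<integral>\<^sup>+x. ennreal (indicator \<Omega> x *\<^sub>R ?P x) \<partial>lborel)"
      by (intro nn_integral_cong) (auto simp: indicator_def)
    also have "\<dots> = ennreal (LINT x|lborel. indicator \<Omega> x *\<^sub>R ?P x)"
      using iP potential_nonneg by (intro nn_integral_eq_integral) (auto simp: set_integrable_def indicator_def)
    finally show ?thesis by (simp add: set_lebesgue_integral_def)
  qed
  have P0: "0 \<le> (LINT x:\<Omega>|lborel. ?P x)"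
    unfolding set_lebesgue_integral_def using potential_nonneg by (intro integral_nonneg_AE AE_I2) (auto simp: indicator_def)
  have const: "(LINT x:\<Omega>|lborel. gh 0) = gh 0 * measure lborel \<Omega>"
    unfolding set_lebesgue_integral_def using emeasure_bounded_finite[OF \<Omega>(1)] by (simp add: mult.commute)
  have "(LINT x:\<Omega>|lborel. ?P x) = (LINT x:\<Omega>|lborel. gh (v x)) + lam / 2 * (L2_norm \<Omega> v)\<^sup>2 - gh 0 * measure lborel \<Omega>"
    using i set_integral_add[OF i(1,2)] set_integral_diff[OF set_integral_add(1)[OF i(1,2)] i(3)] const
      set_integrable_square(2)[OF vL] by simp
  moreover have "(X0_norm \<sigma> v)\<^sup>2 / 2 = frac_const DIM('a) \<sigma> / 4 * ?D"
    using X0_norm_sq[OF \<sigma>, of v] by simp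
  ultimately have sum: "real_energy v + lam / 2 * (L2_norm \<Omega> v)\<^sup>2 - gh 0 * measure lborel \<Omega> =
      frac_const DIM('a) \<sigma> / 4 * ?D + (LINT x:\<Omega>|lborel. ?P x)"
    by (simp add: real_energy_def)
  show "convex_part v = ennreal (real_energy v + lam / 2 * (L2_norm \<Omega> v)\<^sup>2 - gh 0 * measure lborel \<Omega>)"
    unfolding convex_part_def D P sum using fc D0 P0 by (intro ennreal_plus[symmetric]) auto
  show "0 \<le> real_energy v + lam / 2 * (L2_norm \<Omega> v)\<^sup>2 - gh 0 * measure lborel \<Omega>"
    unfolding sum using fc D0 P0 by simp
qed

lemma convex_part_lsc:
  assumes u: "\<And>n. u n \<in> borel_measurable borel" and v: "v \<in> borel_measurable borel"
    and lim: "AE x in lborel. (\<lambda>n. u n x) \<longlonglongrightarrow> v x"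
  shows "convex_part v \<le> liminf (\<lambda>n. convex_part (u n))"
proof -
  note [measurable] = u v
  let ?K = "\<lambda>v. \<integral>\<^sup>+p. ennreal (frac_const DIM('a) \<sigma> / 4 * (frac_diff \<sigma> v p)\<^sup>2) \<partial>(lborel \<Otimes>\<^sub>M lborel)"
  let ?Q = "\<lambda>v x. ennreal (gh (v x) + lam / 2 * (v x)\<^sup>2 - gh 0) * indicator \<Omega> x"
  obtain N where N: "N \<in> null_sets lborel" "\<And>x. x \<notin> N \<Longrightarrow> (\<lambda>n. u n x) \<longlonglongrightarrow> v x"
    using lim by (auto elim!: AE_E3)
  \<comment> \<open>Convergence almost everywhere in one variable becomes convergence for almost
    every pair, since both strips over the null set are null.\<close>
  have "N \<times> UNIV \<in> null_sets (lborel \<Otimes>\<^sub>M lborel)" "UNIV \<times> N \<in> null_sets (lborel \<Otimes>\<^sub>M lborel)"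
    using N(1) by (auto intro: lborel.times_in_null_sets1 lborel.times_in_null_sets2)
  then have "N \<times> UNIV \<union> UNIV \<times> N \<in> null_sets (lborel \<Otimes>\<^sub>M lborel)" by (rule null_sets.Un)
  then have "AE p in (lborel \<Otimes>\<^sub>M lborel). p \<notin> N \<times> UNIV \<union> UNIV \<times> N" by (rule AE_not_in)
  then have "AE p in (lborel \<Otimes>\<^sub>M lborel). (\<lambda>n. ennreal (frac_const DIM('a) \<sigma> / 4 * (frac_diff \<sigma> (u n) p)\<^sup>2)) \<longlonglongrightarrow>
      ennreal (frac_const DIM('a) \<sigma> / 4 * (frac_diff \<sigma> v p)\<^sup>2)"
  proof eventually_elim
    case (elim p)
    obtain x y where p: "p = (x, y)" by (cases p)
    have "(\<lambda>n. u n x) \<longlonglongrightarrow> v x" "(\<lambda>n. u n y) \<longlonglongrightarrow> v y" using elim N(2) by (auto simp: p)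
    then show ?case unfolding p frac_diff_def by (auto intro!: tendsto_intros)
  qed
  then have "?K v = (\<integral>\<^sup>+p. liminf (\<lambda>n. ennreal (frac_const DIM('a) \<sigma> / 4 * (frac_diff \<sigma> (u n) p)\<^sup>2)) \<partial>(lborel \<Otimes>\<^sub>M lborel))"
    by (intro nn_integral_cong_AE) (auto elim!: eventually_mono dest: lim_imp_Liminf[OF sequentially_bot])
  also have "\<dots> \<le> liminf (\<lambda>n. ?K (u n))" by (intro nn_integral_liminf) measurable
  finally have K: "?K v \<le> liminf (\<lambda>n. ?K (u n))" .
  have "AE x in lborel. (\<lambda>n. ?Q (u n) x) \<longlonglongrightarrow> ?Q v x"
    using lim
  proof eventually_elim
    case (elim x)
    have "isCont gh (v x)" using gh DERIV_isCont by blast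
    then have "(\<lambda>n. gh (u n x)) \<longlonglongrightarrow> gh (v x)" using elim by (rule isCont_tendsto_compose)
    then have "(\<lambda>n. ennreal (gh (u n x) + lam / 2 * (u n x)\<^sup>2 - gh 0)) \<longlonglongrightarrow> ennreal (gh (v x) + lam / 2 * (v x)\<^sup>2 - gh 0)"
      using elim by (intro tendsto_intros)
    then show ?case by (cases "x \<in> \<Omega>") auto
  qed
  then have "(\<integral>\<^sup>+x. ?Q v x \<partial>lborel) = (\<integral>\<^sup>+x. liminf (\<lambda>n. ?Q (u n) x) \<partial>lborel)"
    by (intro nn_integral_cong_AE) (auto elim!: eventually_mono dest: lim_imp_Liminf[OF sequentially_bot])
  also have "\<dots> \<le> liminf (\<lambda>n. \<integral>\<^sup>+x. ?Q (u n) x \<partial>lborel)" by (intro nn_integral_liminf) measurable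
  finally have Q: "(\<integral>\<^sup>+x. ?Q v x \<partial>lborel) \<le> liminf (\<lambda>n. \<integral>\<^sup>+x. ?Q (u n) x \<partial>lborel)" .
  have "convex_part v \<le> liminf (\<lambda>n. ?K (u n)) + liminf (\<lambda>n. \<integral>\<^sup>+x. ?Q (u n) x \<partial>lborel)"
    unfolding convex_part_def using K Q by (intro add_mono)
  also have "\<dots> \<le> liminf (\<lambda>n. convex_part (u n))"
    unfolding convex_part_def by (rule ennreal_liminf_add_le)
  finally show ?thesis .
qed

text \<open>Fatou's lemma handles \<open>convex_part\<close>; strong L2 convergence is what lets the
  added term (lam / 2) |u|^2 pass to the limit and be subtracted again.\<close>

lemma energy_lsc:
  assumes u: "\<And>n. u n \<in> X0 \<Omega> \<sigma>" and v: "v \<in> X0 \<Omega> \<sigma>"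
    and lim: "(\<lambda>n. L2_norm \<Omega> (\<lambda>x. u n x - v x)) \<longlonglongrightarrow> 0"
    and fin: "\<And>n. fin_energy (u n)" and le: "\<And>n. real_energy (u n) \<le> c n" and c: "c \<longlonglongrightarrow> c'"
  shows "fin_energy v \<and> real_energy v \<le> c'"
proof -
  interpret L2: semi_inner_space "L2_space \<Omega>" "L2_inner \<Omega>" "L2_norm \<Omega>"
    by (rule semi_inner_space_L2[OF \<Omega>_borel])
  note [measurable] = X0D(1)[OF u] X0D(1)[OF v]
  have uL: "u n \<in> L2_space \<Omega>" and vL: "v \<in> L2_space \<Omega>" for n using u v X0_subset_L2_space by blast+
  have dL: "(\<lambda>x. u n x - v x) \<in> L2_space \<Omega>" for n by (rule L2.diff[OF uL vL])
  have "(\<lambda>n. (L2_norm \<Omega> (\<lambda>x. u n x - v x))\<^sup>2) \<longlonglongrightarrow> 0" using tendsto_power[OF lim, of 2] by simp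
  moreover have "(L2_norm \<Omega> (\<lambda>x. u n x - v x))\<^sup>2 = (LINT x|lborel. norm ((u n x - v x)\<^sup>2))" for n
    using L2.nrm_sq[OF dL[of n]] L2_inner_eq(1)[OF dL[of n] dL[of n] \<Omega>_borel] by (simp add: power2_eq_square)
  ultimately have "(\<lambda>n. LINT x|lborel. norm ((u n x - v x)\<^sup>2)) \<longlonglongrightarrow> 0" by simp
  \<comment> \<open>A subsequence suffices: the bounds \<open>c n\<close> converge, so they have the
    same limit along it.\<close>
  from tendsto_L1_AE_subseq[OF L2_spaceD(2)[OF dL] this]
  obtain r :: "nat \<Rightarrow> nat" where r: "strict_mono r" and ae: "AE x in lborel. (\<lambda>n. (u (r n) x - v x)\<^sup>2) \<longlonglongrightarrow> 0"
    by blast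
  have "AE x in lborel. (\<lambda>n. u (r n) x) \<longlonglongrightarrow> v x"
    using ae
  proof eventually_elim
    case (elim x)
    have "(\<lambda>n. \<bar>u (r n) x - v x\<bar>) \<longlonglongrightarrow> 0" using tendsto_real_sqrt[OF elim] by simp
    then show ?case by (simp add: tendsto_rabs_zero_iff LIM_zero_cancel)
  qed
  then have "convex_part v \<le> liminf (\<lambda>n. convex_part (u (r n)))"
    by (intro convex_part_lsc) auto
  also have "\<dots> \<le> liminf (\<lambda>n. ennreal (c (r n) + lam / 2 * (L2_norm \<Omega> (u (r n)))\<^sup>2 - gh 0 * measure lborel \<Omega>))"
    using le by (intro Liminf_mono always_eventually allI) (auto simp: convex_part_eq(1)[OF u fin] intro!: ennreal_leI)
  finally have 1: "convex_part v \<le> liminf (\<lambda>n. ennreal (c (r n) + lam / 2 * (L2_norm \<Omega> (u (r n)))\<^sup>2 - gh 0 * measure lborel \<Omega>))" .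
  have "(\<lambda>n. L2_inner \<Omega> (u n) (u n)) \<longlonglongrightarrow> L2_inner \<Omega> v v"
    by (rule L2.ip_tendsto[OF uL vL lim uL vL lim])
  then have n2: "(\<lambda>n. (L2_norm \<Omega> (u n))\<^sup>2) \<longlonglongrightarrow> (L2_norm \<Omega> v)\<^sup>2" by (simp add: L2.nrm_sq[OF uL] L2.nrm_sq[OF vL])
  have lim2: "(\<lambda>n. c (r n) + lam / 2 * (L2_norm \<Omega> (u (r n)))\<^sup>2 - gh 0 * measure lborel \<Omega>) \<longlonglongrightarrow>
      c' + lam / 2 * (L2_norm \<Omega> v)\<^sup>2 - gh 0 * measure lborel \<Omega>"
    using LIMSEQ_subseq_LIMSEQ[OF c r] LIMSEQ_subseq_LIMSEQ[OF n2 r] unfolding o_def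
    by (intro tendsto_add tendsto_diff tendsto_mult[OF tendsto_const] tendsto_const)
  have "convex_part v \<le> ennreal (c' + lam / 2 * (L2_norm \<Omega> v)\<^sup>2 - gh 0 * measure lborel \<Omega>)"
    using 1 lim_imp_Liminf[OF sequentially_bot tendsto_ennrealI[OF lim2]] by simp
  note 2 = this
  \<comment> \<open>\<open>ennreal\<close> sends negative numbers to 0, so the comparison returns to
    real numbers only once the limit is known to be nonnegative.\<close>
  have "0 \<le> c' + lam / 2 * (L2_norm \<Omega> v)\<^sup>2 - gh 0 * measure lborel \<Omega>"
  proof (rule LIMSEQ_le_const[OF lim2], intro exI allI impI)
    fix n
    show "0 \<le> c (r n) + lam / 2 * (L2_norm \<Omega> (u (r n)))\<^sup>2 - gh 0 * measure lborel \<Omega>"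
      using convex_part_eq(2)[OF u fin, of "r n"] le[of "r n"] by linarith
  qed
  note 3 = this
  have "(\<integral>\<^sup>+x\<in>\<Omega>. ennreal (gh (v x) + lam / 2 * (v x)\<^sup>2 - gh 0) \<partial>lborel) \<le> convex_part v"
    by (simp add: convex_part_def)
  also have "\<dots> < \<infinity>" using 2 by (rule le_less_trans) simp
  finally have finP: "(\<integral>\<^sup>+x\<in>\<Omega>. ennreal (gh (v x) + lam / 2 * (v x)\<^sup>2 - gh 0) \<partial>lborel) < \<infinity>" .
  have "integrable lborel (\<lambda>x. indicator \<Omega> x *\<^sub>R (gh (v x) + lam / 2 * (v x)\<^sup>2 - gh 0))"
  proof (rule integrableI_bounded)
    have "(\<integral>\<^sup>+x. ennreal (norm (indicator \<Omega> x *\<^sub>R (gh (v x) + lam / 2 * (v x)\<^sup>2 - gh 0))) \<partial>lborel) =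
        (\<integral>\<^sup>+x\<in>\<Omega>. ennreal (gh (v x) + lam / 2 * (v x)\<^sup>2 - gh 0) \<partial>lborel)"
      using potential_nonneg by (intro nn_integral_cong) (auto simp: indicator_def)
    then show "(\<integral>\<^sup>+x. ennreal (norm (indicator \<Omega> x *\<^sub>R (gh (v x) + lam / 2 * (v x)\<^sup>2 - gh 0))) \<partial>lborel) < \<infinity>"
      using finP by simp
  qed measurable
  then have "set_integrable lborel \<Omega> (\<lambda>x. gh (v x) + lam / 2 * (v x)\<^sup>2 - gh 0)" by (simp add: set_integrable_def)
  moreover have "set_integrable lborel \<Omega> (\<lambda>x. lam / 2 * (v x)\<^sup>2 - gh 0)"
    using set_integrable_mult_right[OF set_integrable_square(1)[OF vL], of "lam / 2"] finite_measure_\<Omega>[of "gh 0"]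
    by (rule set_integral_diff(1))
  ultimately have "set_integrable lborel \<Omega> (\<lambda>x. (gh (v x) + lam / 2 * (v x)\<^sup>2 - gh 0) - (lam / 2 * (v x)\<^sup>2 - gh 0))"
    by (rule set_integral_diff(1))
  then have finv: "fin_energy v" by (simp add: fin_energy_def)
  moreover have "real_energy v \<le> c'" using 2 3 convex_part_eq[OF v finv] by simp
  ultimately show ?thesis by simp
qed

end

section \<open>The energy identity\<close>

lemma open_time_interval: "open (time_interval S T)"
proof (cases T)
  case (real r)
  then have "time_interval S T = {S<..<r}" by (auto simp: time_interval_def)
  then show ?thesis by simp
next
  case PInf
  then have "time_interval S T = {S<..}" by (auto simp: time_interval_def)
  then show ?thesis by simp
qed (simp add: time_interval_def)

lemma time_interval_sets: "time_interval S T \<in> sets lebesgue"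
  using open_time_interval by auto

text \<open>\<open>W\<close> is a representative of \<open>w\<close> with values in
  \<open>X0 \<Omega> s\<close> at every time and defined on the whole line. The time derivative is
  expressed through \<open>W\<close>, so both equations involve only \<open>u\<close> and
  \<open>W\<close>.\<close>

locale cahn_hilliard_flow = semiconvex_potential \<Omega> \<sigma> lam g gh
  for \<Omega> :: "'a::euclidean_space set" and \<sigma> lam :: real and g gh :: "real \<Rightarrow> real" +
  fixes s S :: real and T :: ereal and u W :: "real \<Rightarrow> 'a \<Rightarrow> real"
    and u' :: "real \<Rightarrow> ('a \<Rightarrow> real) \<Rightarrow> real"
  assumes s: "0 < s" "s < 1" and lam: "0 \<le> lam"
    and u_cont: "weakly_continuous \<Omega> \<sigma> (time_interval0 S T) u"
    and u_deriv: "has_time_derivative \<Omega> s (time_interval S T) u u'"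
    and W: "\<And>t. W t \<in> X0 \<Omega> s" "strongly_measurable UNIV (X0 \<Omega> s) (X0_norm s) W"
      "integrable lebesgue (\<lambda>t. (X0_norm s (W t))\<^sup>2)"
    and u'_eq: "AE t in lebesgue_on (time_interval S T). \<forall>z\<in>X0 \<Omega> s. u' t z = - frac_lap s (W t) z"
    and W_eq: "AE t in lebesgue_on (time_interval S T). (\<lambda>x. g (u t x)) \<in> L2_space \<Omega> \<and>
      (\<forall>z\<in>X0 \<Omega> \<sigma>. L2_inner \<Omega> (W t) z = frac_lap \<sigma> (u t) z + L2_inner \<Omega> (\<lambda>x. g (u t x)) z)"
begin

sublocale X: semi_inner_space "X0 \<Omega> s" "frac_lap s" "X0_norm s"
  by (rule semi_inner_space_X0[OF s])

sublocale L2: semi_inner_space "L2_space \<Omega>" "L2_inner \<Omega>" "L2_norm \<Omega>"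
  by (rule semi_inner_space_L2[OF \<Omega>_borel])

lemma u_X0: "S \<le> t \<Longrightarrow> ereal t < T \<Longrightarrow> u t \<in> X0 \<Omega> \<sigma>"
  using u_cont by (auto simp: weakly_continuous_def time_interval0_def)

lemma u_L2: "S \<le> t \<Longrightarrow> ereal t < T \<Longrightarrow> u t \<in> L2_space \<Omega>"
  using u_X0 X0_subset_L2_space by blast

lemma before_T: "r \<le> b \<Longrightarrow> ereal b < T \<Longrightarrow> ereal r < T"
  by (metis ereal_less_eq(3) le_less_trans)

lemma pairing_continuous:
  assumes "z \<in> L2_space \<Omega>" "S \<le> a" "ereal b < T"
  shows "continuous_on {a..b} (\<lambda>t. L2_inner \<Omega> (u t) z)"
proof (rule continuous_on_subset)
  show "continuous_on (time_interval0 S T) (\<lambda>t. L2_inner \<Omega> (u t) z)"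
    using u_cont L2_inner_in_X0_dual[OF \<sigma> \<Omega>(1) \<Omega>_borel assms(1)] by (auto simp: weakly_continuous_def)
  show "{a..b} \<subseteq> time_interval0 S T"
    using assms before_T by (auto simp: time_interval0_def)
qed

lemma W_norm_integrable: "(\<lambda>r. X0_norm s (W r)) integrable_on {a..b}"
  using X.locally_integrable(1)[OF W] by (rule set_lebesgue_integral_eq_integral)

lemma W_pairing_integrable: "z \<in> X0 \<Omega> s \<Longrightarrow> (\<lambda>r. frac_lap s (W r) z) integrable_on {a..b}"
  using X.locally_integrable(2)[OF W] by (rule set_lebesgue_integral_eq_integral)

text \<open>The scalar function (u(t), z) is continuous and has weak derivative minus the form of W
  and z. Test functions are supported inside the open time interval, so t stays away from
  \<open>S\<close> here.\<close>

lemma pairing_increment_open: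
  assumes z: "z \<in> X0 \<Omega> s" and t: "S < t" "t < \<tau>" "ereal \<tau> < T"
  shows "L2_inner \<Omega> (u \<tau>) z - L2_inner \<Omega> (u t) z = - integral {t..\<tau>} (\<lambda>r. frac_lap s (W r) z)"
proof -
  let ?I = "time_interval S T"
  have zL: "z \<in> L2_space \<Omega>" using z X0_subset_L2_space by blast
  obtain b where b: "\<tau> < b" "ereal b < T"
    using ereal_dense2[OF t(3)] by auto
  have sub: "{t..b} \<subseteq> ?I" using t b before_T by (auto simp: time_interval_def)
  have m: "(\<lambda>r. - frac_lap s (W r) z) \<in> borel_measurable (lebesgue_on ?I)"
    using X.ip_measurable[OF X.strongly_measurable_mono[OF W(2)] X.strongly_measurable_const[OF z] time_interval_sets]
      time_interval_sets by simp
  have ae: "AE r in lebesgue_on ?I. - frac_lap s (W r) z = u' r z"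
    using u'_eq by eventually_elim (use z in auto)
  have m': "(\<lambda>r. u' r z) \<in> borel_measurable (lebesgue_on ?I)"
    by (rule borel_measurable_lebesgue_on_AE[OF m time_interval_sets ae])
  have "L2_inner \<Omega> (u \<tau>) z - L2_inner \<Omega> (u t) z = integral {t..\<tau>} (\<lambda>r. - frac_lap s (W r) z)"
  proof (rule weak_derivative_FTC[OF _ t(2) b(1) sub time_interval_sets])
    show "continuous_on {t..b} (\<lambda>r. L2_inner \<Omega> (u r) z)"
      by (rule pairing_continuous[OF zL _ b(2)]) (use t in simp)
    have "set_integrable lebesgue {t..b} (\<lambda>r. frac_lap s (W r) z)"
      by (rule X.locally_integrable(2)[OF W z])
    then show "(\<lambda>r. - frac_lap s (W r) z) absolutely_integrable_on {t..b}"
      using set_integrable_mult_right[of "-1 :: real" lebesgue "{t..b}" "\<lambda>r. frac_lap s (W r) z"] by simp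
    fix \<phi> assume \<phi>: "test_function ?I \<phi>"
    have "C_k 0 \<phi>" using \<phi> unfolding test_function_def C_infinity_def by blast
    then have "continuous_on UNIV \<phi>" by simp
    then have "continuous_on ?I \<phi>" by (rule continuous_on_subset) simp
    then have m\<phi>: "\<phi> \<in> borel_measurable (lebesgue_on ?I)"
      by (rule continuous_imp_measurable_on_sets_lebesgue[OF _ time_interval_sets])
    have "(LINT r|lebesgue_on ?I. \<phi> r * u' r z) = (LINT r|lebesgue_on ?I. \<phi> r * (- frac_lap s (W r) z))"
    proof (rule integral_cong_AE)
      show "AE r in lebesgue_on ?I. \<phi> r * u' r z = \<phi> r * (- frac_lap s (W r) z)"
        using ae by eventually_elim (simp only:)
    qed (use m m' m\<phi> in auto)
    then show "(LINT r|lebesgue_on ?I. deriv \<phi> r * L2_inner \<Omega> (u r) z) =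
        - (LINT r|lebesgue_on ?I. \<phi> r * (- frac_lap s (W r) z))"
      using u_deriv \<phi> z by (simp add: has_time_derivative_def)
  qed
  then show ?thesis by simp
qed

text \<open>The initial time \<open>S\<close> is reached by continuity of both sides.\<close>

lemma pairing_increment:
  assumes z: "z \<in> X0 \<Omega> s" and t: "S \<le> t" "t \<le> \<tau>" "ereal \<tau> < T"
  shows "L2_inner \<Omega> (u \<tau>) z - L2_inner \<Omega> (u t) z = - integral {t..\<tau>} (\<lambda>r. frac_lap s (W r) z)"
proof (cases "t = \<tau>")
  case False
  then have t\<tau>: "t < \<tau>" using t by simp
  have zL: "z \<in> L2_space \<Omega>" using z X0_subset_L2_space by blast
  let ?c = "\<lambda>r. L2_inner \<Omega> (u r) z" and ?f = "\<lambda>r. frac_lap s (W r) z"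
  have fi: "?f integrable_on {a..b}" for a b by (rule W_pairing_integrable[OF z])
  \<comment> \<open>The denominators start at 2, which keeps the points strictly between t and
    \<tau>.\<close>
  define x where "x n = t + (\<tau> - t) / real (Suc (Suc n))" for n
  have x: "t < x n" "x n < \<tau>" for n
  proof -
    have "(\<tau> - t) / real (Suc (Suc n)) < (\<tau> - t) / 1" using t\<tau> by (intro divide_strict_left_mono) auto
    then show "t < x n" "x n < \<tau>" using t\<tau> by (auto simp: x_def)
  qed
  have "(\<lambda>n. (\<tau> - t) / real (Suc (Suc n))) \<longlonglongrightarrow> 0"
    by (rule LIMSEQ_Suc[OF LIMSEQ_Suc[OF lim_const_over_n]])
  then have xt: "x \<longlonglongrightarrow> t" unfolding x_def using tendsto_add[OF tendsto_const] by fastforce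
  have "(\<lambda>n. ?c \<tau> - ?c (x n)) \<longlonglongrightarrow> ?c \<tau> - ?c t"
    using x xt t\<tau> less_imp_le[OF x(1)] less_imp_le[OF x(2)]
    by (intro tendsto_diff tendsto_const continuous_on_tendsto_compose[OF pairing_continuous[OF zL t(1,3)]]) auto
  moreover have "(\<lambda>n. - (integral {t..\<tau>} ?f - integral {t..x n} ?f)) \<longlonglongrightarrow> - (integral {t..\<tau>} ?f - integral {t..t} ?f)"
    using x xt t\<tau> less_imp_le[OF x(1)] less_imp_le[OF x(2)]
    by (intro tendsto_minus tendsto_diff tendsto_const
        continuous_on_tendsto_compose[OF indefinite_integral_continuous_1[OF fi[of t \<tau>]]]) auto
  moreover have "?c \<tau> - ?c (x n) = - (integral {t..\<tau>} ?f - integral {t..x n} ?f)" for n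
  proof -
    have "integral {t..x n} ?f + integral {x n..\<tau>} ?f = integral {t..\<tau>} ?f"
      using x[of n] by (intro Henstock_Kurzweil_Integration.integral_combine fi) auto
    then show ?thesis using pairing_increment_open[OF z, of "x n" \<tau>] x[of n] t by simp
  qed
  ultimately have "?c \<tau> - ?c t = - (integral {t..\<tau>} ?f - integral {t..t} ?f)"
    using LIMSEQ_unique by simp
  then show ?thesis by simp
qed simp

lemma pairing_difference:
  assumes z: "z \<in> X0 \<Omega> s" and a: "S \<le> a" "ereal b < T" and t: "t \<in> {a..b}" "\<tau> \<in> {a..b}"
  shows "L2_inner \<Omega> z (\<lambda>x. u \<tau> x - u t x) =
    - (integral {a..\<tau>} (\<lambda>r. frac_lap s (W r) z) - integral {a..t} (\<lambda>r. frac_lap s (W r) z))"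
proof -
  have zL: "z \<in> L2_space \<Omega>" using z X0_subset_L2_space by blast
  have uL: "u t \<in> L2_space \<Omega>" "u \<tau> \<in> L2_space \<Omega>"
    using t a before_T[OF _ a(2)] by (auto intro!: u_L2)
  have *: "L2_inner \<Omega> (u y) z - L2_inner \<Omega> (u a) z = - integral {a..y} (\<lambda>r. frac_lap s (W r) z)"
    if "y \<in> {a..b}" for y
    using pairing_increment[OF z a(1), of y] that before_T[OF _ a(2), of y] by auto
  show ?thesis
    using L2.ip_diff_right[OF uL(2,1) zL] L2.sym[OF zL uL(1)] L2.sym[OF zL uL(2)] *[OF t(1)] *[OF t(2)] by simp
qed

lemma good_times:
  assumes "S \<le> a" "ereal b < T"
  obtains N where "negligible N"
    "\<And>t. t \<in> {a..b} - N \<Longrightarrow> (\<lambda>x. g (u t x)) \<in> L2_space \<Omega>"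
    "\<And>t z. t \<in> {a..b} - N \<Longrightarrow> z \<in> X0 \<Omega> \<sigma> \<Longrightarrow>
      L2_inner \<Omega> (W t) z = frac_lap \<sigma> (u t) z + L2_inner \<Omega> (\<lambda>x. g (u t x)) z"
proof -
  obtain N where N: "negligible N" "\<forall>t\<in>time_interval S T - N. (\<lambda>x. g (u t x)) \<in> L2_space \<Omega> \<and>
      (\<forall>z\<in>X0 \<Omega> \<sigma>. L2_inner \<Omega> (W t) z = frac_lap \<sigma> (u t) z + L2_inner \<Omega> (\<lambda>x. g (u t x)) z)"
    using W_eq unfolding AE_lebesgue_on_iff_negligible[OF time_interval_sets] by blast
  \<comment> \<open>The equations hold in the open time interval, while a may equal
    \<open>S\<close>.\<close>
  have "negligible (insert S N)" using N(1) by (simp add: negligible_insert)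
  moreover have "t \<in> time_interval S T - N" if "t \<in> {a..b} - insert S N" for t
    using that assms before_T[of t b] by (auto simp: time_interval_def)
  ultimately show ?thesis using that[of "insert S N"] N(2) by blast
qed

lemma W_lebesgue_point:
  assumes \<xi>: "strongly_measurable UNIV (X0 \<Omega> s) (X0_norm s) \<xi>"
  obtains N where "negligible N" "\<And>t. t \<in> {a<..<b} - N \<Longrightarrow>
    ((\<lambda>\<tau>. (integral {a..\<tau>} (\<lambda>r. frac_lap s (W r) (\<xi> t)) - integral {a..t} (\<lambda>r. frac_lap s (W r) (\<xi> t))) / (\<tau> - t))
      \<longlongrightarrow> frac_lap s (W t) (\<xi> t)) (at t)"
proof -
  have "\<exists>N. negligible N \<and> (\<forall>t\<in>{a<..<b} - N.
    ((\<lambda>\<tau>. integral {a..\<tau>} (\<lambda>r. frac_lap s (W r) (\<xi> t))) has_real_derivative frac_lap s (W t) (\<xi> t)) (at t))"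
    by (rule X.lebesgue_point[OF W \<xi>])
  then obtain N where N: "negligible N" and d: "\<And>t. t \<in> {a<..<b} - N \<Longrightarrow>
    ((\<lambda>\<tau>. integral {a..\<tau>} (\<lambda>r. frac_lap s (W r) (\<xi> t))) has_real_derivative frac_lap s (W t) (\<xi> t)) (at t)"
    by blast
  show ?thesis
    by (rule that[OF N d[unfolded has_field_derivative_iff]])
qed

text \<open>The interface for the two regularity hypotheses. \<open>dist\<close> bounds the
  semiconvexity error in the shape of \<open>R_bound\<close>; \<open>small\<close> says that this
  error vanishes to first order, so the derivative is not affected; \<open>strong\<close> feeds the
  lower semicontinuity.\<close>

theorem energy_identity:
  assumes a: "S \<le> a" "a < b" "ereal b < T"
    and strong: "\<And>x t. (\<And>n :: nat. x n \<in> {a..b}) \<Longrightarrow> t \<in> {a..b} \<Longrightarrow> x \<longlonglongrightarrow> t \<Longrightarrow>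
      (\<lambda>n. L2_norm \<Omega> (\<lambda>y. u (x n) y - u t y)) \<longlonglongrightarrow> 0"
    and m2: "m2 \<in> borel_measurable lebesgue" "integrable lebesgue (\<lambda>t. (m2 t)\<^sup>2)" "\<And>t. 0 \<le> m2 t"
    and p: "p integrable_on {a..b}" "\<And>t. 0 \<le> p t"
    and N2: "negligible N2"
    and dist: "\<And>t \<tau>. t \<in> {a..b} - N2 \<Longrightarrow> \<tau> \<in> {a..b} \<Longrightarrow> (L2_norm \<Omega> (\<lambda>y. u \<tau> y - u t y))\<^sup>2
      \<le> m2 t * integral {min t \<tau>..max t \<tau>} (\<lambda>r. X0_norm s (W r)) + integral {min t \<tau>..max t \<tau>} p"
    and small: "\<And>t. t \<in> {a<..<b} - N2 \<Longrightarrow>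
      ((\<lambda>\<tau>. (L2_norm \<Omega> (\<lambda>y. u \<tau> y - u t y))\<^sup>2 / (\<tau> - t)) \<longlongrightarrow> 0) (at t)"
  shows "\<And>t. t \<in> {a..b} \<Longrightarrow> fin_energy (u t)"
    and "real_energy (u b) - real_energy (u a) = - integral {a..b} (\<lambda>r. (X0_norm s (W r))\<^sup>2)"
proof -
  obtain N1 where N1: "negligible N1"
    "\<And>t. t \<in> {a..b} - N1 \<Longrightarrow> (\<lambda>x. g (u t x)) \<in> L2_space \<Omega>"
    "\<And>t z. t \<in> {a..b} - N1 \<Longrightarrow> z \<in> X0 \<Omega> \<sigma> \<Longrightarrow>
      L2_inner \<Omega> (W t) z = frac_lap \<sigma> (u t) z + L2_inner \<Omega> (\<lambda>x. g (u t x)) z"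
    by (rule good_times[OF a(1,3)]) blast
  obtain N3 where N3: "negligible N3" "\<And>t. t \<in> {a<..<b} - N3 \<Longrightarrow>
    ((\<lambda>\<tau>. (integral {a..\<tau>} (\<lambda>r. frac_lap s (W r) (W t)) - integral {a..t} (\<lambda>r. frac_lap s (W r) (W t))) / (\<tau> - t))
      \<longlongrightarrow> frac_lap s (W t) (W t)) (at t)"
    by (rule W_lebesgue_point[OF W(2), of a b]) (rule that)
  have uX: "u t \<in> X0 \<Omega> \<sigma>" if "t \<in> {a..b}" for t using that a before_T[OF _ a(3)] by (auto intro!: u_X0)
  have uL: "u t \<in> L2_space \<Omega>" if "t \<in> {a..b}" for t using that a before_T[OF _ a(3)] by (auto intro!: u_L2)
  have W_nonneg: "0 \<le> X0_norm s (W t)" for t by (rule X.nrm_nonneg[OF W(1)])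
  define R where "R t \<tau> = - (integral {a..\<tau>} (\<lambda>r. frac_lap s (W r) (W t)) - integral {a..t} (\<lambda>r. frac_lap s (W r) (W t)))
    - lam / 2 * (L2_norm \<Omega> (\<lambda>y. u \<tau> y - u t y))\<^sup>2" for t \<tau>
  \<comment> \<open>The slope collects the norm of W(t) from the pairing and the factor
    \<open>m2\<close> from the semiconvexity error. The factor \<open>1 *\<close> gives the sum the
    form of \<open>square_integrable_lin\<close>.\<close>
  interpret flow: subgradient_flow "\<lambda>t. real_energy (u t)" "\<lambda>t. - (X0_norm s (W t))\<^sup>2"
    "\<lambda>t. 1 * X0_norm s (W t) + lam / 2 * m2 t" "\<lambda>t. X0_norm s (W t)" "\<lambda>t. lam / 2 * p t" R
    "\<lambda>t. fin_energy (u t)" "N1 \<union> N2 \<union> N3" a b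
  proof
    show "a < b" by fact
    have "integrable lebesgue (\<lambda>r. (1 * X0_norm s (W r) + lam / 2 * m2 r)\<^sup>2)"
      using X.nrm_measurable[OF W(2)] m2 W(3) by (intro square_integrable_lin) auto
    then show "(\<lambda>r. (1 * X0_norm s (W r) + lam / 2 * m2 r)\<^sup>2) integrable_on {a..b}"
      by (rule integrable_lebesgue_imp_integrable_on)
    show "0 \<le> 1 * X0_norm s (W r) + lam / 2 * m2 r" for r using W_nonneg m2 lam by simp
    show "(\<lambda>t. X0_norm s (W t)) integrable_on {a..b}" by (rule W_norm_integrable)
    show "(\<lambda>r. (X0_norm s (W r))\<^sup>2) integrable_on {a..b}" by (rule integrable_lebesgue_imp_integrable_on[OF W(3)])
    show "0 \<le> X0_norm s (W r)" for r by (rule W_nonneg)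
    show "(\<lambda>t. lam / 2 * p t) integrable_on {a..b}" by (rule integrable_on_mult_right[OF p(1)])
    show "0 \<le> lam / 2 * p r" for r using lam p by simp
    have "integrable lebesgue (\<lambda>t. - (X0_norm s (W t))\<^sup>2)" using W(3) by simp
    then show "(\<lambda>t. - (X0_norm s (W t))\<^sup>2) absolutely_integrable_on {a..b}"
      by (rule integrable_lebesgue_imp_integrable_on)
    show "negligible (N1 \<union> N2 \<union> N3)" using N1(1) N2 N3(1) by (intro negligible_Un)
    show "fin_energy (u t)" if "t \<in> {a..b} - (N1 \<union> N2 \<union> N3)" for t
      using that by (intro fin_energy_of_L2 uL N1(2)) auto
    show "real_energy (u t) + R t \<tau> \<le> real_energy (u \<tau>)"
      if t: "t \<in> {a..b} - (N1 \<union> N2 \<union> N3)" and \<tau>: "\<tau> \<in> {a..b}" "fin_energy (u \<tau>)" for t \<tau>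
    proof -
      have "L2_inner \<Omega> (W t) (\<lambda>x. u \<tau> x - u t x) = - (integral {a..\<tau>} (\<lambda>r. frac_lap s (W r) (W t)) -
          integral {a..t} (\<lambda>r. frac_lap s (W r) (W t)))"
        using t \<tau> by (intro pairing_difference[OF W(1) a(1,3)]) auto
      moreover have "real_energy (u t) + L2_inner \<Omega> (W t) (\<lambda>x. u \<tau> x - u t x) -
          lam / 2 * (L2_norm \<Omega> (\<lambda>x. u \<tau> x - u t x))\<^sup>2 \<le> real_energy (u \<tau>)"
        using t \<tau> subsetD[OF X0_subset_L2_space W(1)] by (intro energy_subgradient uX N1(2,3)) auto
      ultimately show ?thesis by (simp add: R_def)
    qed
    show "\<bar>R t \<tau>\<bar> \<le> (1 * X0_norm s (W t) + lam / 2 * m2 t) * integral {min t \<tau>..max t \<tau>} (\<lambda>t. X0_norm s (W t)) +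
        integral {min t \<tau>..max t \<tau>} (\<lambda>t. lam / 2 * p t)"
      if t: "t \<in> {a..b} - (N1 \<union> N2 \<union> N3)" and \<tau>: "\<tau> \<in> {a..b}" for t \<tau>
    proof -
      have "lam / 2 * (L2_norm \<Omega> (\<lambda>y. u \<tau> y - u t y))\<^sup>2 \<le> lam / 2 * (m2 t * integral {min t \<tau>..max t \<tau>} (\<lambda>r. X0_norm s (W r))
          + integral {min t \<tau>..max t \<tau>} p)"
        using lam t \<tau> by (intro mult_left_mono dist) auto
      moreover have "0 \<le> lam / 2 * (L2_norm \<Omega> (\<lambda>y. u \<tau> y - u t y))\<^sup>2" using lam by simp
      moreover have "\<bar>integral {a..\<tau>} (\<lambda>r. frac_lap s (W r) (W t)) - integral {a..t} (\<lambda>r. frac_lap s (W r) (W t))\<bar>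
          \<le> X0_norm s (W t) * integral {min t \<tau>..max t \<tau>} (\<lambda>r. X0_norm s (W r))"
        using t \<tau> by (intro X.increment_bound W) auto
      ultimately have "\<bar>R t \<tau>\<bar> \<le> X0_norm s (W t) * integral {min t \<tau>..max t \<tau>} (\<lambda>r. X0_norm s (W r)) +
          lam / 2 * (m2 t * integral {min t \<tau>..max t \<tau>} (\<lambda>r. X0_norm s (W r)) + integral {min t \<tau>..max t \<tau>} p)"
        unfolding R_def by linarith
      then show ?thesis by (simp add: algebra_simps)
    qed
    show "((\<lambda>\<tau>. R t \<tau> / (\<tau> - t)) \<longlongrightarrow> - (X0_norm s (W t))\<^sup>2) (at t)" if t: "t \<in> {a<..<b} - (N1 \<union> N2 \<union> N3)" for t
    proof -
      have "((\<lambda>\<tau>. - ((integral {a..\<tau>} (\<lambda>r. frac_lap s (W r) (W t)) - integral {a..t} (\<lambda>r. frac_lap s (W r) (W t))) / (\<tau> - t))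
          - lam / 2 * ((L2_norm \<Omega> (\<lambda>y. u \<tau> y - u t y))\<^sup>2 / (\<tau> - t))) \<longlongrightarrow> - frac_lap s (W t) (W t) - lam / 2 * 0) (at t)"
        using t by (intro tendsto_diff tendsto_minus tendsto_mult tendsto_const N3(2) small) auto
      then show ?thesis by (simp add: R_def diff_divide_distrib X.nrm_sq[OF W(1)])
    qed
    show "fin_energy (u t) \<and> real_energy (u t) \<le> c'"
      if "t \<in> {a..b}" "\<And>n. x n \<in> {a..b}" "x \<longlonglongrightarrow> t" "\<And>n. fin_energy (u (x n))"
        "\<And>n. real_energy (u (x n)) \<le> c n" "c \<longlonglongrightarrow> c'" for t x c c'
      using that by (intro energy_lsc[where u="\<lambda>n. u (x n)" and c=c] uX strong) auto
  qed
  show "fin_energy (u t)" if "t \<in> {a..b}" for t by (rule flow.Fin_everywhere[OF that])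
  show "real_energy (u b) - real_energy (u a) = - integral {a..b} (\<lambda>r. (X0_norm s (W r))\<^sup>2)"
    using flow.integral_of_slope by simp
qed

end

section \<open>Quadratic smallness of increments from either regularity hypothesis\<close>

context cahn_hilliard_flow
begin

lemma W_nonneg: "0 \<le> X0_norm s (W t)"
  by (rule X.nrm_nonneg[OF W(1)])

text \<open>Weak convergence together with convergence of norms is strong convergence.\<close>

lemma L2_strong_continuity_of_norm:
  assumes a: "S \<le> a" "ereal b < T"
    and norm_cont: "continuous_on {a..b} (\<lambda>t. (L2_norm \<Omega> (u t))\<^sup>2)"
    and x: "\<And>n :: nat. x n \<in> {a..b}" "t \<in> {a..b}" "x \<longlonglongrightarrow> t"
  shows "(\<lambda>n. L2_norm \<Omega> (\<lambda>y. u (x n) y - u t y)) \<longlonglongrightarrow> 0"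
proof -
  have uL: "u r \<in> L2_space \<Omega>" if "r \<in> {a..b}" for r using that a before_T[OF _ a(2)] by (auto intro!: u_L2)
  have 1: "(\<lambda>n. (L2_norm \<Omega> (u (x n)))\<^sup>2) \<longlonglongrightarrow> (L2_norm \<Omega> (u t))\<^sup>2"
    using x by (intro continuous_on_tendsto_compose[OF norm_cont]) auto
  have 2: "(\<lambda>n. L2_inner \<Omega> (u (x n)) (u t)) \<longlonglongrightarrow> L2_inner \<Omega> (u t) (u t)"
    using x by (intro continuous_on_tendsto_compose[OF pairing_continuous[OF uL[OF x(2)] a]]) auto
  have "(\<lambda>n. (L2_norm \<Omega> (u (x n)))\<^sup>2 - 2 * L2_inner \<Omega> (u (x n)) (u t) + (L2_norm \<Omega> (u t))\<^sup>2) \<longlonglongrightarrow>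
      (L2_norm \<Omega> (u t))\<^sup>2 - 2 * L2_inner \<Omega> (u t) (u t) + (L2_norm \<Omega> (u t))\<^sup>2"
    by (intro tendsto_add tendsto_diff tendsto_mult tendsto_const 1 2)
  then have "(\<lambda>n. (L2_norm \<Omega> (\<lambda>y. u (x n) y - u t y))\<^sup>2) \<longlonglongrightarrow> 0"
    using L2.nrm_diff_sq[OF uL[OF x(1)] uL[OF x(2)]] L2.nrm_sq[OF uL[OF x(2)]] by simp
  from tendsto_real_sqrt[OF this] show ?thesis
    using L2.nrm_nonneg[OF L2.diff[OF uL[OF x(1)] uL[OF x(2)]]] by simp
qed

text \<open>If \<open>u(t) \<in> X0 \<Omega> s\<close> for almost all times, then \<open>u(t)\<close> is itself an admissible subgradient of the convex
  function \<open>|v|\<^sup>2/2\<close>.\<close>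

lemma L2_norm_identity:
  assumes a: "S \<le> a" "a < b" "ereal b < T"
    and U: "\<And>t. U t \<in> X0 \<Omega> s" "strongly_measurable UNIV (X0 \<Omega> s) (X0_norm s) U"
      "integrable lebesgue (\<lambda>t. (X0_norm s (U t))\<^sup>2)"
    and N: "negligible N" "\<And>t. t \<in> {a..b} - N \<Longrightarrow> U t = u t"
  shows "(L2_norm \<Omega> (u b))\<^sup>2 / 2 - (L2_norm \<Omega> (u a))\<^sup>2 / 2 = - integral {a..b} (\<lambda>r. frac_lap s (W r) (U r))"
proof -
  have uL: "u t \<in> L2_space \<Omega>" if "t \<in> {a..b}" for t using that a before_T[OF _ a(3)] by (auto intro!: u_L2)
  obtain N3 where N3: "negligible N3" "\<And>t. t \<in> {a<..<b} - N3 \<Longrightarrow>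
    ((\<lambda>\<tau>. (integral {a..\<tau>} (\<lambda>r. frac_lap s (W r) (U t)) - integral {a..t} (\<lambda>r. frac_lap s (W r) (U t))) / (\<tau> - t))
      \<longlongrightarrow> frac_lap s (W t) (U t)) (at t)"
    by (rule W_lebesgue_point[OF U(2), of a b]) (rule that)
  define R where "R t \<tau> = - (integral {a..\<tau>} (\<lambda>r. frac_lap s (W r) (U t)) - integral {a..t} (\<lambda>r. frac_lap s (W r) (U t)))"
    for t \<tau>
  have below: "(L2_norm \<Omega> v)\<^sup>2 / 2 + L2_inner \<Omega> v (\<lambda>x. z x - v x) \<le> (L2_norm \<Omega> z)\<^sup>2 / 2"
    if "v \<in> L2_space \<Omega>" "z \<in> L2_space \<Omega>" for v z
    using L2.nrm_diff_sq[OF that(2,1)] L2.ip_diff_right[OF that(2,1,1)] L2.nrm_sq[OF that(1)] L2.sym[OF that]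
      zero_le_power2[of "L2_norm \<Omega> (\<lambda>x. z x - v x)"] by simp
  interpret flow: subgradient_flow "\<lambda>t. (L2_norm \<Omega> (u t))\<^sup>2 / 2" "\<lambda>t. - frac_lap s (W t) (U t)"
    "\<lambda>t. X0_norm s (U t)" "\<lambda>t. X0_norm s (W t)" "\<lambda>_. 0" R "\<lambda>_. True" "N \<union> N3" a b
  proof
    show "a < b" by fact
    show "(\<lambda>r. (X0_norm s (U r))\<^sup>2) integrable_on {a..b}" by (rule integrable_lebesgue_imp_integrable_on[OF U(3)])
    show "0 \<le> X0_norm s (U r)" for r by (rule X.nrm_nonneg[OF U(1)])
    show "(\<lambda>t. X0_norm s (W t)) integrable_on {a..b}" by (rule W_norm_integrable)
    show "(\<lambda>r. (X0_norm s (W r))\<^sup>2) integrable_on {a..b}" by (rule integrable_lebesgue_imp_integrable_on[OF W(3)])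
    show "0 \<le> X0_norm s (W r)" for r by (rule W_nonneg)
    have "integrable lebesgue (\<lambda>t. - frac_lap s (W t) (U t))" using X.nrm_ip_integrable[OF W U] by simp
    then show "(\<lambda>t. - frac_lap s (W t) (U t)) absolutely_integrable_on {a..b}"
      by (rule integrable_lebesgue_imp_integrable_on)
    show "negligible (N \<union> N3)" using N(1) N3(1) by (rule negligible_Un)
    show "(L2_norm \<Omega> (u t))\<^sup>2 / 2 + R t \<tau> \<le> (L2_norm \<Omega> (u \<tau>))\<^sup>2 / 2"
      if t: "t \<in> {a..b} - (N \<union> N3)" and \<tau>: "\<tau> \<in> {a..b}" for t \<tau>
    proof -
      have "L2_inner \<Omega> (U t) (\<lambda>x. u \<tau> x - u t x) = R t \<tau>"
        unfolding R_def using t \<tau> by (intro pairing_difference[OF U(1) a(1,3)]) auto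
      then show ?thesis using below[OF uL uL, of t \<tau>] N(2)[of t] t \<tau> by auto
    qed
    show "\<bar>R t \<tau>\<bar> \<le> X0_norm s (U t) * integral {min t \<tau>..max t \<tau>} (\<lambda>t. X0_norm s (W t)) +
        integral {min t \<tau>..max t \<tau>} (\<lambda>_. 0)"
      if t: "t \<in> {a..b} - (N \<union> N3)" and \<tau>: "\<tau> \<in> {a..b}" for t \<tau>
    proof -
      have "\<bar>R t \<tau>\<bar> \<le> X0_norm s (U t) * integral {min t \<tau>..max t \<tau>} (\<lambda>t. X0_norm s (W t))"
        unfolding R_def abs_minus_cancel using t \<tau> by (intro X.increment_bound[OF W U(1)]) auto
      then show ?thesis by simp
    qed
    show "((\<lambda>\<tau>. R t \<tau> / (\<tau> - t)) \<longlongrightarrow> - frac_lap s (W t) (U t)) (at t)" if t: "t \<in> {a<..<b} - (N \<union> N3)" for t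
    proof -
      have "t \<in> {a<..<b} - N3" using t by simp
      from tendsto_minus[OF N3(2)[OF this]] show ?thesis unfolding R_def by (simp only: minus_divide_left)
    qed
    show "True \<and> (L2_norm \<Omega> (u t))\<^sup>2 / 2 \<le> c'"
      if "t \<in> {a..b}" "\<And>n. x n \<in> {a..b}" "x \<longlonglongrightarrow> t" "\<And>n. True"
        "\<And>n. (L2_norm \<Omega> (u (x n)))\<^sup>2 / 2 \<le> c n" "c \<longlonglongrightarrow> c'" for t x c c'
    proof -
      \<comment> \<open>Lower semicontinuity of the norm uses only weak continuity: the convexity
        inequality \<open>below\<close> at u(t) has a linear term that tends to 0.\<close>
      have "(\<lambda>n. c n - (L2_inner \<Omega> (u (x n)) (u t) - L2_inner \<Omega> (u t) (u t))) \<longlonglongrightarrow>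
          c' - (L2_inner \<Omega> (u t) (u t) - L2_inner \<Omega> (u t) (u t))"
        using that(1-3) by (intro tendsto_diff that(6) tendsto_const
          continuous_on_tendsto_compose[OF pairing_continuous[OF uL[OF that(1)] a(1,3)]]) auto
      then have lim: "(\<lambda>n. c n - (L2_inner \<Omega> (u (x n)) (u t) - L2_inner \<Omega> (u t) (u t))) \<longlonglongrightarrow> c'" by simp
      have "(L2_norm \<Omega> (u t))\<^sup>2 / 2 \<le> c n - (L2_inner \<Omega> (u (x n)) (u t) - L2_inner \<Omega> (u t) (u t))" for n
        using below[OF uL[OF that(1)] uL[OF that(2)], of n] that(5)[of n]
          L2.ip_diff_right[OF uL[OF that(2)] uL[OF that(1)] uL[OF that(1)], of n]
          L2.sym[OF uL[OF that(1)] uL[OF that(2)], of n] by simp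
      then show ?thesis by (intro conjI TrueI LIMSEQ_le_const[OF lim] exI allI impI)
    qed
    show "(\<lambda>_. 0 :: real) integrable_on {a..b}" by (rule Henstock_Kurzweil_Integration.integrable_0)
    show "(0 :: real) \<le> 0" True by simp_all
  qed
  show ?thesis using flow.integral_of_slope by simp
qed

text \<open>Expanding |u(\<tau>) - u(t)|^2 gives the increment of |u|^2 minus twice the pairing of
  u(t) with the increment of u. At common Lebesgue points both pieces have derivatives that cancel,
  so the square is of smaller order than \<tau> - t.\<close>

lemma energy_identity_regular_u:
  assumes a: "S \<le> a" "a < b" "ereal b < T"
    and U: "\<And>t. U t \<in> X0 \<Omega> s" "strongly_measurable UNIV (X0 \<Omega> s) (X0_norm s) U"
      "integrable lebesgue (\<lambda>t. (X0_norm s (U t))\<^sup>2)"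
    and N: "negligible N" "\<And>t. t \<in> {a..b} - N \<Longrightarrow> U t = u t"
  shows "\<And>t. t \<in> {a..b} \<Longrightarrow> fin_energy (u t)"
    and "real_energy (u b) - real_energy (u a) = - integral {a..b} (\<lambda>r. (X0_norm s (W r))\<^sup>2)"
proof -
  let ?p = "\<lambda>r. frac_lap s (W r) (U r)"
  have uL: "u t \<in> L2_space \<Omega>" if "t \<in> {a..b}" for t using that a before_T[OF _ a(3)] by (auto intro!: u_L2)
  have p: "integrable lebesgue ?p" by (rule X.nrm_ip_integrable[OF W U])
  have pi: "?p integrable_on {c..d}" for c d by (rule integrable_lebesgue_imp_integrable_on[OF p])
  have norm_id: "(L2_norm \<Omega> (u t))\<^sup>2 = (L2_norm \<Omega> (u a))\<^sup>2 - 2 * integral {a..t} ?p" if "t \<in> {a..b}" for t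
  proof (cases "a = t")
    case False
    then have "a < t" "ereal t < T" using that before_T[OF _ a(3)] by auto
    from L2_norm_identity[OF a(1) this U N(1)] N(2) that show ?thesis by simp
  qed simp
  have cont: "continuous_on {a..b} (\<lambda>t. (L2_norm \<Omega> (u t))\<^sup>2)"
  proof (rule continuous_on_eq)
    show "continuous_on {a..b} (\<lambda>t. (L2_norm \<Omega> (u a))\<^sup>2 - 2 * integral {a..t} ?p)"
      by (intro continuous_intros indefinite_integral_continuous_1[OF pi])
  qed (rule norm_id[symmetric])
  obtain N3 where N3: "negligible N3" "\<And>t. t \<in> {a<..<b} - N3 \<Longrightarrow>
    ((\<lambda>\<tau>. (integral {a..\<tau>} (\<lambda>r. frac_lap s (W r) (U t)) - integral {a..t} (\<lambda>r. frac_lap s (W r) (U t))) / (\<tau> - t))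
      \<longlongrightarrow> frac_lap s (W t) (U t)) (at t)"
    by (rule W_lebesgue_point[OF U(2), of a b]) (rule that)
  obtain N4 where N4: "negligible N4" "\<And>t. t \<in> {a<..<b} - N4 \<Longrightarrow>
      ((\<lambda>t. integral {a..t} ?p) has_real_derivative ?p t) (at t)"
    by (rule lebesgue_differentiation[OF pi, of a b]) (rule that)
  \<comment> \<open>The first term is the norm identity between t and \<tau>, the second the
    equation tested with the fixed element U(t). Absolute values give the densities
    \<open>2 * X0_norm s (U t)\<close> and twice the modulus of \<open>?p\<close>.\<close>
  have expand: "(L2_norm \<Omega> (\<lambda>y. u \<tau> y - u t y))\<^sup>2 = - 2 * (integral {a..\<tau>} ?p - integral {a..t} ?p) +
      2 * (integral {a..\<tau>} (\<lambda>r. frac_lap s (W r) (U t)) - integral {a..t} (\<lambda>r. frac_lap s (W r) (U t)))"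
    if t: "t \<in> {a..b} - N" and \<tau>: "\<tau> \<in> {a..b}" for t \<tau>
  proof -
    have tab: "t \<in> {a..b}" using t by simp
    have "L2_inner \<Omega> (u t) (\<lambda>x. u \<tau> x - u t x) =
      - (integral {a..\<tau>} (\<lambda>r. frac_lap s (W r) (U t)) - integral {a..t} (\<lambda>r. frac_lap s (W r) (U t)))"
      using pairing_difference[OF U(1)[of t] a(1,3) tab \<tau>] N(2)[OF t] by simp
    moreover have "L2_inner \<Omega> (u t) (\<lambda>x. u \<tau> x - u t x) = L2_inner \<Omega> (u \<tau>) (u t) - (L2_norm \<Omega> (u t))\<^sup>2"
      using L2.ip_diff_right[OF uL[OF \<tau>] uL[OF tab] uL[OF tab]] L2.nrm_sq[OF uL[OF tab]]
        L2.sym[OF uL[OF tab] uL[OF \<tau>]] by simp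
    ultimately show ?thesis
      using L2.nrm_diff_sq[OF uL[OF \<tau>] uL[OF tab]] norm_id[OF tab] norm_id[OF \<tau>] by simp
  qed
  have strong: "(\<lambda>n. L2_norm \<Omega> (\<lambda>y. u (x n) y - u t y)) \<longlonglongrightarrow> 0"
    if "\<And>n :: nat. x n \<in> {a..b}" "t \<in> {a..b}" "x \<longlonglongrightarrow> t" for x t
    by (rule L2_strong_continuity_of_norm[OF a(1,3) cont that])
  have m2: "(\<lambda>t. 2 * X0_norm s (U t)) \<in> borel_measurable lebesgue"
    "integrable lebesgue (\<lambda>t. (2 * X0_norm s (U t))\<^sup>2)" "0 \<le> 2 * X0_norm s (U t)" for t
    using X.nrm_measurable[OF U(2)] U(3) X.nrm_nonneg[OF U(1)] by (simp_all add: power_mult_distrib)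
  have "integrable lebesgue (\<lambda>r. \<bar>?p r\<bar>)" using p by simp
  from integrable_lebesgue_imp_integrable_on(2)[OF this]
  have abs_pi: "(\<lambda>r. \<bar>?p r\<bar>) integrable_on {c..d}" for c d .
  have p2: "(\<lambda>r. 2 * \<bar>?p r\<bar>) integrable_on {a..b}" by (rule integrable_on_mult_right[OF abs_pi])
  have N_neg: "negligible (N \<union> N3 \<union> N4)" using N(1) N3(1) N4(1) by (intro negligible_Un)
  have bound: "(L2_norm \<Omega> (\<lambda>y. u \<tau> y - u t y))\<^sup>2 \<le> 2 * X0_norm s (U t) *
      integral {min t \<tau>..max t \<tau>} (\<lambda>r. X0_norm s (W r)) + integral {min t \<tau>..max t \<tau>} (\<lambda>r. 2 * \<bar>?p r\<bar>)"
    if t: "t \<in> {a..b} - (N \<union> N3 \<union> N4)" and \<tau>: "\<tau> \<in> {a..b}" for t \<tau>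
  proof -
    have "\<bar>integral {a..\<tau>} ?p - integral {a..t} ?p\<bar> \<le> integral {min t \<tau>..max t \<tau>} (\<lambda>r. \<bar>?p r\<bar>)"
      using t \<tau> by (intro abs_integral_diff_le[OF pi abs_pi]) auto
    moreover have "\<bar>integral {a..\<tau>} (\<lambda>r. frac_lap s (W r) (U t)) - integral {a..t} (\<lambda>r. frac_lap s (W r) (U t))\<bar>
        \<le> X0_norm s (U t) * integral {min t \<tau>..max t \<tau>} (\<lambda>r. X0_norm s (W r))"
      using t \<tau> by (intro X.increment_bound[OF W U(1)]) auto
    moreover have "integral {min t \<tau>..max t \<tau>} (\<lambda>r. 2 * \<bar>?p r\<bar>) = 2 * integral {min t \<tau>..max t \<tau>} (\<lambda>r. \<bar>?p r\<bar>)"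
      by simp
    moreover have "\<bar>x\<bar> \<le> P \<Longrightarrow> \<bar>y\<bar> \<le> k * I \<Longrightarrow> J = 2 * P \<Longrightarrow> - 2 * x + 2 * y \<le> 2 * k * I + J"
      for x y k P I J :: real by (simp add: abs_le_iff)
    moreover have "t \<in> {a..b} - N" using t by simp
    ultimately show ?thesis unfolding expand[OF \<open>t \<in> {a..b} - N\<close> \<tau>] by blast
  qed
  have small: "((\<lambda>\<tau>. (L2_norm \<Omega> (\<lambda>y. u \<tau> y - u t y))\<^sup>2 / (\<tau> - t)) \<longlongrightarrow> 0) (at t)"
    if t: "t \<in> {a<..<b} - (N \<union> N3 \<union> N4)" for t
  proof (rule Lim_transform_eventually)
    have "((\<lambda>\<tau>. - 2 * ((integral {a..\<tau>} ?p - integral {a..t} ?p) / (\<tau> - t)) +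
      2 * ((integral {a..\<tau>} (\<lambda>r. frac_lap s (W r) (U t)) - integral {a..t} (\<lambda>r. frac_lap s (W r) (U t))) / (\<tau> - t)))
      \<longlongrightarrow> - 2 * ?p t + 2 * ?p t) (at t)"
      using t N4(2)[of t, unfolded has_field_derivative_iff]
      by (intro tendsto_add tendsto_mult tendsto_const N3(2)) auto
    then show "((\<lambda>\<tau>. - 2 * ((integral {a..\<tau>} ?p - integral {a..t} ?p) / (\<tau> - t)) +
      2 * ((integral {a..\<tau>} (\<lambda>r. frac_lap s (W r) (U t)) - integral {a..t} (\<lambda>r. frac_lap s (W r) (U t))) / (\<tau> - t)))
      \<longlongrightarrow> 0) (at t)" by simp
    have "\<forall>\<^sub>F \<tau> in at t. \<tau> \<in> {a<..<b}" using t by (intro eventually_at_in_open') auto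
    then show "\<forall>\<^sub>F \<tau> in at t. - 2 * ((integral {a..\<tau>} ?p - integral {a..t} ?p) / (\<tau> - t)) +
      2 * ((integral {a..\<tau>} (\<lambda>r. frac_lap s (W r) (U t)) - integral {a..t} (\<lambda>r. frac_lap s (W r) (U t))) / (\<tau> - t))
      = (L2_norm \<Omega> (\<lambda>y. u \<tau> y - u t y))\<^sup>2 / (\<tau> - t)"
    proof eventually_elim
      case (elim \<tau>)
      then show ?case using expand[of t \<tau>] t by (simp add: add_divide_distrib)
    qed
  qed
  show "fin_energy (u t)" if "t \<in> {a..b}" for t
    by (rule energy_identity(1)[OF a strong m2 p2 _ N_neg bound small that]) simp_all
  show "real_energy (u b) - real_energy (u a) = - integral {a..b} (\<lambda>r. (X0_norm s (W r))\<^sup>2)"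
    by (rule energy_identity(2)[OF a strong m2 p2 _ N_neg bound small]) simp_all
qed

text \<open>By density of \<open>X0 \<Omega> s\<close> in \<open>L\<^sup>2(\<Omega>)\<close> the increments of \<open>u\<close> are controlled in \<open>L\<^sup>2(\<Omega>)\<close>, not only in the
  dual of \<open>X0 \<Omega> s\<close>.\<close>

lemma L2_increment_bound:
  assumes a: "S \<le> a" "a \<le> b" "ereal b < T"
    and H: "\<And>t. H t \<in> L2_space \<Omega>" "strongly_measurable UNIV (L2_space \<Omega>) (L2_norm \<Omega>) H"
      "integrable lebesgue (\<lambda>t. (L2_norm \<Omega> (H t))\<^sup>2)"
    and N: "negligible N" "\<And>t z. t \<in> {a..b} - N \<Longrightarrow> z \<in> X0 \<Omega> s \<Longrightarrow> - frac_lap s (W t) z = L2_inner \<Omega> (H t) z"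
  shows "L2_norm \<Omega> (\<lambda>y. u b y - u a y) \<le> integral {a..b} (\<lambda>r. L2_norm \<Omega> (H r))"
proof -
  have Hi: "(\<lambda>r. L2_norm \<Omega> (H r)) integrable_on {a..b}"
    using L2.locally_integrable(1)[OF H] by (rule set_lebesgue_integral_eq_integral)
  have uL: "u a \<in> L2_space \<Omega>" "u b \<in> L2_space \<Omega>" using a before_T[OF _ a(3)] by (auto intro!: u_L2)
  show ?thesis
  proof (rule L2_norm_le_of_X0_pairing[OF s \<Omega> L2.diff[OF uL(2,1)]])
    show "0 \<le> integral {a..b} (\<lambda>r. L2_norm \<Omega> (H r))"
      by (rule Henstock_Kurzweil_Integration.integral_nonneg[OF Hi]) (rule L2.nrm_nonneg[OF H(1)])
    fix z assume z: "z \<in> X0 \<Omega> s"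
    then have zL: "z \<in> L2_space \<Omega>" using X0_subset_L2_space by blast
    have "L2_inner \<Omega> (\<lambda>y. u b y - u a y) z = - integral {a..b} (\<lambda>r. frac_lap s (W r) z)"
      using pairing_increment[OF z a] L2.ip_diff_left[OF uL(2,1) zL] by simp
    also have "\<dots> = integral {a..b} (\<lambda>r. - frac_lap s (W r) z)" by simp
    also have "\<dots> = integral {a..b} (\<lambda>r. L2_inner \<Omega> (H r) z)"
      by (rule integral_spike[OF N(1)]) (use N(2)[OF _ z] in auto)
    finally have "\<bar>L2_inner \<Omega> (\<lambda>y. u b y - u a y) z\<bar> = norm (integral {a..b} (\<lambda>r. L2_inner \<Omega> (H r) z))" by simp
    also have "\<dots> \<le> integral {a..b} (\<lambda>r. L2_norm \<Omega> (H r) * L2_norm \<Omega> z)"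
    proof (rule integral_norm_bound_integral)
      show "(\<lambda>r. L2_inner \<Omega> (H r) z) integrable_on {a..b}"
        using L2.locally_integrable(2)[OF H zL] by (rule set_lebesgue_integral_eq_integral)
      show "(\<lambda>r. L2_norm \<Omega> (H r) * L2_norm \<Omega> z) integrable_on {a..b}" by (rule integrable_on_mult_left[OF Hi])
      show "norm (L2_inner \<Omega> (H r) z) \<le> L2_norm \<Omega> (H r) * L2_norm \<Omega> z" for r
        using L2.Cauchy_Schwarz[OF H(1) zL] by simp
    qed
    finally show "\<bar>L2_inner \<Omega> (\<lambda>y. u b y - u a y) z\<bar> \<le> integral {a..b} (\<lambda>r. L2_norm \<Omega> (H r)) * L2_norm \<Omega> z"
      by simp
  qed
qed

text \<open>Here u moves in L2 at most as fast as the indefinite integral \<open>c\<close> of the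
  norm of its derivative. One factor of the squared increment is a bounded difference quotient near
  Lebesgue points, the other tends to 0.\<close>

lemma energy_identity_regular_u':
  assumes a: "S \<le> a" "a < b" "ereal b < T"
    and H: "\<And>t. H t \<in> L2_space \<Omega>" "strongly_measurable UNIV (L2_space \<Omega>) (L2_norm \<Omega>) H"
      "integrable lebesgue (\<lambda>t. (L2_norm \<Omega> (H t))\<^sup>2)"
    and N: "negligible N" "\<And>t z. t \<in> {a..b} - N \<Longrightarrow> z \<in> X0 \<Omega> s \<Longrightarrow> - frac_lap s (W t) z = L2_inner \<Omega> (H t) z"
  shows "\<And>t. t \<in> {a..b} \<Longrightarrow> fin_energy (u t)"
    and "real_energy (u b) - real_energy (u a) = - integral {a..b} (\<lambda>r. (X0_norm s (W r))\<^sup>2)"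
proof -
  let ?n = "\<lambda>r. L2_norm \<Omega> (H r)"
  define c where "c y = integral {a..y} ?n" for y
  have Hi: "?n integrable_on {x..y}" for x y
    using L2.locally_integrable(1)[OF H] by (rule set_lebesgue_integral_eq_integral)
  have n0: "0 \<le> ?n r" for r by (rule L2.nrm_nonneg[OF H(1)])
  have uL: "u t \<in> L2_space \<Omega>" if "t \<in> {a..b}" for t using that a before_T[OF _ a(3)] by (auto intro!: u_L2)
  have c_abs: "\<bar>c \<tau> - c t\<bar> = integral {min t \<tau>..max t \<tau>} ?n" if "t \<in> {a..b}" "\<tau> \<in> {a..b}" for t \<tau>
    unfolding c_def by (rule integral_min_max_eq_abs[OF Hi n0 that, symmetric])
  have le: "L2_norm \<Omega> (\<lambda>y. u \<tau> y - u t y) \<le> \<bar>c \<tau> - c t\<bar>" if t: "t \<in> {a..b}" and \<tau>: "\<tau> \<in> {a..b}" for t \<tau>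
  proof -
    have *: "L2_norm \<Omega> (\<lambda>y. u y' y - u x' y) \<le> \<bar>c y' - c x'\<bar>" if "a \<le> x'" "x' \<le> y'" "y' \<le> b" for x' y'
      using L2_increment_bound[OF _ that(2) before_T[OF that(3) a(3)] H N(1)] N(2) that a c_abs[of x' y'] by simp
    show ?thesis
    proof (cases "t \<le> \<tau>")
      case False
      have "(L2_norm \<Omega> (\<lambda>y. u \<tau> y - u t y))\<^sup>2 = (L2_norm \<Omega> (\<lambda>y. u t y - u \<tau> y))\<^sup>2"
        using L2.nrm_diff_sq[OF uL[OF t] uL[OF \<tau>]] L2.nrm_diff_sq[OF uL[OF \<tau>] uL[OF t]] L2.sym[OF uL[OF t] uL[OF \<tau>]]
        by simp
      then have "L2_norm \<Omega> (\<lambda>y. u \<tau> y - u t y) = L2_norm \<Omega> (\<lambda>y. u t y - u \<tau> y)"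
        using L2.nrm_nonneg[OF L2.diff[OF uL[OF t] uL[OF \<tau>]]] L2.nrm_nonneg[OF L2.diff[OF uL[OF \<tau>] uL[OF t]]]
        by (simp add: power2_eq_iff_nonneg)
      then show ?thesis using *[of \<tau> t] False t \<tau> by (simp add: abs_minus_commute)
    qed (use *[of t \<tau>] t \<tau> in auto)
  qed
  have cc: "continuous_on {a..b} c"
    unfolding c_def by (rule indefinite_integral_continuous_1[OF Hi])
  have strong: "(\<lambda>n. L2_norm \<Omega> (\<lambda>y. u (x n) y - u t y)) \<longlonglongrightarrow> 0"
    if x: "\<And>n :: nat. x n \<in> {a..b}" "t \<in> {a..b}" "x \<longlonglongrightarrow> t" for x t
  proof (rule tendsto_sandwich[of "\<lambda>_. 0" _ _ "\<lambda>n. \<bar>c (x n) - c t\<bar>"])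
    have "(\<lambda>n. c (x n)) \<longlonglongrightarrow> c t"
      using x by (intro continuous_on_tendsto_compose[OF cc]) auto
    then show "(\<lambda>n. \<bar>c (x n) - c t\<bar>) \<longlonglongrightarrow> 0" by (simp add: LIM_zero tendsto_rabs_zero)
    show "\<forall>\<^sub>F n in sequentially. 0 \<le> L2_norm \<Omega> (\<lambda>y. u (x n) y - u t y)"
      using L2.nrm_nonneg[OF L2.diff[OF uL[OF x(1)] uL[OF x(2)]]] by simp
    show "\<forall>\<^sub>F n in sequentially. L2_norm \<Omega> (\<lambda>y. u (x n) y - u t y) \<le> \<bar>c (x n) - c t\<bar>"
      using le[OF x(2,1)] by simp
  qed simp
  have c_eq: "c = (\<lambda>y. integral {a..y} ?n)" by (simp add: c_def fun_eq_iff)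
  obtain N4 where N4: "negligible N4" and c_deriv: "\<And>t. t \<in> {a<..<b} - N4 \<Longrightarrow>
      ((\<lambda>y. integral {a..y} ?n) has_real_derivative ?n t) (at t)"
    by (rule lebesgue_differentiation[OF Hi, of a b]) (rule that)
  note c_deriv = c_deriv[folded c_eq]
  \<comment> \<open>\<open>K\<close> bounds one factor of the squared increment, so the square is
    dominated by an integral alone and the slope factor \<open>m2\<close> can be 0.\<close>
  define K where "K = integral {a..b} ?n"
  have K0: "0 \<le> K" unfolding K_def by (rule Henstock_Kurzweil_Integration.integral_nonneg[OF Hi n0])
  have nrm0: "0 \<le> L2_norm \<Omega> (\<lambda>y. u \<tau> y - u t y)" if "t \<in> {a..b}" "\<tau> \<in> {a..b}" for t \<tau>
    using L2.nrm_nonneg[OF L2.diff[OF uL[OF that(2)] uL[OF that(1)]]] .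
  have sq_le: "(L2_norm \<Omega> (\<lambda>y. u \<tau> y - u t y))\<^sup>2 \<le> \<bar>c \<tau> - c t\<bar>\<^sup>2" if "t \<in> {a..b}" "\<tau> \<in> {a..b}" for t \<tau>
    using le[OF that] nrm0[OF that] by (rule power_mono)
  have bound: "(L2_norm \<Omega> (\<lambda>y. u \<tau> y - u t y))\<^sup>2 \<le> 0 *
      integral {min t \<tau>..max t \<tau>} (\<lambda>r. X0_norm s (W r)) + integral {min t \<tau>..max t \<tau>} (\<lambda>r. K * ?n r)"
    if t: "t \<in> {a..b} - N4" and \<tau>: "\<tau> \<in> {a..b}" for t \<tau>
  proof -
    have "\<bar>c \<tau> - c t\<bar> \<le> K"
      unfolding K_def using t \<tau> n0 by (subst c_abs) (auto intro!: integral_subset_le Hi)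
    then have "\<bar>c \<tau> - c t\<bar> * \<bar>c \<tau> - c t\<bar> \<le> K * \<bar>c \<tau> - c t\<bar>" by (intro mult_right_mono) auto
    then have "\<bar>c \<tau> - c t\<bar>\<^sup>2 \<le> K * \<bar>c \<tau> - c t\<bar>" by (simp only: power2_eq_square)
    also have "\<dots> = integral {min t \<tau>..max t \<tau>} (\<lambda>r. K * ?n r)" using t \<tau> by (subst c_abs) auto
    finally show ?thesis using sq_le[of t \<tau>] t \<tau> by auto
  qed
  have small: "((\<lambda>\<tau>. (L2_norm \<Omega> (\<lambda>y. u \<tau> y - u t y))\<^sup>2 / (\<tau> - t)) \<longlongrightarrow> 0) (at t)"
    if t: "t \<in> {a<..<b} - N4" for t
  proof (rule Lim_null_comparison)
    have "((\<lambda>\<tau>. (c \<tau> - c t) / (\<tau> - t)) \<longlongrightarrow> ?n t) (at t)"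
      using c_deriv[OF t] by (simp add: has_field_derivative_iff)
    moreover have "(c \<longlongrightarrow> c t) (at t)" using c_deriv[OF t] DERIV_isCont isCont_def by blast
    then have "((\<lambda>\<tau>. c \<tau> - c t) \<longlongrightarrow> 0) (at t)" by (simp add: LIM_zero)
    ultimately have "((\<lambda>\<tau>. \<bar>(c \<tau> - c t) / (\<tau> - t)\<bar> * \<bar>c \<tau> - c t\<bar>) \<longlongrightarrow> \<bar>?n t\<bar> * \<bar>0\<bar>) (at t)"
      by (intro tendsto_mult tendsto_rabs)
    then show "((\<lambda>\<tau>. \<bar>(c \<tau> - c t) / (\<tau> - t)\<bar> * \<bar>c \<tau> - c t\<bar>) \<longlongrightarrow> 0) (at t)" by simp
    have "\<forall>\<^sub>F \<tau> in at t. \<tau> \<in> {a<..<b}" using t by (intro eventually_at_in_open') auto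
    then show "\<forall>\<^sub>F \<tau> in at t. norm ((L2_norm \<Omega> (\<lambda>y. u \<tau> y - u t y))\<^sup>2 / (\<tau> - t)) \<le> \<bar>(c \<tau> - c t) / (\<tau> - t)\<bar> * \<bar>c \<tau> - c t\<bar>"
    proof eventually_elim
      case (elim \<tau>)
      have "(L2_norm \<Omega> (\<lambda>y. u \<tau> y - u t y))\<^sup>2 / \<bar>\<tau> - t\<bar> \<le> \<bar>c \<tau> - c t\<bar>\<^sup>2 / \<bar>\<tau> - t\<bar>"
        using sq_le[of t \<tau>] t elim by (intro divide_right_mono) auto
      then show ?case by (simp add: power2_eq_square abs_mult)
    qed
  qed
  have Kn: "(\<lambda>r. K * ?n r) integrable_on {a..b}" "0 \<le> K * ?n r" for r
    using K0 n0 by (auto intro: integrable_on_mult_right[OF Hi])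
  show "fin_energy (u t)" if "t \<in> {a..b}" for t
    by (rule energy_identity(1)[where ?m2.0="\<lambda>_. 0", OF a strong _ _ _ Kn N4 bound small that]) simp_all
  show "real_energy (u b) - real_energy (u a) = - integral {a..b} (\<lambda>r. (X0_norm s (W r))\<^sup>2)"
    by (rule energy_identity(2)[where ?m2.0="\<lambda>_. 0", OF a strong _ _ _ Kn N4 bound small]) simp_all
qed

end

section \<open>Local integrability in time and assembly of the theorem\<close>

lemma bochner_L2_loc_interval:
  assumes f: "bochner_L2_loc S T V nrm f" and b: "S < b" "ereal b < T"
  obtains J where "J \<in> sets lebesgue" "{S<..b} \<subseteq> J" "J \<subseteq> time_interval S T" "bochner_L2 J V nrm f"
proof (cases "T = \<infinity>")
  case True
  show ?thesis
    \<comment> \<open>For infinite T the definition provides open intervals; the extra unit length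
      makes b an interior point.\<close>
    by (rule that[of "{S<..<b + 1}"])
      (use f b True in \<open>auto simp: bochner_L2_loc_def time_interval_def\<close>)
next
  case False
  have "{S<..b} \<subseteq> time_interval S T"
    using b by (auto simp: time_interval_def) (metis ereal_less_eq(3) le_less_trans)
  then show ?thesis
    using f False that[OF time_interval_sets] by (auto simp: bochner_L2_loc_def)
qed

text \<open>For infinite T the time axis is exhausted by countably many bounded intervals.\<close>

lemma bochner_L2_loc_AE:
  assumes f: "bochner_L2_loc S T V nrm f"
  shows "AE t in lebesgue_on (time_interval S T). f t \<in> V"
proof (cases "T = \<infinity>")
  case True
  have "\<exists>N. negligible N \<and> (\<forall>t\<in>{S<..<S + real (Suc k)} - N. f t \<in> V)" for k
  proof -
    have "AE t in lebesgue_on {S<..<S + real (Suc k)}. f t \<in> V"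
      using f True by (auto simp: bochner_L2_loc_def bochner_L2_def strongly_measurable_def)
    then show ?thesis by (subst (asm) AE_lebesgue_on_iff_negligible) auto
  qed
  then obtain N where N: "\<And>k. negligible (N k)" "\<And>k t. t \<in> {S<..<S + real (Suc k)} - N k \<Longrightarrow> f t \<in> V" by metis
  have "f t \<in> V" if t: "t \<in> time_interval S T - (\<Union>k. N k)" for t
  proof -
    obtain k :: nat where "t - S < real k" using reals_Archimedean2 by blast
    then show ?thesis using N(2)[of t k] t by (auto simp: time_interval_def)
  qed
  moreover have "negligible (\<Union>k. N k)" using N(1) by (rule negligible_Union_nat)
  ultimately show ?thesis unfolding AE_lebesgue_on_iff_negligible[OF time_interval_sets] by blast
next
  case False
  then show ?thesis using f by (auto simp: bochner_L2_loc_def bochner_L2_def strongly_measurable_def)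
qed

theorem theorem3:
  fixes \<Omega> :: "'a::euclidean_space set"
    and s \<sigma> lam \<kappa> S :: real and T :: ereal
    and g gh \<beta> \<beta>h :: "real \<Rightarrow> real"
    and u0 :: "'a \<Rightarrow> real"
    and u w :: "real \<Rightarrow> 'a \<Rightarrow> real"
    and u' :: "real \<Rightarrow> ('a \<Rightarrow> real) \<Rightarrow> real"
  assumes "smooth_bounded_domain \<Omega>"
    and "0 < s" "s < 1" "0 < \<sigma>" "\<sigma> < 1"
    and "\<And>r. g differentiable (at r)" "continuous_on UNIV (deriv g)" "g 0 = 0"
    and "0 \<le> lam" "\<And>r. deriv g r \<ge> - lam"
    and "0 < \<kappa>"
        "Liminf at_infinity (\<lambda>r. ereal (g r * r + (lambda_1 \<Omega> \<sigma> - \<kappa>) * r\<^sup>2)) > 0"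
    and "\<And>r. (gh has_real_derivative g r) (at r)"
    and "\<And>r. \<beta> r = g r + lam * r"
    and "\<And>r. (\<beta>h has_real_derivative \<beta> r) (at r)"
    and "u0 \<in> X0 \<Omega> \<sigma>" "set_integrable lborel \<Omega> (\<lambda>x. \<beta>h (u0 x))"
    and "0 \<le> S" "ereal S < T"
    and "weak_solution \<Omega> s \<sigma> g S T u u' w"
    and "S = 0 \<longrightarrow> (AE x in lborel. u 0 x = u0 x)"
    and "bochner_L2_loc S T (X0 \<Omega> s) (X0_norm s) u \<or>
         (\<exists>h. bochner_L2_loc S T (L2_space \<Omega>) (L2_norm \<Omega>) h \<and>
              (AE t in lebesgue_on (time_interval S T).
                 \<forall>z \<in> X0 \<Omega> s. u' t z = L2_inner \<Omega> (h t) z))"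
  shows "(\<forall>t \<in> time_interval0 S T. \<bar>energy \<Omega> \<sigma> gh (u t)\<bar> \<noteq> \<infinity>) \<and>
    (AE t in lebesgue_on (time_interval S T). \<exists>D.
       ((\<lambda>r. real_of_ereal (energy \<Omega> \<sigma> gh (u r))) has_real_derivative D) (at t) \<and>
       (X0_norm s (w t))\<^sup>2 + D = 0) \<and>
    (AE t in lebesgue_on (time_interval S T).
       ((\<lambda>r. real_of_ereal (energy \<Omega> \<sigma> gh (u r))) has_real_derivative u' t (w t)) (at t)) \<and>
    (\<forall>\<tau> \<in> time_interval0 S T. \<forall>t \<in> time_interval0 S T. \<tau> \<le> t \<longrightarrow>
       ereal (LINT r:{\<tau>..t}|lebesgue. (X0_norm s (w r))\<^sup>2) + energy \<Omega> \<sigma> gh (u t)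
         = energy \<Omega> \<sigma> gh (u \<tau>))"

proof -
  let ?I = "time_interval S T"
  note [simp] = time_interval_sets
  have \<Omega>: "bounded \<Omega>" "open \<Omega>" using assms(1) by (auto simp: smooth_bounded_domain_def)
  then have \<Omega>b: "\<Omega> \<in> sets borel" by simp
  have s: "0 < s" "s < 1" by fact+
  have sol: "weakly_continuous \<Omega> \<sigma> (time_interval0 S T) u" "has_time_derivative \<Omega> s ?I u u'"
    "bochner_L2 ?I (X0 \<Omega> s) (X0_norm s) w" "bochner_L2_loc S T (L2_space \<Omega>) (L2_norm \<Omega>) (\<lambda>t x. g (u t x))"
    and sol_eq: "AE t in lebesgue_on ?I. (\<forall>z \<in> X0 \<Omega> s. u' t z + frac_lap s (w t) z = 0) \<and>
        (\<forall>z \<in> X0 \<Omega> \<sigma>. L2_inner \<Omega> (w t) z = frac_lap \<sigma> (u t) z + L2_inner \<Omega> (\<lambda>x. g (u t x)) z)"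
    using assms(20) unfolding weak_solution_def by auto
  interpret X: semi_inner_space "X0 \<Omega> s" "frac_lap s" "X0_norm s" by (rule semi_inner_space_X0[OF s])
  interpret L2: semi_inner_space "L2_space \<Omega>" "L2_inner \<Omega>" "L2_norm \<Omega>" by (rule semi_inner_space_L2[OF \<Omega>b])
  obtain W where W_ext: "\<And>t. W t \<in> X0 \<Omega> s" "\<And>t. t \<notin> ?I \<Longrightarrow> W t = (\<lambda>_. 0)"
    "AE t in lebesgue_on ?I. W t = w t" "strongly_measurable UNIV (X0 \<Omega> s) (X0_norm s) W"
    "integrable lebesgue (\<lambda>t. (X0_norm s (W t))\<^sup>2)"
    by (rule X.bochner_L2_extend[OF sol(3) time_interval_sets]) (rule that)
  interpret cahn_hilliard_flow \<Omega> \<sigma> lam g gh s S T u W u'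
  proof
    show "bounded \<Omega>" "open \<Omega>" by fact+
    show "0 < \<sigma>" "\<sigma> < 1" "g 0 = 0" "0 < s" "s < 1" "0 \<le> lam" by fact+
    show "g differentiable at r" "- lam \<le> deriv g r" "(gh has_real_derivative g r) (at r)" for r
      using assms(6,10,13) by auto
    show "AE t in lebesgue_on ?I. \<forall>z\<in>X0 \<Omega> s. u' t z = - frac_lap s (W t) z"
      using sol_eq W_ext(3) by eventually_elim (auto simp: eq_neg_iff_add_eq_0)
    show "AE t in lebesgue_on ?I. (\<lambda>x. g (u t x)) \<in> L2_space \<Omega> \<and>
      (\<forall>z\<in>X0 \<Omega> \<sigma>. L2_inner \<Omega> (W t) z = frac_lap \<sigma> (u t) z + L2_inner \<Omega> (\<lambda>x. g (u t x)) z)"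
      using bochner_L2_loc_AE[OF sol(4)] sol_eq W_ext(3) by eventually_elim auto
  qed (use sol W_ext in auto)
  let ?n = "\<lambda>r. (X0_norm s (W r))\<^sup>2"
  \<comment> \<open>Both regularity hypotheses lead to the same statement on compact subintervals,
    which may begin at \<open>S\<close>.\<close>
  have step: "(\<forall>t\<in>{a..b}. fin_energy (u t)) \<and> real_energy (u b) - real_energy (u a) = - integral {a..b} ?n"
    if a: "S \<le> a" "a < b" "ereal b < T" for a b
  proof -
    have Sb: "S < b" using a by simp
    show ?thesis
      using assms(22)
    proof (elim disjE exE conjE)
      assume "bochner_L2_loc S T (X0 \<Omega> s) (X0_norm s) u"
      then obtain J where J: "J \<in> sets lebesgue" "{S<..b} \<subseteq> J" "J \<subseteq> ?I" "bochner_L2 J (X0 \<Omega> s) (X0_norm s) u"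
        by (rule bochner_L2_loc_interval[OF _ Sb a(3)]) (rule that)
      obtain U where U: "\<And>t. U t \<in> X0 \<Omega> s" "AE t in lebesgue_on J. U t = u t"
        "strongly_measurable UNIV (X0 \<Omega> s) (X0_norm s) U" "integrable lebesgue (\<lambda>t. (X0_norm s (U t))\<^sup>2)"
        by (rule X.bochner_L2_extend[OF J(4,1)]) (rule that)
      obtain N where N: "negligible N" "\<forall>t\<in>J - N. U t = u t"
        using U(2) unfolding AE_lebesgue_on_iff_negligible[OF J(1)] by blast
      \<comment> \<open>The set \<open>J\<close> covers (S, b], so the possible starting time
        \<open>S\<close> becomes exceptional.\<close>
      have N': "negligible (insert S N)" using N(1) by (simp add: negligible_insert)
      have eq: "U t = u t" if "t \<in> {a..b} - insert S N" for t using that N(2) J(2) a(1) by fastforce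
      show ?thesis using energy_identity_regular_u[OF a U(1,3,4) N' eq] by blast
    next
      fix h
      assume h: "bochner_L2_loc S T (L2_space \<Omega>) (L2_norm \<Omega>) h"
        and h_eq: "AE t in lebesgue_on ?I. \<forall>z \<in> X0 \<Omega> s. u' t z = L2_inner \<Omega> (h t) z"
      from h obtain J where J: "J \<in> sets lebesgue" "{S<..b} \<subseteq> J" "J \<subseteq> ?I" "bochner_L2 J (L2_space \<Omega>) (L2_norm \<Omega>) h"
        by (rule bochner_L2_loc_interval[OF _ Sb a(3)]) (rule that)
      obtain H where H: "\<And>t. H t \<in> L2_space \<Omega>" "AE t in lebesgue_on J. H t = h t"
        "strongly_measurable UNIV (L2_space \<Omega>) (L2_norm \<Omega>) H" "integrable lebesgue (\<lambda>t. (L2_norm \<Omega> (H t))\<^sup>2)"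
        by (rule L2.bochner_L2_extend[OF J(4,1)]) (rule that)
      obtain N where N: "negligible N" "\<forall>t\<in>J - N. H t = h t"
        using H(2) unfolding AE_lebesgue_on_iff_negligible[OF J(1)] by blast
      have "AE t in lebesgue_on ?I. \<forall>z\<in>X0 \<Omega> s. - frac_lap s (W t) z = L2_inner \<Omega> (h t) z"
        using h_eq u'_eq by eventually_elim auto
      then obtain N1 where N1: "negligible N1"
        "\<forall>t\<in>?I - N1. \<forall>z\<in>X0 \<Omega> s. - frac_lap s (W t) z = L2_inner \<Omega> (h t) z"
        unfolding AE_lebesgue_on_iff_negligible[OF time_interval_sets] by blast
      have N': "negligible (insert S (N \<union> N1))" using N(1) N1(1) by (simp add: negligible_insert negligible_Un)
      have eq: "- frac_lap s (W t) z = L2_inner \<Omega> (H t) z" if "t \<in> {a..b} - insert S (N \<union> N1)" "z \<in> X0 \<Omega> s" for t z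
      proof -
        have "t \<in> {S<..b}" using that(1) a(1) by auto
        then have "t \<in> J" using J(2) by blast
        then show ?thesis using that N(2) N1(2) J(3) by auto
      qed
      show ?thesis using energy_identity_regular_u'[OF a H(1,3,4) N' eq] by blast
    qed
  qed
  have fin: "fin_energy (u t)" if "t \<in> time_interval0 S T" for t
  proof -
    have t: "S \<le> t" "ereal t < T" using that by (auto simp: time_interval0_def)
    \<comment> \<open>\<open>step\<close> concerns proper intervals; a later time b exists because t
      < T, and [S, b] contains t.\<close>
    obtain b where "t < b" "ereal b < T" using ereal_dense2[OF t(2)] by auto
    then show ?thesis using step[of S b] t by auto
  qed
  have energy: "energy \<Omega> \<sigma> gh (u t) = ereal (real_energy (u t))" if "t \<in> time_interval0 S T" for t
    by (rule energy_eq_real_energy[OF fin[OF that]])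
  have identity: "real_energy (u t) - real_energy (u \<tau>) = - integral {\<tau>..t} ?n"
    if "S \<le> \<tau>" "\<tau> \<le> t" "ereal t < T" for \<tau> t
    using step[of \<tau> t] that by (cases "\<tau> = t") auto
  have deriv: "AE t in lebesgue_on ?I. ((\<lambda>r. real_of_ereal (energy \<Omega> \<sigma> gh (u r))) has_real_derivative - ?n t) (at t)"
  proof -
    \<comment> \<open>\<open>W\<close> vanishes outside the time interval and its squared norm is
      integrable on the whole line, so these intervals may run past T.\<close>
    have ni: "?n integrable_on {S..S + real k}" for k by (rule integrable_lebesgue_imp_integrable_on[OF W_ext(5)])
    have "\<exists>N. negligible N \<and> (\<forall>t\<in>{S<..<S + real k} - N. ((\<lambda>t. integral {S..t} ?n) has_real_derivative ?n t) (at t))" for k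
      using lebesgue_differentiation[OF ni[of k]] by metis
    then obtain N where N: "\<And>k. negligible (N k)"
      "\<And>k t. t \<in> {S<..<S + real k} - N k \<Longrightarrow> ((\<lambda>t. integral {S..t} ?n) has_real_derivative ?n t) (at t)"
      by metis
    have d: "((\<lambda>r. real_of_ereal (energy \<Omega> \<sigma> gh (u r))) has_real_derivative - ?n t) (at t)"
      if t: "t \<in> ?I - (\<Union>k. N k)" for t
    proof -
      obtain k :: nat where "t - S < real k" using reals_Archimedean2 by blast
      then have "t \<in> {S<..<S + real k} - N k" using t by (auto simp: time_interval_def)
      then have "((\<lambda>r. real_energy (u S) - integral {S..r} ?n) has_real_derivative - ?n t) (at t)"
        using N(2)[of t k] by (auto intro!: derivative_eq_intros)
      then show ?thesis
      proof (rule has_field_derivative_transform_within_open[OF _ open_time_interval])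
        show "t \<in> ?I" using t by simp
        fix r assume "r \<in> ?I"
        then have r: "S \<le> r" "ereal r < T" "r \<in> time_interval0 S T"
          by (auto simp: time_interval_def time_interval0_def)
        show "real_energy (u S) - integral {S..r} ?n = real_of_ereal (energy \<Omega> \<sigma> gh (u r))"
          using identity[OF order_refl r(1,2)] energy[OF r(3)] by simp
      qed
    qed
    have "negligible (\<Union>k. N k)" using N(1) by (rule negligible_Union_nat) 
    then show ?thesis unfolding AE_lebesgue_on_iff_negligible[OF time_interval_sets] using d by blast
  qed
  show ?thesis
  proof (intro conjI)
    show "\<forall>t \<in> time_interval0 S T. \<bar>energy \<Omega> \<sigma> gh (u t)\<bar> \<noteq> \<infinity>" using energy by simp
    show "AE t in lebesgue_on ?I. \<exists>D. ((\<lambda>r. real_of_ereal (energy \<Omega> \<sigma> gh (u r))) has_real_derivative D) (at t) \<and>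
       (X0_norm s (w t))\<^sup>2 + D = 0"
      using deriv W_ext(3)
    proof eventually_elim
      case (elim t)
      then show ?case by (intro exI[of _ "- ?n t"]) simp
    qed
    show "AE t in lebesgue_on ?I. ((\<lambda>r. real_of_ereal (energy \<Omega> \<sigma> gh (u r))) has_real_derivative u' t (w t)) (at t)"
      using deriv W_ext(3) u'_eq
    proof eventually_elim
      case (elim t)
      \<comment> \<open>The first equation tested with w(t) itself turns the slope into the duality
        pairing.\<close>
      have "u' t (w t) = - ?n t" using elim(2,3) W_ext(1)[of t] X.nrm_sq[OF W_ext(1)[of t]] by auto
      then show ?case using elim(1) by simp
    qed
    show "\<forall>\<tau> \<in> time_interval0 S T. \<forall>t \<in> time_interval0 S T. \<tau> \<le> t \<longrightarrow>
       ereal (LINT r:{\<tau>..t}|lebesgue. (X0_norm s (w r))\<^sup>2) + energy \<Omega> \<sigma> gh (u t) = energy \<Omega> \<sigma> gh (u \<tau>)"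
    proof (intro ballI impI)
      fix \<tau> t assume \<tau>t: "\<tau> \<in> time_interval0 S T" "t \<in> time_interval0 S T" "\<tau> \<le> t"
      have ai: "?n absolutely_integrable_on {\<tau>..t}" by (rule integrable_lebesgue_imp_integrable_on[OF W_ext(5)])
      have ae: "AE r in lebesgue. indicator {\<tau>..t} r *\<^sub>R ?n r = indicator {\<tau>..t} r *\<^sub>R (X0_norm s (w r))\<^sup>2"
      proof -
        have "AE r in lebesgue. r \<in> ?I \<longrightarrow> W r = w r" using W_ext(3) by (simp add: AE_restrict_space_iff)
        \<comment> \<open>The closed interval may contain \<open>S\<close>, where \<open>W\<close>
          is 0 by extension and \<open>w\<close> is unrelated to it.\<close>
        moreover have "AE r in lebesgue. r \<noteq> S"
          by (rule AE_not_in[of "{S}", simplified]) (simp add: negligible_iff_null_sets[symmetric])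
        ultimately show ?thesis
        proof eventually_elim
          case (elim r)
          have "r \<in> ?I" if "r \<in> {\<tau>..t}"
            using that elim(2) \<tau>t before_T[of r t] by (auto simp: time_interval_def time_interval0_def)
          then show ?case using elim(1) by (auto simp: indicator_def)
        qed
      qed
      have m: "(\<lambda>r. indicator {\<tau>..t} r *\<^sub>R ?n r) \<in> borel_measurable lebesgue"
        using ai by (simp add: set_integrable_def integrable_iff_bounded)
      have "(LINT r:{\<tau>..t}|lebesgue. (X0_norm s (w r))\<^sup>2) = (LINT r:{\<tau>..t}|lebesgue. ?n r)"
        unfolding set_lebesgue_integral_def
        using ae m borel_measurable_AE[OF m ae] by (intro integral_cong_AE) auto
      also have "\<dots> = integral {\<tau>..t} ?n" using ai by (rule set_lebesgue_integral_eq_integral)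
      finally show "ereal (LINT r:{\<tau>..t}|lebesgue. (X0_norm s (w r))\<^sup>2) + energy \<Omega> \<sigma> gh (u t) = energy \<Omega> \<sigma> gh (u \<tau>)"
        using identity[of \<tau> t] \<tau>t energy[OF \<tau>t(1)] energy[OF \<tau>t(2)] by (simp add: time_interval0_def)
    qed
  qed
qed

end
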